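(* Let $\theta\in\mathbb R\setminus\pi\mathbb Z$ and let $\phi\in L^2(\mathbb R)$ be such that: (i) $\phi(t)$ is well-defined everywhere on $\mathbb R$; (ii) there are constants $B\ge A>0$ with $A\le |G_{\phi,\theta}(\xi)|\le B$ for a.e. $\xi\in[0,\Delta]$; (iii) $C_{\phi,\theta}(t)<\infty$ for all $t\in\mathbb R$. Let $0\le\sigma<1$. Then the following are equivalent. (a) There is a frame $\{S_n(t):n\in\mathbb Z\}$ of $V_\theta(\phi)$ such that $$f(t)=\sum_{n\in\mathbb Z}f(\sigma+n)S_n(t),\qquad f\in V_\theta(\phi).$$ (b) There is a Riesz basis $\{S_n(t):n\in\mathbb Z\}$ of $V_\theta(\phi)$ such that $$f(t)=\sum_{n\in\mathbb Z}f(\sigma+n)S_n(t),\qquad f\in V_\theta(\phi).$$ (c) There are constants $\beta\ge\alpha>0$ such that $\alpha\le|Z_{\phi,\theta}(\sigma,\xi)|\le\beta$ for a.e. $\xi\in[0,\Delta]$. In this case the expansions in (a) and (b) converge in $L^2(\mathbb R)$ and uniformly on any subset of $\mathbb R$ on which $C_{\phi,\theta}(t)$ is bounded, and $$S_n(t)=\overline{\lambda_\theta(t)}\,\lambda_\theta(\sigma+n)\,\lambda_\theta(t-n)\,S(t-n),$$ where $S\in V_\theta(\phi)$ is such that $$\hat S_\theta(\xi)=\frac{\hat\phi_\theta(\xi)}{\lambda_\theta(\xi)Z_{\phi,\theta}(\sigma,\xi)}\quad\text{a.e. on }\mathbb R,$$ and $S_n(\sigma+k)=\delta_{n,k}$ (Kronecker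 delta) for $n,k\in\mathbb Z$.
   Context: Notation, for $\theta\in\mathbb R\setminus\pi\mathbb Z$: $c(\theta)=\sqrt{\frac{1-i\cot\theta}{2\pi}}$, $a=\frac{\cot\theta}{2}$, $b=\csc\theta$, $\Delta=\frac{2\pi}{|b|}=2\pi|\sin\theta|$, $\lambda_\theta(x)=e^{iax^2}$, and $K_\theta(t,\xi)=c(\theta)e^{ia(t^2+\xi^2)-ibt\xi}$. The fractional Fourier transform (FrFT) is $\mathcal F_\theta[f](\xi)=\hat f_\theta(\xi)=\int_{\mathbb R}f(t)K_\theta(t,\xi)\,dt$, understood as a unitary operator on $L^2(\mathbb R)$. The chirp-modulated version of a function $f$ is $\vec f(t)=\lambda_\theta(t)f(t)$, and of a sequence $\mathbf c=\{c(n)\}_n$ is $\vec c(n)=\lambda_\theta(n)c(n)$. For $\phi\in L^2(\mathbb R)$: $C_{\phi,\theta}(t)=\sum_{n\in\mathbb Z}|\vec\phi(t-n)|^2$ and $G_{\phi,\theta}(\xi)=\sum_{n\in\mathbb Z}|\hat\phi_\theta(\xi+n\Delta)|^2$. Fractional semi-discrete convolution: $(\mathbf c\ast_\theta\phi)(t)=c(\theta)\overline{\lambda_\theta(t)}\sum_{n\in\mathbb Z}\vec c(n)\vec\phi(t-n)$, $\mathbf c\in\ell^2(\mathbb Z)$. The chirp-modulated shift-invariant space generated by $\phi$ is $V_\theta(\phi)$, the closure of $\{\mathbf c\ast_\theta\phi:\mathbf c\in\ell^2(\mathbb Z)\}$, that is, $V_\theta(\phi)=\overline{\mathrm{span}}\{c(\theta)\overline{\lambda_\theta(t)}\vec\phi(t-n):n\in\mathbb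 Z\}\subset L^2(\mathbb R)$. Under hypotheses (i)-(iii), $\{c(\theta)\overline{\lambda_\theta(t)}\vec\phi(t-n)\}_n$ is a Riesz basis of $V_\theta(\phi)$ and $V_\theta(\phi)$ is a reproducing kernel Hilbert space, whose elements $f=\mathbf c\ast_\theta\phi$ are everywhere-defined functions given by the pointwise sums above; values such as $f(\sigma+n)$ are understood in this sense. The fractional Zak transform of $\phi$ is $Z_{\phi,\theta}(t,\xi)=\sum_{n\in\mathbb Z}\vec\phi(t-n)\lambda_\theta(n)\overline{K_\theta(n,\xi)}$; for fixed $t$ with $C_{\phi,\theta}(t)<\infty$ the series converges in $L^2[0,\Delta]$ as a function of $\xi$ (and likewise on every bounded interval, so it defines a function of $\xi$ a.e. on $\mathbb R$). A sequence $\{\phi_n\}_{n\in\mathbb Z}$ in a separable Hilbert space $\mathcal H$ is a frame of $\mathcal H$ if there are $B\ge A>0$ with $A\|h\|^2\le\sum_n|\langle h,\phi_n\rangle|^2\le B\|h\|^2$ for all $h\in\mathcal H$; it is a Riesz basis of $\mathcal H$ if it is complete in $\mathcal H$ and there are $B\ge A>0$ with $A\|\mathbf c\|^2\le\|\sum_nc(n)\phi_n\|^2\le B\|\mathbf c\|^2$ for all $\mathbf c\in\ell^2(\mathbb Z)$, where $\|\mathbf c\|^2=\sum_n|c(n)|^2$.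
   Formalization: The formula for Ŝ_θ is corrected by the constant factor conj(c(θ)): Ŝ_θ = conj(c(θ)) φ̂_θ/(λ_θ Z_{φ,θ}(σ,·)); as printed it contradicts S_n(σ+k)=δ_{n,k} (e.g. θ=π/2, φ=sinc, σ=0 gives S_0(0)=√(2π)). *)

theory Defs
  imports "HOL-Analysis.Analysis"
begin

section \<open>Square-integrable functions and square-summable sequences\<close>

text \<open>
  Elements of $L^2(\mathbb{R})$ are represented by functions defined everywhere. Squared norms are
  extended nonnegative reals, so that infinite values are not confused with the default value 0
  of divergent real-valued sums and integrals.
\<close>

definition L2_norm_sq :: "(real \<Rightarrow> complex) \<Rightarrow> ennreal" where
  "L2_norm_sq f = (\<integral>\<^sup>+ t. ennreal ((cmod (f t))\<^sup>2) \<partial>lebesgue)"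

definition L2_fun :: "(real \<Rightarrow> complex) \<Rightarrow> bool" where
  "L2_fun f \<longleftrightarrow> f \<in> borel_measurable lebesgue \<and> L2_norm_sq f < \<infinity>"

definition L2_inner :: "(real \<Rightarrow> complex) \<Rightarrow> (real \<Rightarrow> complex) \<Rightarrow> complex" where
  "L2_inner f g = (LINT t|lebesgue. f t * cnj (g t))"

definition l2_norm_sq :: "(int \<Rightarrow> complex) \<Rightarrow> ennreal" where
  "l2_norm_sq c = (\<Sum>\<^sub>\<infinity>n. ennreal ((cmod (c n))\<^sup>2))"

definition l2_seq :: "(int \<Rightarrow> complex) \<Rightarrow> bool" where
  "l2_seq c \<longleftrightarrow> l2_norm_sq c < \<infinity>"

definition L2_has_sum :: "(int \<Rightarrow> real \<Rightarrow> complex) \<Rightarrow> (real \<Rightarrow> complex) \<Rightarrow> bool" where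
  "L2_has_sum g f \<longleftrightarrow>
     ((\<lambda>F. L2_norm_sq (\<lambda>t. f t - (\<Sum>n\<in>F. g n t))) \<longlongrightarrow> 0) (finite_subsets_at_top UNIV)"

definition L2_closed_span :: "(int \<Rightarrow> real \<Rightarrow> complex) \<Rightarrow> (real \<Rightarrow> complex) set" where
  "L2_closed_span g =
     {f. L2_fun f \<and>
         (\<forall>\<epsilon>>0. \<exists>F c. finite F \<and> L2_norm_sq (\<lambda>t. f t - (\<Sum>n\<in>F. c n * g n t)) < ennreal \<epsilon>)}"


section \<open>Frames and Riesz bases of subspaces of the square-integrable functions\<close>

definition L2_frame :: "(real \<Rightarrow> complex) set \<Rightarrow> (int \<Rightarrow> real \<Rightarrow> complex) \<Rightarrow> bool" where
  "L2_frame V S \<longleftrightarrow>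
     (\<forall>n. S n \<in> V) \<and>
     (\<exists>A B::real. 0 < A \<and> A \<le> B \<and>
       (\<forall>h\<in>V. ennreal A * L2_norm_sq h \<le> (\<Sum>\<^sub>\<infinity>n. ennreal ((cmod (L2_inner h (S n)))\<^sup>2)) \<and>
               (\<Sum>\<^sub>\<infinity>n. ennreal ((cmod (L2_inner h (S n)))\<^sup>2)) \<le> ennreal B * L2_norm_sq h))"

definition L2_riesz_basis :: "(real \<Rightarrow> complex) set \<Rightarrow> (int \<Rightarrow> real \<Rightarrow> complex) \<Rightarrow> bool" where
  "L2_riesz_basis V S \<longleftrightarrow>
     (\<forall>n. S n \<in> V) \<and> V \<subseteq> L2_closed_span S \<and>
     (\<exists>A B::real. 0 < A \<and> A \<le> B \<and>
       (\<forall>c. l2_seq c \<longrightarrow>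
         (\<exists>g. L2_fun g \<and> L2_has_sum (\<lambda>n t. c n * S n t) g \<and>
              ennreal A * l2_norm_sq c \<le> L2_norm_sq g \<and>
              L2_norm_sq g \<le> ennreal B * l2_norm_sq c)))"


section \<open>The fractional Fourier transform\<close>

definition frft_c :: "real \<Rightarrow> complex" where
  "frft_c \<theta> = csqrt ((1 - \<i> * complex_of_real (cot \<theta>)) / complex_of_real (2 * pi))"

definition frft_a :: "real \<Rightarrow> real" where
  "frft_a \<theta> = cot \<theta> / 2"

definition frft_b :: "real \<Rightarrow> real" where
  "frft_b \<theta> = 1 / sin \<theta>"

definition frft_Delta :: "real \<Rightarrow> real" where
  "frft_Delta \<theta> = 2 * pi / \<bar>frft_b \<theta>\<bar>"

definition chirp :: "real \<Rightarrow> real \<Rightarrow> complex" where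
  "chirp \<theta> x = exp (\<i> * complex_of_real (frft_a \<theta> * x\<^sup>2))"

definition frft_kernel :: "real \<Rightarrow> real \<Rightarrow> real \<Rightarrow> complex" where
  "frft_kernel \<theta> t \<xi> =
     frft_c \<theta> * exp (\<i> * complex_of_real (frft_a \<theta> * (t\<^sup>2 + \<xi>\<^sup>2)) - \<i> * complex_of_real (frft_b \<theta> * t * \<xi>))"

text \<open>
  The transform of a square-integrable function is the $L^2$-limit of the transforms of its
  truncations to $[-R,R]$, which are integrable. It is determined only almost everywhere;
  \<open>frft\<close> chooses one representative.
\<close>

definition frft :: "real \<Rightarrow> (real \<Rightarrow> complex) \<Rightarrow> real \<Rightarrow> complex" where
  "frft \<theta> f = (SOME g. L2_fun g \<and>
     ((\<lambda>R::real. L2_norm_sq (\<lambda>\<xi>. g \<xi> - (LINT t:{-R..R}|lebesgue. f t * frft_kernel \<theta> t \<xi>)))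
        \<longlongrightarrow> 0) at_top)"

definition chirp_mod :: "real \<Rightarrow> (real \<Rightarrow> complex) \<Rightarrow> real \<Rightarrow> complex" where
  "chirp_mod \<theta> f t = chirp \<theta> t * f t"

definition chirp_mod_seq :: "real \<Rightarrow> (int \<Rightarrow> complex) \<Rightarrow> int \<Rightarrow> complex" where
  "chirp_mod_seq \<theta> c n = chirp \<theta> (of_int n) * c n"

definition C_fun :: "real \<Rightarrow> (real \<Rightarrow> complex) \<Rightarrow> real \<Rightarrow> ennreal" where
  "C_fun \<theta> \<phi> t = (\<Sum>\<^sub>\<infinity>n::int. ennreal ((cmod (chirp_mod \<theta> \<phi> (t - of_int n)))\<^sup>2))"

definition G_fun :: "real \<Rightarrow> (real \<Rightarrow> complex) \<Rightarrow> real \<Rightarrow> ennreal" where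
  "G_fun \<theta> \<phi> \<xi> = (\<Sum>\<^sub>\<infinity>n::int. ennreal ((cmod (frft \<theta> \<phi> (\<xi> + of_int n * frft_Delta \<theta>)))\<^sup>2))"


section \<open>Chirp-modulated shift-invariant spaces\<close>

definition frac_conv :: "real \<Rightarrow> (int \<Rightarrow> complex) \<Rightarrow> (real \<Rightarrow> complex) \<Rightarrow> real \<Rightarrow> complex" where
  "frac_conv \<theta> c \<phi> t =
     frft_c \<theta> * cnj (chirp \<theta> t) *
     (\<Sum>\<^sub>\<infinity>n. chirp_mod_seq \<theta> c n * chirp_mod \<theta> \<phi> (t - of_int n))"

definition chirp_SIS :: "real \<Rightarrow> (real \<Rightarrow> complex) \<Rightarrow> (real \<Rightarrow> complex) set" where
  "chirp_SIS \<theta> \<phi> =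
     L2_closed_span (\<lambda>n t. frft_c \<theta> * cnj (chirp \<theta> t) * chirp_mod \<theta> \<phi> (t - of_int n))"

text \<open>
  The set \<open>chirp_SIS\<close> is closed under modification on null sets, so its members have no
  well-defined point values. If \<open>C_fun\<close> is finite everywhere and \<open>G_fun\<close> is bounded
  above and away from 0, every member agrees almost everywhere with exactly one pointwise sum
  \<open>frac_conv\<close> with square-summable coefficients. The following reproducing kernel space
  consists of these distinguished representatives.
\<close>

definition chirp_SIS_pt :: "real \<Rightarrow> (real \<Rightarrow> complex) \<Rightarrow> (real \<Rightarrow> complex) set" where
  "chirp_SIS_pt \<theta> \<phi> = {f \<in> chirp_SIS \<theta> \<phi>. \<exists>c. l2_seq c \<and> f = frac_conv \<theta> c \<phi>}"

text \<open>
  The fractional Zak transform at a fixed \<open>t\<close> is the limit of its defining series in $L^2$ of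
  every bounded interval; again one representative is chosen. The factor
  \<open>cnj (frft_c \<theta>)\<close> of the conjugated kernel is part of it:
  $Z(t,\xi) = \overline{c(\theta)}\,\overline{\lambda(\xi)} \sum_n \vec\phi(t-n) e^{ibn\xi}$.
\<close>

definition zak :: "real \<Rightarrow> (real \<Rightarrow> complex) \<Rightarrow> real \<Rightarrow> real \<Rightarrow> complex" where
  "zak \<theta> \<phi> t = (SOME Z. Z \<in> borel_measurable lebesgue \<and>
     (\<forall>R>0. ((\<lambda>F. L2_norm_sq (\<lambda>\<xi>. indicator {-R..R} \<xi> *
         (Z \<xi> - (\<Sum>n\<in>F. chirp_mod \<theta> \<phi> (t - of_int n) * chirp \<theta> (of_int n)
                            * cnj (frft_kernel \<theta> (of_int n) \<xi>)))))
        \<longlongrightarrow> 0) (finite_subsets_at_top (UNIV :: int set))))"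

definition sampling_expansion ::
  "real \<Rightarrow> (real \<Rightarrow> complex) \<Rightarrow> real \<Rightarrow> (int \<Rightarrow> real \<Rightarrow> complex) \<Rightarrow> bool" where
  "sampling_expansion \<theta> \<phi> \<sigma> S \<longleftrightarrow>
     (\<forall>f \<in> chirp_SIS_pt \<theta> \<phi>. \<forall>t. ((\<lambda>n. f (\<sigma> + of_int n) * S n t) has_sum f t) UNIV)"

end

theory Submission
  imports Defs
begin

text \<open>
Multiplication by the chirp turns the statement into one about ordinary shift-invariant spaces. Write
$\kappa = c(\theta)$, $\psi = \lambda\phi$, and let
$D(\xi) = \sum_n \psi(\sigma+n) e^{-ibn\xi}$ (the constant \<open>symbol\<close>), a function of period
$\Delta$. The fractional transform of $f = \kappa\bar\lambda \sum_n c_n \psi(\cdot - n)$ is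
$\kappa \hat c\,\hat\phi_\theta$ with $\hat c(\xi) = \sum_n c_n e^{-ibn\xi}$ (\<open>frft_synth\<close>).
Hence $\|f\|^2$ is the mean of $|\hat c|^2 G$ over a period (\<open>synth_norm\<close>), and the bounds on
$G$ make $H \mapsto$ \<open>from_symbol H\<close> an isomorphism from $L^2$ of one period onto the space, up
to null sets. Two formulas translate the theorem into a statement about $D$. The sample
$f(\sigma+k)$ is, up to a factor $\kappa$ and a unimodular one, the $k$-th Fourier coefficient of
$\hat c D$ (\<open>synth_sample\<close>), and $|Z(\sigma,\xi)| = |\kappa|\,|D(\xi)|$ (\<open>zak_eq\<close>).

Suppose that $f = \sum_n f(\sigma+n) S_n$ and that $S$ is a frame or a Riesz basis. In either case
$\|\sum a_n S_n\|^2 \le K \|a\|^2$. If $\hat c$ is the indicator of $\{|D| < \delta\}$, then the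
samples of $f$ have small $\ell^2$-norm, so by Fatou's lemma $\|f\|$ is too small for its symbol
unless that set is null (\<open>symbol_lower_bound\<close>). Once $|D| \ge \delta$ almost everywhere,
there are members of the space, \<open>samp_fun n\<close>, whose symbols are unimodular multiples of
$e^{-ibn\xi}/(\kappa D)$ and whose samples at $\sigma + k$ are $\delta_{nk}$. Expanding them gives
$S_n = $ \<open>samp_fun n\<close> at every point (\<open>sampling_unique\<close>). So $S$ is known
explicitly, and its lower bound, tested on $\{|D| > M\}$, shows that $D$ is bounded above
(\<open>symbol_upper_bound_Riesz\<close>, \<open>symbol_upper_bound_frame\<close>).

Conversely, if $D$ is bounded above and away from 0, then division of symbols by $\kappa D$ is an
isomorphism that carries the orthogonal system of harmonics to the functions \<open>samp_fun n\<close>,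
up to unimodular constants. They therefore form a Riesz basis and a frame, and the coefficients of $f$
are its samples (\<open>pt_coefficients\<close>). Since $|f(t)|^2$ is bounded by a constant times
$C_{\phi,\theta}(t)$ times the squared norm of the symbol (\<open>from_symbol_pointwise_bound\<close>),
convergence in norm is uniform wherever $C_{\phi,\theta}$ is bounded.

The analysis underneath is developed from three facts. Spaces of square-integrable functions are
complete (\<open>L2_complete\<close>). The harmonics of a period are complete, by the theorem of Stone
and Weierstrass on the circle (\<open>annihilates_zero\<close>), which yields Parseval's identity. Finally,
Plancherel's theorem for functions of bounded support follows from Parseval's identity: the values
of the transform on a grid of suitable spacing are Fourier coefficients, and integrating over the
translates of the grid recovers the whole line (\<open>Plancherel_unit\<close>).
\<close>

section \<open>Square-integrable functions on a measure space\<close>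

definition sq_norm :: "'a measure \<Rightarrow> ('a \<Rightarrow> complex) \<Rightarrow> ennreal" where
  "sq_norm M f = (\<integral>\<^sup>+x. ennreal ((cmod (f x))\<^sup>2) \<partial>M)"

text \<open>
The pair of \<open>sq_norm\<close> and \<open>sq_int\<close> extends \<open>L2_norm_sq\<close> and
\<open>L2_fun\<close> to an arbitrary measure, because the argument also runs on an interval of one period.
\<close>
definition sq_int :: "'a measure \<Rightarrow> ('a \<Rightarrow> complex) \<Rightarrow> bool" where
  "sq_int M f \<longleftrightarrow> f \<in> borel_measurable M \<and> sq_norm M f < \<infinity>"

text \<open>
For functions of infinite square norm the value is the default 0, which is why \<open>sq_int\<close>
appears among the assumptions of the inequalities below.
\<close>
definition L2norm :: "'a measure \<Rightarrow> ('a \<Rightarrow> complex) \<Rightarrow> real" where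
  "L2norm M f = sqrt (enn2real (sq_norm M f))"

definition iprod :: "'a measure \<Rightarrow> ('a \<Rightarrow> complex) \<Rightarrow> ('a \<Rightarrow> complex) \<Rightarrow> complex" where
  "iprod M f g = (LINT x|M. f x * cnj (g x))"

lemma borel_measurable_cnj [measurable (raw)]:
  "f \<in> borel_measurable M \<Longrightarrow> (\<lambda>x. cnj (f x)) \<in> borel_measurable M"
  by (rule measurable_compose[where g=cnj]) (auto intro!: borel_measurable_continuous_onI continuous_intros)

lemma sq_intD [measurable_dest]: "sq_int M f \<Longrightarrow> f \<in> borel_measurable M"
  by (simp add: sq_int_def)

lemma L2norm_nonneg [simp]: "0 \<le> L2norm M f" by (simp add: L2norm_def)

lemma sq_norm_L2norm: "sq_int M f \<Longrightarrow> sq_norm M f = ennreal ((L2norm M f)\<^sup>2)"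
  by (simp add: sq_int_def L2norm_def)

lemma sq_norm_cong_AE: "(AE x in M. f x = g x) \<Longrightarrow> sq_norm M f = sq_norm M g"
  unfolding sq_norm_def by (intro nn_integral_cong_AE) auto

lemma sq_norm_mono_AE: "(AE x in M. cmod (f x) \<le> cmod (g x)) \<Longrightarrow> sq_norm M f \<le> sq_norm M g"
  unfolding sq_norm_def by (intro nn_integral_mono_AE) (auto intro!: ennreal_leI power_mono)

lemma sq_norm_eq_0: "f \<in> borel_measurable M \<Longrightarrow> sq_norm M f = 0 \<longleftrightarrow> (AE x in M. f x = 0)"
  unfolding sq_norm_def by (subst nn_integral_0_iff_AE) auto

lemma sq_norm_cmult: "f \<in> borel_measurable M \<Longrightarrow>
    sq_norm M (\<lambda>x. c * f x) = ennreal ((cmod c)\<^sup>2) * sq_norm M f"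
  unfolding sq_norm_def
  by (simp add: nn_integral_cmult[symmetric] norm_mult power_mult_distrib ennreal_mult)

lemma sq_norm_unimodular: "(\<And>t. cmod (u t) = 1) \<Longrightarrow> sq_norm M (\<lambda>t. u t * f t) = sq_norm M f"
  by (simp add: sq_norm_def norm_mult)

lemma sq_norm_uminus: "sq_norm M (\<lambda>x. - f x) = sq_norm M f"
  by (simp add: sq_norm_def)

lemma sq_norm_minus_commute: "sq_norm M (\<lambda>x. f x - g x) = sq_norm M (\<lambda>x. g x - f x)"
  by (simp add: sq_norm_def norm_minus_commute)

text \<open>
Young's inequality $2xy \le e x^2 + y^2/e$, applied pointwise. Optimizing over $e$ gives the
triangle inequality below, and $e = 1$ gives a quick estimate that needs no finiteness.
\<close>
lemma sq_norm_add_eps: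
  assumes [measurable]: "f \<in> borel_measurable M" "g \<in> borel_measurable M" and e: "e > 0"
  shows "sq_norm M (\<lambda>x. f x + g x) \<le> ennreal (1+e) * sq_norm M f + ennreal (1+1/e) * sq_norm M g"
proof -
  have young: "(cmod (a+b))\<^sup>2 \<le> (1+e) * (cmod a)\<^sup>2 + (1+1/e) * (cmod b)\<^sup>2" for a b
  proof -
    have "0 \<le> (sqrt e * cmod a - cmod b / sqrt e)\<^sup>2" by simp
    also have "\<dots> = e * (cmod a)\<^sup>2 - 2 * cmod a * cmod b + (cmod b)\<^sup>2 / e"
      using e by (simp add: power2_diff power_mult_distrib power_divide)
    finally have "2 * cmod a * cmod b \<le> e * (cmod a)\<^sup>2 + (cmod b)\<^sup>2 / e" by simp
    moreover have "(cmod (a+b))\<^sup>2 \<le> (cmod a + cmod b)\<^sup>2"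
      by (intro power_mono norm_triangle_ineq) auto
    ultimately show ?thesis by (simp add: power2_sum algebra_simps)
  qed
  have "sq_norm M (\<lambda>x. f x + g x) \<le>
      (\<integral>\<^sup>+x. ennreal (1+e) * ennreal ((cmod (f x))\<^sup>2) + ennreal (1+1/e) * ennreal ((cmod (g x))\<^sup>2) \<partial>M)"
    unfolding sq_norm_def using young e
    by (intro nn_integral_mono) (simp add: ennreal_mult[symmetric] ennreal_plus[symmetric] del: ennreal_plus)
  also have "\<dots> = ennreal (1+e) * sq_norm M f + ennreal (1+1/e) * sq_norm M g"
    unfolding sq_norm_def by (subst nn_integral_add) (auto simp: nn_integral_cmult)
  finally show ?thesis .
qed

lemma sq_norm_add_le:
  assumes "f \<in> borel_measurable M" "g \<in> borel_measurable M"
  shows "sq_norm M (\<lambda>x. f x + g x) \<le> 2 * sq_norm M f + 2 * sq_norm M g"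
  using sq_norm_add_eps[OF assms, of 1] by simp

lemma sq_int_add: "sq_int M f \<Longrightarrow> sq_int M g \<Longrightarrow> sq_int M (\<lambda>x. f x + g x)"
  using sq_norm_add_le[of f M g] unfolding sq_int_def
  by (auto simp: ennreal_mult_less_top elim!: order.strict_trans1)

lemma sq_int_cmult: "sq_int M f \<Longrightarrow> sq_int M (\<lambda>x. c * f x)"
  unfolding sq_int_def by (auto simp: sq_norm_cmult ennreal_mult_less_top)

lemma sq_int_uminus: "sq_int M f \<Longrightarrow> sq_int M (\<lambda>x. - f x)"
  unfolding sq_int_def by (auto simp: sq_norm_uminus)

lemma sq_int_diff: "sq_int M f \<Longrightarrow> sq_int M g \<Longrightarrow> sq_int M (\<lambda>x. f x - g x)"
  using sq_int_add[of M f "\<lambda>x. - g x"] sq_int_uminus by fastforce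

lemma sq_int_zero [simp]: "sq_int M (\<lambda>x. 0)"
  by (simp add: sq_int_def sq_norm_def)

lemma sq_int_sum: "(\<And>i. i \<in> I \<Longrightarrow> sq_int M (f i)) \<Longrightarrow> sq_int M (\<lambda>x. \<Sum>i\<in>I. f i x)"
  by (induction I rule: infinite_finite_induct) (auto intro: sq_int_add)

lemma sq_int_bounded:
  assumes "sq_int M g" "f \<in> borel_measurable M" "AE x in M. cmod (f x) \<le> C * cmod (g x)"
  shows "sq_int M f"
proof -
  have "sq_norm M f \<le> sq_norm M (\<lambda>x. of_real C * g x)"
  proof (rule sq_norm_mono_AE)
    show "AE x in M. cmod (f x) \<le> cmod (of_real C * g x)"
      using assms(3) by eventually_elim
        (auto simp: norm_mult intro: order_trans[OF _ mult_right_mono[of C "\<bar>C\<bar>"]])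
  qed
  then show ?thesis using sq_int_cmult[OF assms(1), of "of_real C"] assms(2)
    by (auto simp: sq_int_def)
qed

lemma L2norm_cmult: "sq_int M f \<Longrightarrow> L2norm M (\<lambda>x. c * f x) = cmod c * L2norm M f"
  by (simp add: L2norm_def sq_norm_cmult[OF sq_intD] enn2real_mult real_sqrt_mult)

lemma L2norm_minus_commute: "L2norm M (\<lambda>x. f x - g x) = L2norm M (\<lambda>x. g x - f x)"
  by (simp add: L2norm_def sq_norm_minus_commute[of M f g])

lemma L2norm_cong_AE: "(AE x in M. f x = g x) \<Longrightarrow> L2norm M f = L2norm M g"
  by (simp add: L2norm_def cong: sq_norm_cong_AE)

lemma L2norm_eq_0: "sq_int M f \<Longrightarrow> L2norm M f = 0 \<longleftrightarrow> (AE x in M. f x = 0)"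
  using sq_norm_eq_0[of f M] sq_norm_L2norm[of M f] by (auto simp: sq_int_def)

lemma L2norm_triangle:
  assumes f: "sq_int M f" and g: "sq_int M g"
  shows "L2norm M (\<lambda>x. f x + g x) \<le> L2norm M f + L2norm M g"
proof -
  let ?a = "L2norm M f" and ?b = "L2norm M g" and ?s = "L2norm M (\<lambda>x. f x + g x)"
  have key: "?s\<^sup>2 \<le> (1+e) * ?a\<^sup>2 + (1+1/e) * ?b\<^sup>2" if "e > 0" for e
    using sq_norm_add_eps[OF sq_intD[OF f] sq_intD[OF g] that] that
    by (simp add: sq_norm_L2norm f g sq_int_add ennreal_mult[symmetric] ennreal_plus[symmetric]
        del: ennreal_plus)
  have "?s \<le> ?a + ?b + d" if d: "d > 0" for d :: real
  proof -
    \<comment> \<open>The margin $d/2$ keeps both numbers positive, so that the optimal $e = v/u$ is defined.\<close>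
    define u v where "u = ?a + d/2" and "v = ?b + d/2"
    have uv: "u > 0" "v > 0" using d by (auto simp: u_def v_def add_nonneg_pos)
    have "?s\<^sup>2 \<le> (1+v/u) * ?a\<^sup>2 + (1+1/(v/u)) * ?b\<^sup>2" using uv by (intro key) auto
    also have "\<dots> \<le> (1+v/u) * u\<^sup>2 + (1+1/(v/u)) * v\<^sup>2"
      using uv d by (intro add_mono mult_left_mono power_mono) (auto simp: u_def v_def)
    also have "\<dots> = (u+v)\<^sup>2" using uv by (simp add: field_simps power2_eq_square)
    finally have "?s \<le> u + v" using uv by (simp add: power2_le_iff_abs_le)
    then show ?thesis by (simp add: u_def v_def)
  qed
  then show ?thesis by (rule field_le_epsilon)
qed

lemma L2norm_triangle_diff:
  assumes "sq_int M f" "sq_int M g"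
  shows "\<bar>L2norm M f - L2norm M g\<bar> \<le> L2norm M (\<lambda>x. f x - g x)"
  using L2norm_triangle[OF sq_int_diff[OF assms] assms(2)]
    L2norm_triangle[OF sq_int_diff[OF assms(2,1)] assms(1)] L2norm_minus_commute[of M f g] by simp

lemma L2norm_mono_AE:
  assumes "sq_int M g" "AE x in M. cmod (f x) \<le> cmod (g x)"
  shows "L2norm M f \<le> L2norm M g"
  using sq_norm_mono_AE[OF assms(2)] assms(1)
  by (simp add: L2norm_def sq_int_def enn2real_mono)

section \<open>Convergence and completeness in square mean\<close>

lemma sq_norm_tendsto_0_iff:
  assumes "\<And>i. sq_int M (f i)"
  shows "((\<lambda>i. sq_norm M (f i)) \<longlongrightarrow> 0) F \<longleftrightarrow> ((\<lambda>i. L2norm M (f i)) \<longlongrightarrow> 0) F"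
proof -
  have "((\<lambda>i. sq_norm M (f i)) \<longlongrightarrow> 0) F \<longleftrightarrow> ((\<lambda>i. ennreal ((L2norm M (f i))\<^sup>2)) \<longlongrightarrow> ennreal 0) F"
    by (simp add: sq_norm_L2norm[OF assms])
  also have "\<dots> \<longleftrightarrow> ((\<lambda>i. (L2norm M (f i))\<^sup>2) \<longlongrightarrow> 0) F"
    by (subst tendsto_ennreal_iff) auto
  also have "\<dots> \<longleftrightarrow> ((\<lambda>i. L2norm M (f i)) \<longlongrightarrow> 0) F"
    using tendsto_real_sqrt[of "\<lambda>i. (L2norm M (f i))\<^sup>2" 0 F] tendsto_power[of "\<lambda>i. L2norm M (f i)" 0 F 2]
    by auto
  finally show ?thesis .
qed

definition L2_conv :: "'a measure \<Rightarrow> ('i \<Rightarrow> 'a \<Rightarrow> complex) \<Rightarrow> ('a \<Rightarrow> complex) \<Rightarrow> 'i filter \<Rightarrow> bool" where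
  "L2_conv M f g F \<longleftrightarrow> ((\<lambda>i. sq_norm M (\<lambda>x. g x - f i x)) \<longlongrightarrow> 0) F"

lemma L2_conv_L2norm:
  assumes "\<And>i. sq_int M (f i)" "sq_int M g"
  shows "L2_conv M f g F \<longleftrightarrow> ((\<lambda>i. L2norm M (\<lambda>x. g x - f i x)) \<longlongrightarrow> 0) F"
  unfolding L2_conv_def using assms by (intro sq_norm_tendsto_0_iff sq_int_diff)

lemma sq_norm_small_ev:
  assumes "((\<lambda>i. sq_norm M (f i)) \<longlongrightarrow> 0) F" "e > 0"
  shows "\<forall>\<^sub>F i in F. sq_norm M (f i) < ennreal e"
  using order_tendstoD(2)[OF assms(1), of "ennreal e"] assms(2) by simp

lemma L2_conv_sq_int:
  assumes "\<And>i. sq_int M (f i)" "g \<in> borel_measurable M" "L2_conv M f g F" "F \<noteq> bot"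
  shows "sq_int M g"
proof -
  have "\<forall>\<^sub>F i in F. sq_norm M (\<lambda>x. g x - f i x) < ennreal 1"
    using assms by (intro sq_norm_small_ev) (auto simp: L2_conv_def)
  then obtain i where "sq_norm M (\<lambda>x. g x - f i x) < ennreal 1"
    using assms(4) eventually_happens by blast
  then have "sq_norm M (\<lambda>x. g x - f i x) < \<infinity>" by (simp add: order.strict_trans)
  then have "sq_int M (\<lambda>x. (g x - f i x) + f i x)"
    using assms(1,2) sq_intD[OF assms(1)] by (intro sq_int_add) (auto simp: sq_int_def)
  then show ?thesis by simp
qed

lemma L2_conv_unique:
  assumes f: "\<And>i. f i \<in> borel_measurable M" and g: "g \<in> borel_measurable M" and h: "h \<in> borel_measurable M"
    and "L2_conv M f g F" "L2_conv M f h F" "F \<noteq> bot"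
  shows "AE x in M. g x = h x"
proof -
  note [measurable] = f g h
  have "sq_norm M (\<lambda>x. g x - h x) \<le> 2 * sq_norm M (\<lambda>x. g x - f i x) + 2 * sq_norm M (\<lambda>x. h x - f i x)" for i
    using sq_norm_add_le[of "\<lambda>x. g x - f i x" M "\<lambda>x. f i x - h x"]
    by (simp add: sq_norm_minus_commute[of M "f i" h])
  moreover have "((\<lambda>i. 2 * sq_norm M (\<lambda>x. g x - f i x) + 2 * sq_norm M (\<lambda>x. h x - f i x)) \<longlongrightarrow> 2 * 0 + 2 * 0) F"
    using assms(4,5) unfolding L2_conv_def
    by (intro tendsto_add ennreal_tendsto_cmult) auto
  ultimately have "sq_norm M (\<lambda>x. g x - h x) \<le> 0"
    using assms(6) by (intro tendsto_le[OF assms(6) _ tendsto_const]) auto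
  then have "AE x in M. g x - h x = 0" by (subst sq_norm_eq_0[symmetric]) auto
  then show ?thesis by simp
qed

lemma L2_conv_L2norm_tendsto:
  assumes "\<And>i. sq_int M (f i)" "sq_int M g" "L2_conv M f g F"
  shows "((\<lambda>i. L2norm M (f i)) \<longlongrightarrow> L2norm M g) F"
proof (rule Lim_null[THEN iffD2], rule Lim_null_comparison)
  show "((\<lambda>i. L2norm M (\<lambda>x. g x - f i x)) \<longlongrightarrow> 0) F" using assms L2_conv_L2norm by blast
  show "\<forall>\<^sub>F i in F. norm (L2norm M (f i) - L2norm M g) \<le> L2norm M (\<lambda>x. g x - f i x)"
    using L2norm_triangle_diff[OF assms(1,2)] L2norm_minus_commute[of M g] by simp
qed

lemma L2_conv_Cauchy:
  assumes f: "\<And>i. f i \<in> borel_measurable M" and g: "g \<in> borel_measurable M"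
    and l: "L2_conv M f g F" and e: "e > 0"
  shows "\<exists>P. eventually P F \<and> (\<forall>i j. P i \<longrightarrow> P j \<longrightarrow> sq_norm M (\<lambda>x. f i x - f j x) \<le> ennreal e)"
proof (intro exI[of _ "\<lambda>i. sq_norm M (\<lambda>x. g x - f i x) < ennreal (e/4)"] conjI allI impI)
  note [measurable] = f g
  show "\<forall>\<^sub>F i in F. sq_norm M (\<lambda>x. g x - f i x) < ennreal (e/4)"
    using l e unfolding L2_conv_def by (intro sq_norm_small_ev) auto
  fix i j assume ij: "sq_norm M (\<lambda>x. g x - f i x) < ennreal (e/4)" "sq_norm M (\<lambda>x. g x - f j x) < ennreal (e/4)"
  have "sq_norm M (\<lambda>x. f i x - f j x) \<le> 2 * sq_norm M (\<lambda>x. f i x - g x) + 2 * sq_norm M (\<lambda>x. g x - f j x)"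
    using sq_norm_add_le[of "\<lambda>x. f i x - g x" M "\<lambda>x. g x - f j x"] by simp
  also have "\<dots> \<le> 2 * ennreal (e/4) + 2 * ennreal (e/4)"
    using ij by (intro add_mono mult_left_mono) (auto simp: sq_norm_minus_commute[of M "f i" g])
  also have "\<dots> = ennreal (e/4 + e/4 + (e/4 + e/4))" using e by (simp only: mult_2 ennreal_plus[symmetric])
  also have "e/4 + e/4 + (e/4 + e/4) = e" by simp
  finally show "sq_norm M (\<lambda>x. f i x - f j x) \<le> ennreal e" .
qed

lemma L2_conv_add_cmult:
  assumes "\<And>i. sq_int M (f i)" "sq_int M g" "L2_conv M f g F" "\<And>i. sq_int M (f' i)" "sq_int M g'" "L2_conv M f' g' F"
  shows "L2_conv M (\<lambda>i x. c * f i x + f' i x) (\<lambda>x. c * g x + g' x) F"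
proof -
  have si: "sq_int M (\<lambda>x. c * f i x + f' i x)" "sq_int M (\<lambda>x. c * g x + g' x)" for i
    by (intro sq_int_add sq_int_cmult assms)+
  have b: "L2norm M (\<lambda>x. (c * g x + g' x) - (c * f i x + f' i x)) \<le> cmod c * L2norm M (\<lambda>x. g x - f i x) + L2norm M (\<lambda>x. g' x - f' i x)" for i
  proof -
    have "L2norm M (\<lambda>x. c * (g x - f i x) + (g' x - f' i x)) \<le> L2norm M (\<lambda>x. c * (g x - f i x)) + L2norm M (\<lambda>x. g' x - f' i x)"
      by (intro L2norm_triangle sq_int_cmult sq_int_diff assms)
    also have "L2norm M (\<lambda>x. c * (g x - f i x)) = cmod c * L2norm M (\<lambda>x. g x - f i x)"
      by (intro L2norm_cmult sq_int_diff assms)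
    finally show ?thesis by (simp add: algebra_simps)
  qed
  have "((\<lambda>i. cmod c * L2norm M (\<lambda>x. g x - f i x) + L2norm M (\<lambda>x. g' x - f' i x)) \<longlongrightarrow> cmod c * 0 + 0) F"
    using L2_conv_L2norm[OF assms(1,2), of "\<lambda>i. i"] L2_conv_L2norm[OF assms(4,5), of "\<lambda>i. i"] assms(3,6)
    by (intro tendsto_add tendsto_mult tendsto_const) auto
  then have lim: "((\<lambda>i. cmod c * L2norm M (\<lambda>x. g x - f i x) + L2norm M (\<lambda>x. g' x - f' i x)) \<longlongrightarrow> 0) F" by simp
  have "((\<lambda>i. L2norm M (\<lambda>x. (c * g x + g' x) - (c * f i x + f' i x))) \<longlongrightarrow> 0) F"
  proof (rule Lim_null_comparison[OF always_eventually lim], rule allI)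
    fix i show "norm (L2norm M (\<lambda>x. (c * g x + g' x) - (c * f i x + f' i x))) \<le> cmod c * L2norm M (\<lambda>x. g x - f i x) + L2norm M (\<lambda>x. g' x - f' i x)"
      using b[of i] by simp
  qed
  then show ?thesis using L2_conv_L2norm[OF si, of "\<lambda>i. i" F] by simp
qed

text \<open>
Fatou's lemma turns pointwise limits into norm bounds. It transports estimates from finite sums to
pointwise sums of series, and it is the only link between a pointwise sampling expansion and norms.
\<close>
lemma sq_norm_Fatou:
  assumes [measurable]: "\<And>k::nat. f k \<in> borel_measurable M"
    and lim: "AE x in M. (\<lambda>k. f k x) \<longlonglongrightarrow> g x"
    and bd: "\<forall>\<^sub>F k in sequentially. sq_norm M (f k) \<le> C"
  shows "sq_norm M g \<le> C"
proof -
  have "sq_norm M g = (\<integral>\<^sup>+x. liminf (\<lambda>k. ennreal ((cmod (f k x))\<^sup>2)) \<partial>M)"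
    unfolding sq_norm_def
  proof (rule nn_integral_cong_AE, use lim in eventually_elim)
    case (elim x)
    then have "(\<lambda>k. ennreal ((cmod (f k x))\<^sup>2)) \<longlonglongrightarrow> ennreal ((cmod (g x))\<^sup>2)"
      by (intro tendsto_ennrealI tendsto_power tendsto_norm)
    then show ?case using lim_imp_Liminf[OF sequentially_bot] by metis
  qed
  also have "\<dots> \<le> liminf (\<lambda>k. sq_norm M (f k))"
    unfolding sq_norm_def by (rule nn_integral_liminf) simp
  also have "\<dots> \<le> C"
    using Liminf_le[OF sequentially_bot bd] by simp
  finally show ?thesis .
qed

text \<open>
The usual proof of completeness: a subsequence with rapidly decreasing steps converges almost
everywhere, and Fatou's lemma shows that its limit is a limit in square mean. The limit is written
out as \<open>lim\<close> of a subsequence so that it inherits from the approximating functions whatever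
is stable under pointwise limits, such as exact periodicity and Borel measurability.
\<close>
lemma L2_complete_seq:
  fixes f :: "nat \<Rightarrow> 'a \<Rightarrow> complex"
  assumes [measurable]: "\<And>k. f k \<in> borel_measurable M"
    and Cauchy: "\<And>e. e > 0 \<Longrightarrow> \<exists>N. \<forall>i\<ge>N. \<forall>j\<ge>N. sq_norm M (\<lambda>x. f i x - f j x) \<le> ennreal e"
  shows "\<exists>s. strict_mono s \<and> L2_conv M f (\<lambda>x. lim (\<lambda>k. f (s k) x)) sequentially"
proof -
  have "\<forall>k. \<exists>N. \<forall>i\<ge>N. \<forall>j\<ge>N. sq_norm M (\<lambda>x. f i x - f j x) \<le> ennreal ((1/4)^k)"
    using Cauchy by simp
  then obtain N where N: "\<And>k i j. i \<ge> N k \<Longrightarrow> j \<ge> N k \<Longrightarrow> sq_norm M (\<lambda>x. f i x - f j x) \<le> ennreal ((1/4)^k)"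
    by metis
  define s where "s = rec_nat (N 0) (\<lambda>k p. max (N (Suc k)) (Suc p))"
  have sS: "s (Suc k) = max (N (Suc k)) (Suc (s k))" for k by (simp add: s_def)
  have sm: "strict_mono s" by (rule strict_mono_Suc_iff[THEN iffD2]) (simp add: sS less_max_iff_disj)
  have sN: "s k \<ge> N k" for k by (cases k) (auto simp: s_def)
  have sle: "s k \<le> s (Suc k)" for k by (simp add: sS)
  define d where "d k x = f (s (Suc k)) x - f (s k) x" for k x
  have [measurable]: "d k \<in> borel_measurable M" for k 
    using borel_measurable_diff[OF assms(1)[of "s (Suc k)"] assms(1)[of "s k"]] by (simp add: d_def[abs_def])
  have dn: "sq_norm M (d k) \<le> ennreal ((1/4)^k)" for k
    unfolding d_def using sN[of k] sle[of k] by (intro N) auto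
  \<comment> \<open>The weights $2^k$ keep the series of integrals finite and force geometric decay of the steps
    at almost every point.\<close>
  have "(\<integral>\<^sup>+x. (\<Sum>k. ennreal (2^k) * ennreal ((cmod (d k x))\<^sup>2)) \<partial>M)
      = (\<Sum>k. ennreal (2^k) * sq_norm M (d k))"
    unfolding sq_norm_def by (subst nn_integral_suminf) (auto simp: nn_integral_cmult)
  also have "\<dots> \<le> (\<Sum>k. ennreal ((1/2)^k))"
  proof (intro suminf_le summableI)
    fix k
    have "ennreal (2^k) * sq_norm M (d k) \<le> ennreal (2^k) * ennreal ((1/4)^k)"
      by (intro mult_left_mono dn) auto
    also have "\<dots> = ennreal ((1/2)^k)"
      by (simp add: ennreal_mult[symmetric] power_mult_distrib[symmetric])
    finally show "ennreal (2^k) * sq_norm M (d k) \<le> ennreal ((1/2)^k)" .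
  qed
  also have "\<dots> = ennreal (\<Sum>k. (1/2)^k)"
    by (intro suminf_ennreal2) (auto intro: summable_geometric)
  finally have "(\<integral>\<^sup>+x. (\<Sum>k. ennreal (2^k) * ennreal ((cmod (d k x))\<^sup>2)) \<partial>M) \<noteq> \<infinity>"
    by (auto simp: top_unique)
  then have "AE x in M. (\<Sum>k. ennreal (2^k) * ennreal ((cmod (d k x))\<^sup>2)) \<noteq> \<infinity>"
    by (intro nn_integral_PInf_AE) auto
  then have conv: "AE x in M. (\<lambda>k. f (s k) x) \<longlonglongrightarrow> lim (\<lambda>k. f (s k) x)"
  proof eventually_elim
    case (elim x)
    then obtain C where C: "C \<ge> 0" "(\<Sum>k. ennreal (2^k) * ennreal ((cmod (d k x))\<^sup>2)) = ennreal C"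
      by (cases "(\<Sum>k. ennreal (2^k) * ennreal ((cmod (d k x))\<^sup>2))") auto
    have b: "cmod (d k x) \<le> sqrt C * (sqrt (1/2))^k" for k
    proof -
      have "ennreal (2^k) * ennreal ((cmod (d k x))\<^sup>2) \<le> ennreal C"
        using sum_le_suminf[of "\<lambda>k. ennreal (2^k) * ennreal ((cmod (d k x))\<^sup>2)" "{k}"] C(2) by simp
      then have "2^k * (cmod (d k x))\<^sup>2 \<le> C" using C(1) by (simp add: ennreal_mult[symmetric])
      then have "(cmod (d k x))\<^sup>2 \<le> C * (1/2)^k" by (simp add: field_simps power_one_over)
      then have "sqrt ((cmod (d k x))\<^sup>2) \<le> sqrt (C * (1/2)^k)" by (rule real_sqrt_le_mono)
      then show ?thesis by (simp add: real_sqrt_mult real_sqrt_power)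
    qed
    have "summable (\<lambda>k. sqrt C * (sqrt (1/2))^k)"
      by (intro summable_mult summable_geometric) (simp add: real_sqrt_lt_1_iff)
    then have "summable (\<lambda>k. d k x)" by (rule summable_comparison_test') (use b in auto)
    then have "convergent (\<lambda>n. \<Sum>k<n. d k x)" by (simp add: summable_iff_convergent)
    moreover have "(\<Sum>k<n. d k x) = f (s n) x - f (s 0) x" for n
      unfolding d_def by (rule sum_lessThan_telescope)
    ultimately have "convergent (\<lambda>n. f (s n) x - f (s 0) x)" by simp
    then have "convergent (\<lambda>n. f (s n) x)" by (metis convergent_diff_const_right_iff)
    then show ?case by (simp add: convergent_LIMSEQ_iff)
  qed
  let ?g = "\<lambda>x. lim (\<lambda>k. f (s k) x)"
  have "L2_conv M f ?g sequentially"
    unfolding L2_conv_def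
  proof (rule tendsto_zero_ennreal)
    fix r :: real assume r: "0 < r"
    obtain K where K: "\<And>i j. i \<ge> K \<Longrightarrow> j \<ge> K \<Longrightarrow> sq_norm M (\<lambda>x. f i x - f j x) \<le> ennreal (r/2)"
      using Cauchy[of "r/2"] r by auto
    have "sq_norm M (\<lambda>x. ?g x - f i x) \<le> ennreal (r/2)" if i: "i \<ge> K" for i
    proof (rule sq_norm_Fatou[where f="\<lambda>k x. f (s k) x - f i x"])
      show "AE x in M. (\<lambda>k. f (s k) x - f i x) \<longlonglongrightarrow> ?g x - f i x"
        using conv by eventually_elim (intro tendsto_diff tendsto_const)
      show "\<forall>\<^sub>F k in sequentially. sq_norm M (\<lambda>x. f (s k) x - f i x) \<le> ennreal (r/2)"
        using i by (intro eventually_sequentiallyI[of K] K) (auto intro: order_trans[OF _ seq_suble[OF sm]])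
    qed simp
    moreover have "ennreal (r/2) < ennreal r" using r by (simp add: ennreal_less_iff)
    ultimately show "\<forall>\<^sub>F i in sequentially. sq_norm M (\<lambda>x. ?g x - f i x) < ennreal r"
      by (intro eventually_sequentiallyI[of K]) (auto intro: order.strict_trans1)
  qed
  then show ?thesis using sm by blast
qed

text \<open>
The same for families indexed along a filter, such as finite partial sums of an unordered series or
truncations to growing intervals; \<open>r\<close> is any sequence that runs through the filter.
\<close>
lemma L2_complete:
  fixes f :: "'i \<Rightarrow> 'a \<Rightarrow> complex"
  assumes [measurable]: "\<And>i. f i \<in> borel_measurable M"
    and r: "filterlim r F sequentially"
    and Cauchy: "\<And>e. e > 0 \<Longrightarrow> \<exists>P. eventually P F \<and> (\<forall>i j. P i \<longrightarrow> P j \<longrightarrow> sq_norm M (\<lambda>x. f i x - f j x) \<le> ennreal e)"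
  shows "\<exists>s. strict_mono s \<and> L2_conv M f (\<lambda>x. lim (\<lambda>k. f (r (s k)) x)) F"
proof -
  have C2: "\<exists>N. \<forall>i\<ge>N. \<forall>j\<ge>N. sq_norm M (\<lambda>x. f (r i) x - f (r j) x) \<le> ennreal e" if e: "e > 0" for e
  proof -
    obtain P where P: "eventually P F" "\<And>i j. P i \<Longrightarrow> P j \<Longrightarrow> sq_norm M (\<lambda>x. f i x - f j x) \<le> ennreal e"
      using Cauchy[OF e] by blast
    have "eventually (\<lambda>k. P (r k)) sequentially" using r P(1) by (simp add: filterlim_iff)
    then obtain N where "\<And>k. k \<ge> N \<Longrightarrow> P (r k)" by (auto simp: eventually_sequentially)
    with P(2) show ?thesis by blast
  qed
  obtain s where s: "strict_mono s" "L2_conv M (\<lambda>k. f (r k)) (\<lambda>x. lim (\<lambda>k. f (r (s k)) x)) sequentially"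
    using L2_complete_seq[of "\<lambda>k. f (r k)" M] C2 by auto
  define g where "g = (\<lambda>x. lim (\<lambda>k. f (r (s k)) x))"
  have [measurable]: "g \<in> borel_measurable M" unfolding g_def by measurable
  have lim: "((\<lambda>k. sq_norm M (\<lambda>x. g x - f (r k) x)) \<longlongrightarrow> 0) sequentially"
    using s(2) by (simp add: L2_conv_def g_def)
  have "L2_conv M f g F" unfolding L2_conv_def
  proof (rule tendsto_zero_ennreal)
    fix e :: real assume e: "0 < e"
    obtain P where P: "eventually P F" "\<And>i j. P i \<Longrightarrow> P j \<Longrightarrow> sq_norm M (\<lambda>x. f i x - f j x) \<le> ennreal (e/8)"
      using Cauchy[of "e/8"] e by auto
    have "\<forall>\<^sub>F k in sequentially. P (r k)" using r P(1) by (simp add: filterlim_iff)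
    moreover have "\<forall>\<^sub>F k in sequentially. sq_norm M (\<lambda>x. g x - f (r k) x) < ennreal (e/8)"
      using lim e by (intro sq_norm_small_ev) auto
    ultimately obtain k where k: "P (r k)" "sq_norm M (\<lambda>x. g x - f (r k) x) < ennreal (e/8)"
      using eventually_happens[OF eventually_conj] by fastforce
    have "sq_norm M (\<lambda>x. g x - f i x) < ennreal e" if "P i" for i
    proof -
      have "sq_norm M (\<lambda>x. g x - f i x) \<le> 2 * sq_norm M (\<lambda>x. g x - f (r k) x) + 2 * sq_norm M (\<lambda>x. f (r k) x - f i x)"
        using sq_norm_add_le[of "\<lambda>x. g x - f (r k) x" M "\<lambda>x. f (r k) x - f i x"] by simp
      also have "\<dots> \<le> 2 * ennreal (e/8) + 2 * ennreal (e/8)"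
        using k P(2)[OF k(1) that] by (intro add_mono mult_left_mono) auto
      also have "\<dots> = ennreal (2 * (e/8) + 2 * (e/8))" using e by (simp only: mult_2 ennreal_plus[symmetric])
      also have "\<dots> < ennreal e" using e by (intro ennreal_lessI) auto
      finally show ?thesis .
    qed
    then show "\<forall>\<^sub>F i in F. sq_norm M (\<lambda>x. g x - f i x) < ennreal e"
      using P(1) by (rule eventually_mono[rotated])
  qed
  then show ?thesis using s(1) unfolding g_def by blast
qed

section \<open>Inner products of square-integrable functions\<close>

lemma iprod_integrable:
  assumes "sq_int M f" "sq_int M g"
  shows "integrable M (\<lambda>x. f x * cnj (g x))"
proof -
  have [measurable]: "f \<in> borel_measurable M" "g \<in> borel_measurable M" using assms by (auto simp: sq_int_def)
  have "(\<integral>\<^sup>+x. ennreal (cmod (f x)) * ennreal (cmod (g x)) \<partial>M)\<^sup>2 \<le> sq_norm M f * sq_norm M g"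
    using Cauchy_Schwarz_nn_integral[of "\<lambda>x. ennreal (cmod (f x))" M "\<lambda>x. ennreal (cmod (g x))"]
    by (simp add: sq_norm_def ennreal_power)
  also have "\<dots> < \<infinity>" using assms by (simp add: sq_int_def ennreal_mult_less_top)
  finally have "(\<integral>\<^sup>+x. ennreal (cmod (f x)) * ennreal (cmod (g x)) \<partial>M) < \<infinity>"
    by (simp add: power_less_top_ennreal)
  then show ?thesis
    by (subst integrable_iff_bounded) (simp add: norm_mult ennreal_mult)
qed

lemma iprod_bound:
  assumes "sq_int M f" "sq_int M g"
  shows "cmod (iprod M f g) \<le> L2norm M f * L2norm M g"
proof -
  have [measurable]: "f \<in> borel_measurable M" "g \<in> borel_measurable M" using assms by (auto simp: sq_int_def)
  let ?I = "\<integral>\<^sup>+x. ennreal (cmod (f x)) * ennreal (cmod (g x)) \<partial>M"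
  have "?I\<^sup>2 \<le> sq_norm M f * sq_norm M g"
    using Cauchy_Schwarz_nn_integral[of "\<lambda>x. ennreal (cmod (f x))" M "\<lambda>x. ennreal (cmod (g x))"]
    by (simp add: sq_norm_def ennreal_power)
  also have "\<dots> = ennreal ((L2norm M f * L2norm M g)\<^sup>2)"
    by (simp add: sq_norm_L2norm assms ennreal_mult power_mult_distrib)
  finally have *: "?I\<^sup>2 \<le> ennreal ((L2norm M f * L2norm M g)\<^sup>2)" .
  have "ennreal (cmod (iprod M f g)) \<le> ?I"
    using integral_norm_bound_ennreal[OF iprod_integrable[OF assms]]
    by (simp add: iprod_def norm_mult ennreal_mult)
  then have "(ennreal (cmod (iprod M f g)))\<^sup>2 \<le> ?I\<^sup>2" by (intro power_mono) auto
  also note *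
  also have "(ennreal (cmod (iprod M f g)))\<^sup>2 = ennreal ((cmod (iprod M f g))\<^sup>2)" by (simp add: ennreal_power)
  finally have "(cmod (iprod M f g))\<^sup>2 \<le> (L2norm M f * L2norm M g)\<^sup>2"
    by (subst (asm) ennreal_le_iff) auto
  then show ?thesis by (rule power2_le_imp_le) simp
qed

lemma iprod_add_left: "sq_int M f \<Longrightarrow> sq_int M g \<Longrightarrow> sq_int M h \<Longrightarrow>
    iprod M (\<lambda>x. f x + g x) h = iprod M f h + iprod M g h"
  unfolding iprod_def by (subst Bochner_Integration.integral_add[symmetric])
    (auto intro!: iprod_integrable simp: algebra_simps)

lemma iprod_diff_left: "sq_int M f \<Longrightarrow> sq_int M g \<Longrightarrow> sq_int M h \<Longrightarrow>
    iprod M (\<lambda>x. f x - g x) h = iprod M f h - iprod M g h"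
  unfolding iprod_def by (subst Bochner_Integration.integral_diff[symmetric])
    (auto intro!: iprod_integrable simp: algebra_simps)

lemma iprod_cmult_left: "iprod M (\<lambda>x. c * f x) h = c * iprod M f h"
  unfolding iprod_def by (simp add: mult.assoc)

lemma iprod_sum_left: "(\<And>i. i \<in> I \<Longrightarrow> sq_int M (f i)) \<Longrightarrow> sq_int M h \<Longrightarrow>
    iprod M (\<lambda>x. \<Sum>i\<in>I. f i x) h = (\<Sum>i\<in>I. iprod M (f i) h)"
proof (induction I rule: infinite_finite_induct)
  case (insert i I)
  then show ?case by (simp add: iprod_add_left sq_int_sum)
qed (auto simp: iprod_def)

lemma iprod_cnj: "cnj (iprod M f g) = iprod M g f"
  unfolding iprod_def by (subst Bochner_Integration.integral_cnj[symmetric]) (simp add: mult.commute)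

lemma iprod_self: "sq_int M f \<Longrightarrow> iprod M f f = of_real ((L2norm M f)\<^sup>2)"
proof -
  assume f: "sq_int M f"
  have "iprod M f f = (LINT x|M. complex_of_real ((cmod (f x))\<^sup>2))"
    by (simp only: iprod_def complex_norm_square)
  also have "\<dots> = of_real (LINT x|M. (cmod (f x))\<^sup>2)" by (rule integral_complex_of_real)
  also have "(LINT x|M. (cmod (f x))\<^sup>2) = enn2real (sq_norm M f)"
    unfolding sq_norm_def using sq_intD[OF f] by (intro integral_eq_nn_integral) auto
  finally show ?thesis by (simp add: L2norm_def)
qed

text \<open>
This polarization formula is used in both directions: to expand squared norms and, once norms are
known to be preserved, to conclude that inner products are.
\<close>
lemma L2norm_add_sq:
  assumes "sq_int M f" "sq_int M g"
  shows "(L2norm M (\<lambda>x. f x + g x))\<^sup>2 = (L2norm M f)\<^sup>2 + (L2norm M g)\<^sup>2 + 2 * Re (iprod M f g)"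
proof -
  let ?s = "\<lambda>x. f x + g x"
  have s: "sq_int M ?s" by (intro sq_int_add assms)
  have r: "iprod M h ?s = iprod M h f + iprod M h g" if "sq_int M h" for h
    using iprod_add_left[OF assms that] by (metis complex_cnj_add iprod_cnj)
  have "complex_of_real ((L2norm M ?s)\<^sup>2) = iprod M f f + iprod M g g + (iprod M f g + cnj (iprod M f g))"
    using iprod_self[OF s] iprod_add_left[OF assms s] r[OF assms(1)] r[OF assms(2)] iprod_cnj[of M f g]
    by (metis (no_types, lifting) add.assoc add.commute add.left_commute)
  then have "complex_of_real ((L2norm M ?s)\<^sup>2) = of_real ((L2norm M f)\<^sup>2 + (L2norm M g)\<^sup>2 + 2 * Re (iprod M f g))"
    by (simp add: iprod_self assms complex_add_cnj)
  then show ?thesis by (simp only: of_real_eq_iff)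
qed

lemma L2_conv_iprod:
  assumes f: "\<And>i. sq_int M (f i)" and g: "sq_int M g" and h: "sq_int M h" and l: "L2_conv M f g F"
  shows "((\<lambda>i. iprod M (f i) h) \<longlongrightarrow> iprod M g h) F"
proof (rule Lim_null[THEN iffD2], rule Lim_null_comparison)
  show "((\<lambda>i. L2norm M (\<lambda>x. g x - f i x) * L2norm M h) \<longlongrightarrow> 0) F"
    using L2_conv_L2norm[OF f g, of "\<lambda>i. i"] l by (intro tendsto_mult_left_zero) auto
  show "\<forall>\<^sub>F i in F. norm (iprod M (f i) h - iprod M g h) \<le> L2norm M (\<lambda>x. g x - f i x) * L2norm M h"
  proof (rule always_eventually, rule allI)
    fix i
    have "norm (iprod M (f i) h - iprod M g h) = cmod (iprod M (\<lambda>x. g x - f i x) h)"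
      by (simp add: iprod_diff_left f g h norm_minus_commute)
    also have "\<dots> \<le> L2norm M (\<lambda>x. g x - f i x) * L2norm M h"
      by (intro iprod_bound sq_int_diff f g h)
    finally show "norm (iprod M (f i) h - iprod M g h) \<le> L2norm M (\<lambda>x. g x - f i x) * L2norm M h" .
  qed
qed

section \<open>Square-summable families indexed by the integers\<close>

text \<open>
Unordered sums over the integers are limits along finite sets; the symmetric intervals provide a
sequence of such sets, as Fatou's lemma and pointwise measurability require.
\<close>
lemma filterlim_symmetric_interval:
  "filterlim (\<lambda>k::nat. {- int k..int k}) (finite_subsets_at_top (UNIV::int set)) sequentially"
  unfolding filterlim_finite_subsets_at_top
proof safe
  fix X :: "int set" assume X: "finite X"
  define N where "N = (\<Sum>x\<in>X. \<bar>x\<bar>)"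
  have N: "\<bar>x\<bar> \<le> N" if "x \<in> X" for x
    unfolding N_def using that X by (intro member_le_sum) auto
  show "\<forall>\<^sub>F y in sequentially. finite {- int y..int y} \<and> X \<subseteq> {- int y..int y} \<and> {- int y..int y} \<subseteq> UNIV"
    using N by (intro eventually_sequentiallyI[of "nat N"]) force
qed

lemma eventually_fin: "\<forall>\<^sub>F F in finite_subsets_at_top UNIV. finite F"
  by (rule eventually_finite_subsets_at_top_weakI)

lemma filterlim_image_uminus:
  "filterlim (image uminus) (finite_subsets_at_top (UNIV::int set)) (finite_subsets_at_top UNIV)"
  unfolding filterlim_finite_subsets_at_top
proof safe
  fix X :: "int set" assume X: "finite X"
  show "\<forall>\<^sub>F y in finite_subsets_at_top UNIV. finite (uminus ` y) \<and> X \<subseteq> uminus ` y \<and> uminus ` y \<subseteq> UNIV"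
    unfolding eventually_finite_subsets_at_top
  proof (intro exI[of _ "uminus ` X"] conjI allI impI)
    fix Y :: "int set" assume Y: "finite Y \<and> uminus ` X \<subseteq> Y \<and> Y \<subseteq> UNIV"
    have "x \<in> uminus ` Y" if "x \<in> X" for x
    proof
      show "x = - (- x)" by simp
      show "- x \<in> Y" using that Y by blast
    qed
    then show "X \<subseteq> uminus ` Y" by blast
  qed (use X in auto)
qed

lemma infsum_ennreal_nn_integral:
  fixes f :: "int \<Rightarrow> ennreal"
  shows "infsum f UNIV = (\<integral>\<^sup>+n. f n \<partial>count_space UNIV)"
proof (rule antisym)
  have "sum f F \<le> (\<integral>\<^sup>+n. f n \<partial>count_space UNIV)" if "finite F" for F
  proof -
    have "sum f F = (\<integral>\<^sup>+n. f n \<partial>count_space F)" using that by (simp add: nn_integral_count_space_finite)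
    also have "\<dots> \<le> (\<integral>\<^sup>+n. f n \<partial>count_space UNIV)"
      by (subst nn_integral_count_space_indicator) (auto intro!: nn_integral_mono split: split_indicator)
    finally show ?thesis .
  qed
  then show "infsum f UNIV \<le> (\<integral>\<^sup>+n. f n \<partial>count_space UNIV)"
    by (subst nonneg_infsum_complete) (auto intro!: SUP_least)
next
  let ?F = "\<lambda>k::nat. {- int k..int k}"
  have "(\<integral>\<^sup>+n. f n \<partial>count_space UNIV) = (\<integral>\<^sup>+n. (SUP k. f n * indicator (?F k) n) \<partial>count_space UNIV)"
  proof (intro nn_integral_cong antisym)
    fix n :: int
    have "f n = f n * indicator (?F (nat \<bar>n\<bar>)) n" by (auto split: split_indicator)
    also have "\<dots> \<le> (SUP k. f n * indicator (?F k) n)" by (rule SUP_upper) simp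
    finally show "f n \<le> (SUP k. f n * indicator (?F k) n)" .
    show "(SUP k. f n * indicator (?F k) n) \<le> f n"
      by (intro SUP_least) (auto split: split_indicator)
  qed
  also have "\<dots> = (SUP k. \<integral>\<^sup>+n. f n * indicator (?F k) n \<partial>count_space UNIV)"
    by (intro nn_integral_monotone_convergence_SUP)
       (auto simp: incseq_def le_fun_def split: split_indicator)
  also have "\<dots> \<le> infsum f UNIV"
  proof (rule SUP_least)
    fix k
    have "(\<integral>\<^sup>+n. f n * indicator (?F k) n \<partial>count_space UNIV) = sum f (?F k)"
      by (simp add: nn_integral_count_space_indicator[symmetric] nn_integral_count_space_finite)
    also have "\<dots> \<le> infsum f UNIV"
      by (subst nonneg_infsum_complete) (auto intro!: SUP_upper)
    finally show "(\<integral>\<^sup>+n. f n * indicator (?F k) n \<partial>count_space UNIV) \<le> infsum f UNIV" .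
  qed
  finally show "(\<integral>\<^sup>+n. f n \<partial>count_space UNIV) \<le> infsum f UNIV" .
qed

lemma infsum_ennreal_le:
  assumes "\<And>F. finite F \<Longrightarrow> (\<Sum>n\<in>F. f n) \<le> C" "\<And>n. 0 \<le> f n" "0 \<le> C"
  shows "(\<Sum>\<^sub>\<infinity>n::int. ennreal (f n)) \<le> ennreal C"
proof -
  have "(SUP F\<in>{F. finite F \<and> F \<subseteq> UNIV}. \<Sum>n\<in>F. ennreal (f n)) \<le> ennreal C"
  proof (rule SUP_least)
    fix F :: "int set" assume F: "F \<in> {F. finite F \<and> F \<subseteq> UNIV}"
    then have "(\<Sum>n\<in>F. f n) \<le> C" using assms(1) by simp
    then have "ennreal (\<Sum>n\<in>F. f n) \<le> ennreal C" by (rule ennreal_leI)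
    then show "(\<Sum>n\<in>F. ennreal (f n)) \<le> ennreal C" using assms(2) by (simp add: sum_ennreal)
  qed
  then show ?thesis by (subst nonneg_infsum_complete) simp_all
qed

lemma infsum_ennreal_ge:
  assumes "finite F" "\<And>n. 0 \<le> f n"
  shows "ennreal (\<Sum>n\<in>F. f n) \<le> (\<Sum>\<^sub>\<infinity>n::int. ennreal (f n))"
proof -
  have "ennreal (\<Sum>n\<in>F. f n) = (\<Sum>n\<in>F. ennreal (f n))" using assms(2) by (simp add: sum_ennreal)
  also have "\<dots> \<le> (SUP F\<in>{F. finite F \<and> F \<subseteq> UNIV}. \<Sum>n\<in>F. ennreal (f n))"
    by (rule SUP_upper) (simp add: assms(1))
  finally show ?thesis by (subst nonneg_infsum_complete) simp_all
qed

lemma l2_norm_sq_summable: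
  assumes "(\<lambda>n. (cmod (c n))\<^sup>2) summable_on UNIV"
  shows "l2_norm_sq c = ennreal (\<Sum>\<^sub>\<infinity>n. (cmod (c n))\<^sup>2)"
  unfolding l2_norm_sq_def using assms
  by (subst infsum_nonneg_is_SUPREMUM_ennreal) (auto simp: nonneg_infsum_complete)

lemma l2_seq_bounded:
  assumes "\<And>F. finite F \<Longrightarrow> (\<Sum>n\<in>F. (cmod (c n))\<^sup>2) \<le> C"
  shows "(\<lambda>n. (cmod (c n))\<^sup>2) summable_on UNIV" "l2_seq c"
proof -
  show s: "(\<lambda>n. (cmod (c n))\<^sup>2) summable_on UNIV"
    using assms by (intro nonneg_bdd_above_summable_on) (auto intro!: bdd_aboveI2)
  show "l2_seq c" by (simp add: l2_seq_def l2_norm_sq_summable[OF s])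
qed

lemma l2_seq_summable: "l2_seq c \<longleftrightarrow> (\<lambda>n. (cmod (c n))\<^sup>2) summable_on UNIV"
proof
  assume c: "l2_seq c"
  show "(\<lambda>n. (cmod (c n))\<^sup>2) summable_on UNIV"
  proof (rule l2_seq_bounded)
    fix F :: "int set" assume F: "finite F"
    have "ennreal (\<Sum>n\<in>F. (cmod (c n))\<^sup>2) \<le> l2_norm_sq c"
      unfolding l2_norm_sq_def using F
      by (subst nonneg_infsum_complete) (auto intro!: SUP_upper2[of F])
    also have "\<dots> = ennreal (enn2real (l2_norm_sq c))" using c by (simp add: l2_seq_def)
    finally show "(\<Sum>n\<in>F. (cmod (c n))\<^sup>2) \<le> enn2real (l2_norm_sq c)"
      by (subst (asm) ennreal_le_iff) auto
  qed
qed (auto simp: l2_seq_def l2_norm_sq_summable)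

text \<open>
The real-valued counterpart of \<open>l2_norm_sq\<close>, with the default value 0 if the squares are
not summable.
\<close>
definition l2sq :: "(int \<Rightarrow> complex) \<Rightarrow> real" where
  "l2sq c = (\<Sum>\<^sub>\<infinity>n. (cmod (c n))\<^sup>2)"

lemma l2sq_nonneg [simp]: "0 \<le> l2sq c" unfolding l2sq_def by (rule infsum_nonneg) simp

lemma l2_norm_sq_l2sq: "l2_seq c \<Longrightarrow> l2_norm_sq c = ennreal (l2sq c)"
  by (simp add: l2_seq_summable l2_norm_sq_summable l2sq_def)

lemma l2sq_lim: "l2_seq c \<Longrightarrow> ((\<lambda>F. \<Sum>n\<in>F. (cmod (c n))\<^sup>2) \<longlongrightarrow> l2sq c) (finite_subsets_at_top UNIV)"
  unfolding l2sq_def l2_seq_summable using has_sum_def has_sum_infsum by blast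

lemma l2sq_ge_sum: "l2_seq c \<Longrightarrow> finite F \<Longrightarrow> (\<Sum>n\<in>F. (cmod (c n))\<^sup>2) \<le> l2sq c"
  unfolding l2sq_def by (subst infsum_finite[symmetric], simp)
    (rule infsum_mono_neutral, auto simp: l2_seq_summable)

lemma l2_tail:
  assumes c: "l2_seq c" and e: "e > 0"
  shows "\<exists>F0. finite F0 \<and> (\<forall>F. finite F \<longrightarrow> F \<inter> F0 = {} \<longrightarrow> (\<Sum>n\<in>F. (cmod (c n))\<^sup>2) \<le> e)"
proof -
  have "\<forall>\<^sub>F F in finite_subsets_at_top UNIV. (\<Sum>n\<in>F. (cmod (c n))\<^sup>2) > l2sq c - e"
    using order_tendstoD(1)[OF l2sq_lim[OF c]] e by simp
  then obtain F0 where F0: "finite F0" "\<And>F. finite F \<Longrightarrow> F0 \<subseteq> F \<Longrightarrow> (\<Sum>n\<in>F. (cmod (c n))\<^sup>2) > l2sq c - e"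
    by (auto simp: eventually_finite_subsets_at_top)
  have "(\<Sum>n\<in>F. (cmod (c n))\<^sup>2) \<le> e" if F: "finite F" "F \<inter> F0 = {}" for F
  proof -
    have "(\<Sum>n\<in>F. (cmod (c n))\<^sup>2) + (\<Sum>n\<in>F0. (cmod (c n))\<^sup>2) = (\<Sum>n\<in>F \<union> F0. (cmod (c n))\<^sup>2)"
      using F F0 by (intro sum.union_disjoint[symmetric]) auto
    also have "\<dots> \<le> l2sq c" using F F0 c by (intro l2sq_ge_sum) auto
    finally show ?thesis using F0(2)[OF F0(1)] by simp
  qed
  with F0(1) show ?thesis by blast
qed

lemma l2_mult_summable:
  assumes "l2_seq c" "l2_seq d"
  shows "(\<lambda>n. norm (c n * d n)) summable_on UNIV"
proof (rule summable_on_comparison_test)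
  show "(\<lambda>n. (cmod (c n))\<^sup>2 + (cmod (d n))\<^sup>2) summable_on UNIV"
    using assms by (intro summable_on_add) (auto simp: l2_seq_summable)
  fix n
  have "0 \<le> (cmod (c n) - cmod (d n))\<^sup>2" by simp
  then have "2 * (cmod (c n) * cmod (d n)) \<le> (cmod (c n))\<^sup>2 + (cmod (d n))\<^sup>2" by (simp add: power2_diff)
  moreover have "0 \<le> cmod (c n) * cmod (d n)" by simp
  ultimately show "norm (c n * d n) \<le> (cmod (c n))\<^sup>2 + (cmod (d n))\<^sup>2" unfolding norm_mult by linarith
qed simp

lemma l2_mult_bound_finite:
  "cmod (\<Sum>n\<in>F. c n * d n) \<le> sqrt (\<Sum>n\<in>F. (cmod (c n))\<^sup>2) * sqrt (\<Sum>n\<in>F. (cmod (d n))\<^sup>2)"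
proof -
  have "cmod (\<Sum>n\<in>F. c n * d n) \<le> (\<Sum>n\<in>F. \<bar>cmod (c n)\<bar> * \<bar>cmod (d n)\<bar>)"
    by (rule order_trans[OF norm_sum]) (simp add: norm_mult)
  also have "\<dots> \<le> L2_set (\<lambda>n. cmod (c n)) F * L2_set (\<lambda>n. cmod (d n)) F" by (rule L2_set_mult_ineq)
  finally show ?thesis by (simp add: L2_set_def)
qed

lemma l2_mult_bound:
  assumes c: "l2_seq c" and d: "l2_seq d"
  shows "cmod (\<Sum>\<^sub>\<infinity>n. c n * d n) \<le> sqrt (l2sq c) * sqrt (l2sq d)"
proof (rule tendsto_upperbound[OF _ _ finite_subsets_at_top_neq_bot])
  have "((\<lambda>n. c n * d n) has_sum (\<Sum>\<^sub>\<infinity>n. c n * d n)) UNIV"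
    by (rule has_sum_infsum[OF abs_summable_summable[OF l2_mult_summable[OF c d]]])
  then show "((\<lambda>F. cmod (\<Sum>n\<in>F. c n * d n)) \<longlongrightarrow> cmod (\<Sum>\<^sub>\<infinity>n. c n * d n)) (finite_subsets_at_top UNIV)"
    unfolding has_sum_def by (rule tendsto_norm)
  show "\<forall>\<^sub>F F in finite_subsets_at_top UNIV. cmod (\<Sum>n\<in>F. c n * d n) \<le> sqrt (l2sq c) * sqrt (l2sq d)"
  proof (rule eventually_finite_subsets_at_top_weakI)
    fix F :: "int set" assume F: "finite F"
    have "sqrt (\<Sum>n\<in>F. (cmod (c n))\<^sup>2) * sqrt (\<Sum>n\<in>F. (cmod (d n))\<^sup>2) \<le> sqrt (l2sq c) * sqrt (l2sq d)"
      by (intro mult_mono real_sqrt_le_mono l2sq_ge_sum c d F) (simp_all add: sum_nonneg)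
    with l2_mult_bound_finite show "cmod (\<Sum>n\<in>F. c n * d n) \<le> sqrt (l2sq c) * sqrt (l2sq d)"
      by (rule order_trans)
  qed
qed

lemma l2_seq_add_cmult: assumes "l2_seq c" "l2_seq d" shows "l2_seq (\<lambda>n. a * c n + d n)"
proof -
  have "(\<lambda>n. (cmod (a * c n + d n))\<^sup>2) summable_on UNIV"
  proof (rule summable_on_comparison_test)
    show "(\<lambda>n. 2 * (cmod a)\<^sup>2 * (cmod (c n))\<^sup>2 + 2 * (cmod (d n))\<^sup>2) summable_on UNIV"
      using assms by (intro summable_on_add summable_on_cmult_right) (auto simp: l2_seq_summable)
    fix n
    have "(cmod (a * c n + d n))\<^sup>2 \<le> (cmod (a * c n) + cmod (d n))\<^sup>2"
      by (intro power_mono norm_triangle_ineq) auto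
    also have "\<dots> \<le> 2 * (cmod (a * c n))\<^sup>2 + 2 * (cmod (d n))\<^sup>2"
      using zero_le_power2[of "cmod (a * c n) - cmod (d n)"] by (simp add: power2_sum power2_diff)
    finally show "(cmod (a * c n + d n))\<^sup>2 \<le> 2 * (cmod a)\<^sup>2 * (cmod (c n))\<^sup>2 + 2 * (cmod (d n))\<^sup>2"
      by (simp add: norm_mult power_mult_distrib)
  qed auto
  then show ?thesis by (simp add: l2_seq_summable)
qed

lemma l2_norm_sq_bij:
  assumes "bij \<pi>" shows "l2_norm_sq (\<lambda>n. c (\<pi> n)) = l2_norm_sq c"
  unfolding l2_norm_sq_def using infsum_reindex_bij_betw[of \<pi> UNIV UNIV "\<lambda>n. ennreal ((cmod (c n))\<^sup>2)"] assms by simp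

lemma unimodular_l2:
  assumes "\<And>n. cmod (u n) = 1"
  shows "l2_norm_sq (\<lambda>n. u n * c n) = l2_norm_sq c" "l2_seq (\<lambda>n. u n * c n) = l2_seq c" "l2sq (\<lambda>n. u n * c n) = l2sq c"
  by (simp_all add: l2_seq_def l2_norm_sq_def l2sq_def norm_mult assms)

section \<open>Bessel bounds and synthesis bounds\<close>

lemma cancel_self_mult_le:
  fixes x k :: real
  assumes "x * x \<le> k * x" "0 \<le> k" "0 \<le> x"
  shows "x \<le> k"
proof (cases "x = 0")
  case False
  then show ?thesis using assms by (intro mult_right_le_imp_le[of x x k]) auto
qed (use assms in simp)

lemma sum_iprod_sq:
  fixes S :: "int \<Rightarrow> 'a \<Rightarrow> complex"
  assumes S: "\<And>n. sq_int M (S n)" and h: "sq_int M h"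
  shows "complex_of_real (\<Sum>n\<in>F. (cmod (iprod M h (S n)))\<^sup>2) = iprod M h (\<lambda>t. \<Sum>n\<in>F. iprod M h (S n) * S n t)"
proof -
  have "iprod M h (\<lambda>t. \<Sum>n\<in>F. iprod M h (S n) * S n t) = cnj (iprod M (\<lambda>t. \<Sum>n\<in>F. iprod M h (S n) * S n t) h)"
    by (simp add: iprod_cnj)
  also have "\<dots> = (\<Sum>n\<in>F. cnj (iprod M h (S n)) * iprod M h (S n))"
    by (subst iprod_sum_left) (auto simp: S h sq_int_cmult iprod_cmult_left iprod_cnj)
  finally show ?thesis unfolding of_real_sum complex_norm_square by (simp add: mult.commute)
qed

text \<open>
With $\alpha_n = \langle h, S_n\rangle$ one has
$\sum |\alpha_n|^2 = \langle h, \sum \alpha_n S_n\rangle$, so a bound for synthesis bounds the sum by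
its own square root.
\<close>
lemma Bessel_from_synthesis:
  fixes S :: "int \<Rightarrow> 'a \<Rightarrow> complex"
  assumes S: "\<And>n. sq_int M (S n)" and K: "0 \<le> K"
    and synth: "\<And>a. (L2norm M (\<lambda>t. \<Sum>n\<in>F. a n * S n t))\<^sup>2 \<le> K * (\<Sum>n\<in>F. (cmod (a n))\<^sup>2)"
    and h: "sq_int M h"
  shows "(\<Sum>n\<in>F. (cmod (iprod M h (S n)))\<^sup>2) \<le> K * (L2norm M h)\<^sup>2"
proof -
  let ?X = "\<Sum>n\<in>F. (cmod (iprod M h (S n)))\<^sup>2" and ?g = "\<lambda>t. \<Sum>n\<in>F. iprod M h (S n) * S n t"
  have X0: "0 \<le> ?X" by (intro sum_nonneg) auto
  have g: "sq_int M ?g" by (intro sq_int_sum sq_int_cmult S)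
  have "?X = cmod (complex_of_real ?X)" using X0 by (simp only: norm_of_real abs_of_nonneg)
  also have "\<dots> = cmod (iprod M h ?g)" by (simp only: sum_iprod_sq[where S=S and F=F, OF S h])
  also have "\<dots> \<le> L2norm M h * L2norm M ?g" by (rule iprod_bound[OF h g])
  finally have "?X\<^sup>2 \<le> (L2norm M h * L2norm M ?g)\<^sup>2" using X0 by (intro power_mono)
  also have "\<dots> \<le> (L2norm M h)\<^sup>2 * (K * ?X)" unfolding power_mult_distrib by (intro mult_left_mono synth) auto
  finally have "?X * ?X \<le> (K * (L2norm M h)\<^sup>2) * ?X" by (simp add: power2_eq_square mult_ac)
  moreover have "0 \<le> K * (L2norm M h)\<^sup>2" using K by simp
  ultimately show ?thesis by (rule cancel_self_mult_le) (rule X0)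
qed

text \<open>
The dual estimate: the squared norm of $g = \sum a_n S_n$ is $\sum a_n \langle S_n, g\rangle$. The
Bessel bound is assumed only for $g$ itself, since the upper frame inequality is available only for
members of the space that the frame spans.
\<close>
lemma synthesis_from_Bessel:
  fixes S :: "int \<Rightarrow> 'a \<Rightarrow> complex"
  assumes S: "\<And>n. sq_int M (S n)" and K: "0 \<le> K"
    and Bes: "(\<Sum>n\<in>F. (cmod (iprod M (\<lambda>t. \<Sum>n\<in>F. a n * S n t) (S n)))\<^sup>2) \<le> K * (L2norm M (\<lambda>t. \<Sum>n\<in>F. a n * S n t))\<^sup>2"
  shows "(L2norm M (\<lambda>t. \<Sum>n\<in>F. a n * S n t))\<^sup>2 \<le> K * (\<Sum>n\<in>F. (cmod (a n))\<^sup>2)"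
proof -
  let ?g = "\<lambda>t. \<Sum>n\<in>F. a n * S n t"
  have g: "sq_int M ?g" by (intro sq_int_sum sq_int_cmult S)
  let ?N = "(L2norm M ?g)\<^sup>2" and ?s = "\<Sum>n\<in>F. (cmod (a n))\<^sup>2"
  have s0: "0 \<le> ?s" by (intro sum_nonneg) auto
  have "iprod M ?g ?g = (\<Sum>n\<in>F. a n * iprod M (S n) ?g)"
    by (subst iprod_sum_left) (auto simp: S g sq_int_cmult iprod_cmult_left)
  then have e: "complex_of_real ?N = (\<Sum>n\<in>F. a n * iprod M (S n) ?g)" by (simp only: iprod_self[OF g])
  have "?N = cmod (complex_of_real ?N)" by (simp only: norm_of_real) simp
  also have "\<dots> = cmod (\<Sum>n\<in>F. a n * iprod M (S n) ?g)" by (simp only: e)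
  also have "\<dots> \<le> sqrt ?s * sqrt (\<Sum>n\<in>F. (cmod (iprod M (S n) ?g))\<^sup>2)" by (rule l2_mult_bound_finite)
  also have "(\<Sum>n\<in>F. (cmod (iprod M (S n) ?g))\<^sup>2) = (\<Sum>n\<in>F. (cmod (cnj (iprod M (S n) ?g)))\<^sup>2)"
    by (simp only: complex_mod_cnj)
  also have "\<dots> = (\<Sum>n\<in>F. (cmod (iprod M ?g (S n)))\<^sup>2)"
    by (simp only: iprod_cnj)
  finally have "?N\<^sup>2 \<le> (sqrt ?s * sqrt (\<Sum>n\<in>F. (cmod (iprod M ?g (S n)))\<^sup>2))\<^sup>2" by (intro power_mono) auto
  also have "\<dots> = ?s * (\<Sum>n\<in>F. (cmod (iprod M ?g (S n)))\<^sup>2)"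
    using s0 by (simp add: power_mult_distrib sum_nonneg)
  also have "\<dots> \<le> ?s * (K * ?N)" by (intro mult_left_mono Bes s0)
  finally have "?N * ?N \<le> (K * ?s) * ?N" by (simp add: power2_eq_square mult_ac)
  moreover have "0 \<le> K * ?s" using K s0 by simp
  ultimately show ?thesis by (rule cancel_self_mult_le) simp
qed

section \<open>Translation and periodization on the line\<close>

lemma shift_measurable_lebesgue [measurable]: "(\<lambda>x::real. x + t) \<in> lebesgue \<rightarrow>\<^sub>M lebesgue"
  using lebesgue_affine_measurable[of "\<lambda>_. 1" t] by (simp add: add.commute)

lemma nn_integral_shift:
  assumes "f \<in> borel_measurable lebesgue"
  shows "(\<integral>\<^sup>+x. f (x + t :: real) \<partial>lebesgue) = (\<integral>\<^sup>+x. f x \<partial>lebesgue)"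
  using nn_integral_real_affine_lebesgue[OF assms, of 1 t] by (simp add: add.commute)

lemma distr_shift_lebesgue: "distr lebesgue lebesgue (\<lambda>x::real. x + t) = lebesgue"
  using lebesgue_real_affine[of 1 t] by (simp add: add.commute density_1)

lemma integral_shift:
  fixes f :: "real \<Rightarrow> complex"
  assumes [measurable]: "f \<in> borel_measurable lebesgue"
  shows "(LINT x|lebesgue. f (x + t)) = (LINT x|lebesgue. f x)"
proof -
  have "(LINT x|lebesgue. f x) = (LINT x|distr lebesgue lebesgue (\<lambda>x. x + t). f x)"
    by (subst distr_shift_lebesgue) (rule refl)
  also have "\<dots> = (LINT x|lebesgue. f (x + t))"
    by (rule integral_distr) auto
  finally show ?thesis by simp
qed

lemma measurable_shift:
  fixes f :: "real \<Rightarrow> 'a::topological_space"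
  assumes "f \<in> borel_measurable lebesgue" shows "(\<lambda>x. f (x + t)) \<in> borel_measurable lebesgue"
  by (rule measurable_compose[OF shift_measurable_lebesgue assms])

lemma sq_norm_shift: "f \<in> borel_measurable lebesgue \<Longrightarrow> sq_norm lebesgue (\<lambda>x. f (x + t :: real)) = sq_norm lebesgue f"
  unfolding sq_norm_def by (rule nn_integral_shift[where f="\<lambda>x. ennreal ((cmod (f x))\<^sup>2)"]) measurable

lemma sq_int_shift: "sq_int lebesgue f \<Longrightarrow> sq_int lebesgue (\<lambda>x. f (x + t :: real))"
  unfolding sq_int_def by (auto simp: sq_norm_shift intro: measurable_shift[of f])

lemma AE_shift:
  assumes "AE x in lebesgue. P x" shows "AE x in lebesgue. P (x + t :: real)"
proof -
  have "AE x in distr lebesgue lebesgue (\<lambda>x. x + t). P x" by (subst distr_shift_lebesgue) (rule assms)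
  then show ?thesis by (rule AE_distrD[OF shift_measurable_lebesgue])
qed

lemma sum_translated_intervals:
  fixes P x :: real assumes P: "P > 0"
  shows "(\<integral>\<^sup>+n. indicator {of_int n * P..<(of_int n + 1) * P} x \<partial>count_space (UNIV::int set)) = 1"
proof -
  have eq: "x \<in> {of_int n * P..<(of_int n + 1) * P} \<longleftrightarrow> n = \<lfloor>x / P\<rfloor>" for n
  proof -
    have "n = \<lfloor>x / P\<rfloor> \<longleftrightarrow> of_int n \<le> x / P \<and> x / P < of_int n + 1" using floor_eq_iff[of "x / P" n] by auto
    then show ?thesis using P by (simp add: pos_le_divide_eq pos_divide_less_eq)
  qed
  have "(\<integral>\<^sup>+n. indicator {of_int n * P..<(of_int n + 1) * P} x \<partial>count_space (UNIV::int set))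
      = (\<integral>\<^sup>+n. indicator {\<lfloor>x / P\<rfloor>} n \<partial>count_space (UNIV::int set))"
    by (intro nn_integral_cong) (use eq in \<open>auto simp: indicator_def\<close>)
  also have "\<dots> = 1" by simp
  finally show ?thesis .
qed

text \<open>
Cut the line into the intervals $[nP, (n+1)P)$ and move each of them to $[0,P)$.
\<close>
lemma nn_integral_periodize:
  fixes f :: "real \<Rightarrow> ennreal"
  assumes f [measurable]: "f \<in> borel_measurable lebesgue" and P: "P > 0"
  shows "(\<integral>\<^sup>+x. f x \<partial>lebesgue)
       = (\<integral>\<^sup>+x. (\<integral>\<^sup>+n. f (x + of_int n * P) \<partial>count_space (UNIV::int set)) \<partial>lebesgue_on {0..P})"
proof -
  let ?I = "\<lambda>n. {of_int n * P..<(of_int n + 1) * P}"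
  have [measurable]: "(\<lambda>x. f (x + t)) \<in> borel_measurable lebesgue" for t
    by (rule measurable_compose[OF shift_measurable_lebesgue f])
  have [measurable]: "{a..<b} \<in> sets lebesgue" for a b :: real by simp
  have "(\<integral>\<^sup>+x. f x \<partial>lebesgue) = (\<integral>\<^sup>+x. (\<integral>\<^sup>+n. f x * indicator (?I n) x \<partial>count_space (UNIV::int set)) \<partial>lebesgue)"
    by (intro nn_integral_cong) (simp add: nn_integral_cmult sum_translated_intervals P)
  also have "\<dots> = (\<integral>\<^sup>+n. (\<integral>\<^sup>+x. f x * indicator (?I n) x \<partial>lebesgue) \<partial>count_space (UNIV::int set))"
    by (rule nn_integral_count_space_nn_integral) auto
  also have "\<dots> = (\<integral>\<^sup>+n. (\<integral>\<^sup>+x. f (x + of_int n * P) * indicator {0..<P} x \<partial>lebesgue) \<partial>count_space (UNIV::int set))"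
  proof (rule nn_integral_cong)
    fix n :: int
    have "(\<integral>\<^sup>+x. f x * indicator (?I n) x \<partial>lebesgue)
       = (\<integral>\<^sup>+x. f (x + of_int n * P) * indicator (?I n) (x + of_int n * P) \<partial>lebesgue)"
      by (rule nn_integral_shift[symmetric]) measurable
    also have "\<dots> = (\<integral>\<^sup>+x. f (x + of_int n * P) * indicator {0..<P} x \<partial>lebesgue)"
      by (intro nn_integral_cong) (auto simp: indicator_def algebra_simps)
    finally show "(\<integral>\<^sup>+x. f x * indicator (?I n) x \<partial>lebesgue) = (\<integral>\<^sup>+x. f (x + of_int n * P) * indicator {0..<P} x \<partial>lebesgue)" .
  qed
  also have "\<dots> = (\<integral>\<^sup>+x. (\<integral>\<^sup>+n. f (x + of_int n * P) * indicator {0..<P} x \<partial>count_space (UNIV::int set)) \<partial>lebesgue)"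
    by (rule nn_integral_count_space_nn_integral[symmetric]) auto
  also have "\<dots> = (\<integral>\<^sup>+x. (\<integral>\<^sup>+n. f (x + of_int n * P) \<partial>count_space (UNIV::int set)) * indicator {0..<P} x \<partial>lebesgue)"
    by (intro nn_integral_cong) (simp add: nn_integral_multc)
  also have "\<dots> = (\<integral>\<^sup>+x. (\<integral>\<^sup>+n. f (x + of_int n * P) \<partial>count_space (UNIV::int set)) * indicator {0..P} x \<partial>lebesgue)"
  proof (rule nn_integral_cong_AE)
    have "AE x in lebesgue. x \<notin> {P}" by (rule AE_not_in) auto
    then show "AE x in lebesgue. (\<integral>\<^sup>+n. f (x + of_int n * P) \<partial>count_space (UNIV::int set)) * indicator {0..<P} x =
        (\<integral>\<^sup>+n. f (x + of_int n * P) \<partial>count_space (UNIV::int set)) * indicator {0..P} x"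
      by eventually_elim (auto simp: indicator_def)
  qed
  also have "\<dots> = (\<integral>\<^sup>+x. (\<integral>\<^sup>+n. f (x + of_int n * P) \<partial>count_space (UNIV::int set)) \<partial>lebesgue_on {0..P})"
    by (subst nn_integral_restrict_space) auto
  finally show ?thesis .
qed

section \<open>Harmonics on one period\<close>

definition harmonic :: "real \<Rightarrow> int \<Rightarrow> real \<Rightarrow> complex" where
  "harmonic w n x = cis (w * of_int n * x)"

definition period :: "real \<Rightarrow> real" where "period w = 2 * pi / \<bar>w\<bar>"

text \<open>
A circle of circumference \<open>period w\<close>, with the endpoints of the interval not identified;
the difference is a null set.
\<close>
abbreviation torus :: "real \<Rightarrow> real measure" where "torus w \<equiv> lebesgue_on {0..period w}"

lemma norm_harmonic [simp]: "cmod (harmonic w n x) = 1" by (simp add: harmonic_def)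

lemma harmonic_mult: "harmonic w m x * harmonic w n x = harmonic w (m+n) x" by (simp add: harmonic_def cis_mult algebra_simps)

lemma cnj_harmonic: "cnj (harmonic w n x) = harmonic w (-n) x" by (simp add: harmonic_def cis_cnj)

lemma harmonic_0 [simp]: "harmonic w 0 x = 1" by (simp add: harmonic_def)

lemma period_minus [simp]: "period (-w) = period w" by (simp add: period_def)

lemma period_pos: "w \<noteq> 0 \<Longrightarrow> period w > 0" by (simp add: period_def)

lemma continuous_harmonic: "continuous_on A (harmonic w n)"
  unfolding harmonic_def[abs_def] cis_conv_exp by (intro continuous_intros)

lemma measurable_harmonic [measurable]: "harmonic w n \<in> borel_measurable borel"
  by (intro borel_measurable_continuous_onI continuous_harmonic)

lemma borel_lebesgue: "f \<in> borel_measurable borel \<Longrightarrow> f \<in> borel_measurable lebesgue"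
  by (rule measurable_completion) simp

lemma measurable_harmonic_l [measurable]: "harmonic w n \<in> borel_measurable lebesgue"
  by (intro borel_lebesgue measurable_harmonic)

lemma measurable_torus: "f \<in> borel_measurable lebesgue \<Longrightarrow> f \<in> borel_measurable (torus w)"
  by (rule measurable_restrict_space1)

lemma measurable_harmonic_torus [measurable]: "harmonic w n \<in> borel_measurable (torus w')"
  by (intro measurable_torus measurable_harmonic_l)

lemma harmonic_periodic: assumes "w \<noteq> 0" shows "harmonic w n (x + of_int k * period w) = harmonic w n x"
proof -
  have "w * of_int n * (x + of_int k * period w) = w * of_int n * x + 2 * pi * of_int (n * k * (if w > 0 then 1 else -1))"
    using assms by (auto simp: period_def field_simps abs_if)
  then show ?thesis by (simp only: harmonic_def cis_mult[symmetric] cis_multiple_2pi Ints_of_int mult_1_right)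
qed

lemma finite_measure_torus: "finite_measure (torus w)"
  by (rule finite_measure_lebesgue_on) simp

lemma emeasure_torus: "emeasure (torus w) (space (torus w)) = ennreal (period w)"
  by (simp add: emeasure_restrict_space period_def)

lemma AE_torus_iff: "(AE x in torus w. Q x) \<longleftrightarrow> (AE x in lebesgue. x \<in> {0..period w} \<longrightarrow> Q x)"
  by (subst AE_restrict_space_iff) auto

lemma AE_periodic:
  assumes w: "w \<noteq> 0" and period: "\<And>x k. Q (x + of_int k * period w) \<longleftrightarrow> Q x" and ae: "AE x in torus w. Q x"
  shows "AE x in lebesgue. Q x"
proof -
  have 0: "AE x in lebesgue. x \<in> {0..period w} \<longrightarrow> Q x" using ae by (simp only: AE_torus_iff)
  have "AE x in lebesgue. x + of_int k * period w \<in> {0..period w} \<longrightarrow> Q (x + of_int k * period w)" for k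
    by (rule AE_shift[OF 0])
  then have "AE x in lebesgue. \<forall>k::int. x + of_int k * period w \<in> {0..period w} \<longrightarrow> Q x"
    unfolding period by (subst AE_all_countable) auto
  then show ?thesis
  proof eventually_elim
    case (elim x)
    have p: "period w > 0" by (rule period_pos[OF w])
    have "of_int \<lfloor>x / period w\<rfloor> * period w \<le> x"
      using pos_le_divide_eq[OF p] of_int_floor_le by blast
    moreover have "x / period w < of_int \<lfloor>x / period w\<rfloor> + 1" by linarith
    then have "x < (of_int \<lfloor>x / period w\<rfloor> + 1) * period w" using pos_divide_less_eq[OF p] by blast
    ultimately have "x + of_int (- \<lfloor>x / period w\<rfloor>) * period w \<in> {0..period w}"
      by (simp add: algebra_simps)
    then show ?case using elim by blast
  qed
qed

text \<open>
The interval $[-R,R]$ meets at most $2N+1$ translates of a period. This is how convergence on one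
period yields convergence on every bounded interval, as in the definition of the Zak transform.
\<close>
lemma periodic_interval_bound:
  fixes f :: "real \<Rightarrow> ennreal" and R :: real
  assumes w: "w \<noteq> 0" and f: "f \<in> borel_measurable lebesgue" and period: "\<And>x k. f (x + of_int k * period w) = f x"
  defines "N \<equiv> \<lceil>\<bar>R\<bar> / period w\<rceil> + 1"
  shows "(\<integral>\<^sup>+x. f x * indicator {-R..R} x \<partial>lebesgue) \<le> of_nat (card {-N..N}) * (\<integral>\<^sup>+x. f x \<partial>torus w)"
proof -
  have P: "period w > 0" by (rule period_pos[OF w])
  note [measurable] = f
  have m: "(\<lambda>x. f x * indicator {-R..R} x) \<in> borel_measurable lebesgue" 
    by (intro borel_measurable_times_ennreal f borel_measurable_indicator) simp
  have "(\<integral>\<^sup>+x. f x * indicator {-R..R} x \<partial>lebesgue)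
     = (\<integral>\<^sup>+x. (\<integral>\<^sup>+n. f (x + of_int n * period w) * indicator {-R..R} (x + of_int n * period w) \<partial>count_space (UNIV::int set)) \<partial>torus w)"
    by (rule nn_integral_periodize[OF m P])
  also have "\<dots> \<le> (\<integral>\<^sup>+x. of_nat (card {-N..N}) * f x \<partial>torus w)"
  proof (rule nn_integral_mono)
    fix x assume "x \<in> space (torus w)"
    then have x: "0 \<le> x" "x \<le> period w" by auto
    have "indicator {-R..R} (x + of_int n * period w) \<le> (indicator {-N..N} n :: ennreal)" for n :: int
    proof (cases "x + of_int n * period w \<in> {-R..R}")
      case True
      then have "\<bar>of_int n * period w\<bar> \<le> \<bar>R\<bar> + period w" using x by auto
      then have "\<bar>real_of_int n\<bar> * period w \<le> \<bar>R\<bar> + period w" using P by (simp add: abs_mult)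
      then have "\<bar>real_of_int n\<bar> \<le> \<bar>R\<bar> / period w + 1" using P by (simp add: field_simps)
      then have "\<bar>n\<bar> \<le> N" unfolding N_def by linarith
      then show ?thesis by (auto simp: indicator_def)
    qed simp
    then have "(\<integral>\<^sup>+n. f (x + of_int n * period w) * indicator {-R..R} (x + of_int n * period w) \<partial>count_space (UNIV::int set))
       \<le> (\<integral>\<^sup>+n. f x * indicator {-N..N} n \<partial>count_space UNIV)"
      unfolding period by (intro nn_integral_mono mult_left_mono) auto
    also have "\<dots> = f x * of_nat (card {-N..N})"
      by (simp add: nn_integral_cmult)
    finally show "(\<integral>\<^sup>+n. f (x + of_int n * period w) * indicator {-R..R} (x + of_int n * period w) \<partial>count_space (UNIV::int set)) \<le> of_nat (card {-N..N}) * f x"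
      by (simp add: mult.commute)
  qed
  also have "\<dots> = of_nat (card {-N..N}) * (\<integral>\<^sup>+x. f x \<partial>torus w)"
    by (rule nn_integral_cmult) (rule measurable_torus[OF f])
  finally show ?thesis .
qed

lemma integral_harmonic:
  assumes w: "w \<noteq> 0"
  shows "(LINT x|torus w. harmonic w n x) = (if n = 0 then of_real (period w) else 0)"
proof (cases "n = 0")
  case True
  then show ?thesis using period_pos[OF w]
    by (simp add: measure_restrict_space scaleR_conv_of_real)
next
  case False
  define a where "a = w * of_int n"
  have a: "a \<noteq> 0" using w False by (simp add: a_def)
  have "(LINT x|torus w. harmonic w n x) = integral {0..period w} (harmonic w n)"
    using continuous_imp_integrable[of 0 "period w" "harmonic w n"] continuous_harmonic
    by (intro lebesgue_integral_eq_integral) auto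
  also have "(harmonic w n has_integral (cis (a * period w) / (\<i> * a) - cis (a * 0) / (\<i> * a))) {0..period w}"
  proof (rule fundamental_theorem_of_calculus)
    show "0 \<le> period w" using period_pos[OF w] by simp
    fix x assume "x \<in> {0..period w}"
    show "((\<lambda>x. cis (a * x) / (\<i> * a)) has_vector_derivative harmonic w n x) (at x within {0..period w})"
    proof -
      have "((\<lambda>z. exp (\<i> * a * z) / (\<i> * a)) has_field_derivative exp (\<i> * a * of_real x)) (at (of_real x))"
        using a by (auto intro!: derivative_eq_intros)
      from has_vector_derivative_real_field[OF this]
      show ?thesis unfolding cis_conv_exp harmonic_def a_def[symmetric] by (simp add: mult.assoc)
    qed
  qed
  then have "integral {0..period w} (harmonic w n) = (harmonic w n (0 + of_int 1 * period w) - harmonic w n 0) / (\<i> * a)"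
    by (simp add: integral_unique harmonic_def a_def diff_divide_distrib)
  also have "\<dots> = 0" by (simp only: harmonic_periodic[OF w]) simp
  finally show ?thesis using False by simp
qed

lemma iprod_harmonic: "w \<noteq> 0 \<Longrightarrow> iprod (torus w) (harmonic w n) (harmonic w m) = (if n = m then of_real (period w) else 0)"
  by (simp add: iprod_def cnj_harmonic harmonic_mult integral_harmonic)

section \<open>Completeness of the harmonics\<close>

text \<open>
Orthogonality to all harmonics. As $n$ runs through all integers, it does not matter that the
harmonic is not conjugated.
\<close>
definition annihilates :: "real \<Rightarrow> (real \<Rightarrow> complex) \<Rightarrow> bool" where
  "annihilates w h \<longleftrightarrow> integrable (torus w) h \<and> (\<forall>n. (LINT x|torus w. h x * harmonic w n x) = 0)"

lemma integrable_mult_harmonic: "integrable (torus w) h \<Longrightarrow> integrable (torus w) (\<lambda>x. h x * harmonic w n x)"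
  by (rule Bochner_Integration.integrable_bound[of _ h]) (auto simp: norm_mult)

lemma annihilates_add: "annihilates w g \<Longrightarrow> annihilates w h \<Longrightarrow> annihilates w (\<lambda>x. g x + h x)"
  unfolding annihilates_def
  by (auto simp: distrib_right integrable_mult_harmonic)

lemma annihilates_cmult: "annihilates w h \<Longrightarrow> annihilates w (\<lambda>x. c * h x)"
  unfolding annihilates_def by (auto simp: mult.assoc)

lemma annihilates_harmonic: "annihilates w h \<Longrightarrow> annihilates w (\<lambda>x. h x * harmonic w m x)"
  unfolding annihilates_def by (auto simp: mult.assoc harmonic_mult integrable_mult_harmonic)

text \<open>
Multiplication by a harmonic only shifts the family of vanishing integrals, and a real linear form
on the plane is $\alpha z + \bar\alpha \bar z$. Quantifying over \<open>h\<close> in the induction makes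
the product case a mere iteration.
\<close>
lemma annihilates_polynomial:
  fixes p :: "complex \<Rightarrow> real"
  assumes "real_polynomial_function p" "annihilates w h"
  shows "annihilates w (\<lambda>x. h x * of_real (p (harmonic w 1 x)))"
  using assms
proof (induction p arbitrary: h rule: real_polynomial_function.induct)
  case (linear f)
  then interpret f: bounded_linear f by simp
  define \<alpha> where "\<alpha> = (complex_of_real (f 1) - \<i> * of_real (f \<i>)) / 2"
  have f: "complex_of_real (f z) = \<alpha> * z + cnj \<alpha> * cnj z" for z
  proof -
    have "f z = f (Re z *\<^sub>R 1 + Im z *\<^sub>R \<i>)" by (rule arg_cong[where f=f]) (simp add: complex_eq_iff)
    also have "\<dots> = Re z * f 1 + Im z * f \<i>" by (simp add: f.add f.scaleR)
    finally show ?thesis by (simp add: complex_eq_iff field_simps \<alpha>_def)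
  qed
  have "annihilates w (\<lambda>x. \<alpha> * (h x * harmonic w 1 x) + cnj \<alpha> * (h x * harmonic w (-1) x))"
    by (intro annihilates_add annihilates_cmult annihilates_harmonic linear)
  then show ?case by (simp add: f cnj_harmonic algebra_simps)
next
  case (const c)
  then show ?case using annihilates_cmult[of w h "of_real c"] by (simp add: mult.commute)
next
  case (add f g)
  then show ?case using annihilates_add[OF add.IH(1)[OF add.prems] add.IH(2)[OF add.prems]]
    by (simp add: algebra_simps)
next
  case (mult f g)
  then show ?case using mult.IH(2)[OF mult.IH(1)[OF mult.prems]] by (simp add: mult.assoc)
qed

text \<open>
Stone--Weierstrass on the unit circle: polynomials approximate \<open>q\<close> uniformly, and $h$ is
integrable.
\<close>
lemma annihilates_continuous:
  fixes q :: "complex \<Rightarrow> real"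
  assumes h: "annihilates w h" and q: "continuous_on UNIV q"
  shows "(LINT x|torus w. h x * of_real (q (harmonic w 1 x))) = 0"
proof -
  have hi [measurable]: "integrable (torus w) h" using h by (simp add: annihilates_def)
  have qE [measurable]: "(\<lambda>x. q (harmonic w 1 x)) \<in> borel_measurable (torus w)"
    by (intro measurable_compose[OF measurable_harmonic_torus] borel_measurable_continuous_onI q)
  have qc: "continuous_on (sphere (0::complex) 1) q" using q continuous_on_subset by blast
  have S: "harmonic w 1 x \<in> sphere 0 1" for x by simp
  obtain B where B: "\<And>z. z \<in> sphere (0::complex) 1 \<Longrightarrow> \<bar>q z\<bar> \<le> B"
    using compact_imp_bounded[OF compact_continuous_image[OF qc compact_sphere]]
    unfolding bounded_iff by (metis image_eqI real_norm_def)
  have iq: "integrable (torus w) (\<lambda>x. h x * of_real (q (harmonic w 1 x)))"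
  proof (rule Bochner_Integration.integrable_bound[of _ "\<lambda>x. of_real B * h x"])
    show "AE x in torus w. norm (h x * of_real (q (harmonic w 1 x))) \<le> norm (of_real B * h x)"
    proof (rule AE_I2)
      fix x
      have "\<bar>q (harmonic w 1 x)\<bar> \<le> \<bar>B\<bar>" using B[OF S[of x]] by linarith
      then show "norm (h x * of_real (q (harmonic w 1 x))) \<le> norm (of_real B * h x)"
        by (simp add: norm_mult mult.commute[of "\<bar>B\<bar>"] mult_left_mono)
    qed
  qed (use hi in auto)
  have "cmod (LINT x|torus w. h x * of_real (q (harmonic w 1 x))) \<le> e * (LINT x|torus w. cmod (h x))" if e: "e > 0" for e
  proof -
    obtain p where p: "real_polynomial_function p" "\<And>z. z \<in> sphere 0 1 \<Longrightarrow> \<bar>q z - p z\<bar> < e"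
      using Stone_Weierstrass_real_polynomial_function[OF compact_sphere qc e] by metis
    have ap: "annihilates w (\<lambda>x. h x * of_real (p (harmonic w 1 x)))" by (rule annihilates_polynomial[OF p(1) h])
    then have iprod: "integrable (torus w) (\<lambda>x. h x * of_real (p (harmonic w 1 x)))"
      and p0: "(LINT x|torus w. h x * of_real (p (harmonic w 1 x))) = 0"
      unfolding annihilates_def by (auto dest: spec[of _ 0])
    have "(LINT x|torus w. h x * of_real (q (harmonic w 1 x))) = (LINT x|torus w. h x * of_real (q (harmonic w 1 x)) - h x * of_real (p (harmonic w 1 x)))"
      using iq iprod p0 by simp
    also have "cmod \<dots> \<le> (LINT x|torus w. cmod (h x * of_real (q (harmonic w 1 x)) - h x * of_real (p (harmonic w 1 x))))"
      by (rule integral_norm_bound)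
    also have "\<dots> \<le> (LINT x|torus w. e * cmod (h x))"
    proof (rule integral_mono)
      fix x
      have "cmod (h x * of_real (q (harmonic w 1 x)) - h x * of_real (p (harmonic w 1 x))) = cmod (h x) * \<bar>q (harmonic w 1 x) - p (harmonic w 1 x)\<bar>"
        by (simp only: right_diff_distrib[symmetric] norm_mult of_real_diff[symmetric] norm_of_real)
      also have "\<dots> \<le> cmod (h x) * e" using p(2)[OF S[of x]] by (intro mult_left_mono) auto
      finally show "cmod (h x * of_real (q (harmonic w 1 x)) - h x * of_real (p (harmonic w 1 x))) \<le> e * cmod (h x)"
        by (simp add: mult.commute)
    qed (use iq iprod hi in auto)
    finally show ?thesis by simp
  qed
  then have "cmod (LINT x|torus w. h x * of_real (q (harmonic w 1 x))) \<le> 0"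
  proof -
    assume *: "\<And>e. e > 0 \<Longrightarrow> cmod (LINT x|torus w. h x * of_real (q (harmonic w 1 x))) \<le> e * (LINT x|torus w. cmod (h x))"
    show ?thesis
    proof (rule tendsto_lowerbound)
      show "((\<lambda>e. e * (LINT x|torus w. cmod (h x))) \<longlongrightarrow> 0) (at_right 0)"
        by (auto intro!: tendsto_eq_intros)
      show "\<forall>\<^sub>F e in at_right 0. cmod (LINT x|torus w. h x * of_real (q (harmonic w 1 x))) \<le> e * (LINT x|torus w. cmod (h x))"
        using * by (auto simp: eventually_at_right_field intro!: exI[of _ 1])
    qed simp
  qed
  then show ?thesis by simp
qed

text \<open>
The indicator of a compact set is the decreasing limit of the continuous functions
$\max(0, 1 - k\,\mathrm{dist}(z,K))$.
\<close>
lemma annihilates_compact: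
  assumes h: "annihilates w h" and K: "compact K" "K \<noteq> {}"
  shows "(LINT x|torus w. h x * indicator K (harmonic w 1 x)) = 0"
proof -
  have hi [measurable]: "integrable (torus w) h" using h by (simp add: annihilates_def)
  define q where "q k z = max 0 (1 - real k * infdist z K)" for k and z :: complex
  have qc: "continuous_on UNIV (q k)" for k
    unfolding q_def[abs_def] by (intro continuous_intros)
  have qE [measurable]: "(\<lambda>x. q k (harmonic w 1 x)) \<in> borel_measurable (torus w)" for k
    by (intro measurable_compose[OF measurable_harmonic_torus] borel_measurable_continuous_onI qc)
  have q1: "0 \<le> q k z" "q k z \<le> 1" for k z by (auto simp: q_def infdist_nonneg)
  have K': "closed K" using K by (simp add: compact_imp_closed)
  have lim: "(\<lambda>k. q k z) \<longlonglongrightarrow> indicator K z" for z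
  proof (cases "z \<in> K")
    case True
    then have "infdist z K = 0" using in_closed_iff_infdist_zero[OF K' K(2)] by simp
    then show ?thesis using True by (simp add: q_def)
  next
    case False
    then have d: "infdist z K > 0" using in_closed_iff_infdist_zero[OF K' K(2), of z] infdist_nonneg[of z K] by simp
    obtain N :: nat where N: "1 / infdist z K < N" using reals_Archimedean2 by blast
    have "q k z = 0" if "k \<ge> N" for k
    proof -
      have "1 / infdist z K \<le> k" using N that by linarith
      then show ?thesis using d by (simp add: q_def field_simps)
    qed
    then show ?thesis using False by (intro tendsto_eventually) (auto intro: eventually_sequentiallyI)
  qed
  have [measurable]: "(\<lambda>x. indicator K (harmonic w 1 x) :: complex) \<in> borel_measurable (torus w)"
    using K' by (intro measurable_compose[OF measurable_harmonic_torus]) auto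
  have "(\<lambda>k. LINT x|torus w. h x * of_real (q k (harmonic w 1 x))) \<longlonglongrightarrow> (LINT x|torus w. h x * indicator K (harmonic w 1 x))"
  proof (rule integral_dominated_convergence[where w="\<lambda>x. cmod (h x)"])
    show "AE x in torus w. (\<lambda>k. h x * of_real (q k (harmonic w 1 x))) \<longlonglongrightarrow> h x * indicator K (harmonic w 1 x)"
    proof (rule AE_I2)
      fix x show "(\<lambda>k. h x * of_real (q k (harmonic w 1 x))) \<longlonglongrightarrow> h x * indicator K (harmonic w 1 x)"
        using tendsto_mult[OF tendsto_const tendsto_of_real[OF lim[of "harmonic w 1 x"]], of "h x"]
        by (simp add: of_real_indicator)
    qed
    show "AE x in torus w. norm (h x * of_real (q k (harmonic w 1 x))) \<le> cmod (h x)" for k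
      using q1 by (auto simp: norm_mult mult_left_le)
  qed (use hi in auto)
  then show ?thesis using annihilates_continuous[OF h qc] by (simp add: LIMSEQ_const_iff)
qed

lemma harmonic_inj:
  assumes w: "w \<noteq> 0" and xy: "0 \<le> x" "x < period w" "0 \<le> y" "y < period w" and eq: "harmonic w 1 x = harmonic w 1 y"
  shows "x = y"
proof -
  have "cis (w * (x - y)) = 1"
    using eq by (simp add: harmonic_def right_diff_distrib cis_divide[symmetric])
  then obtain n :: int where n: "w * (x - y) = of_int (2 * n) * pi"
    by (auto simp: complex_eq_iff cos_one_2pi_int)
  have "\<bar>w\<bar> * \<bar>x - y\<bar> < \<bar>w\<bar> * period w"
    using w xy by (intro mult_strict_left_mono) auto
  then have "\<bar>of_int (2 * n) * pi\<bar> < 2 * pi" using w n by (simp add: abs_mult[symmetric] period_def)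
  then have "\<bar>real_of_int n\<bar> < 1" by (simp add: abs_mult)
  then have "n = 0" by linarith
  then show ?thesis using n w by simp
qed

lemma AE_torus_less: "AE x in torus w. x < period w"
proof -
  have "AE x in lebesgue. x \<notin> {period w}" by (rule AE_not_in) auto
  then show ?thesis by (subst AE_restrict_space_iff) auto
qed

lemma annihilates_compact_subset:
  assumes w: "w \<noteq> 0" and h: "annihilates w h" and K: "compact K" "K \<subseteq> {0..<period w}"
  shows "(LINT x|torus w. h x * indicator K x) = 0"
proof (cases "K = {}")
  case False
  have hi [measurable]: "integrable (torus w) h" using h by (simp add: annihilates_def)
  have Kb: "K \<in> sets borel" using K(1) by (simp add: borel_compact)
  have "(LINT x|torus w. h x * indicator (harmonic w 1 ` K) (harmonic w 1 x)) = 0"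
    using False by (intro annihilates_compact[OF h] compact_continuous_image continuous_harmonic K) auto
  moreover have "(LINT x|torus w. h x * indicator K x) = (LINT x|torus w. h x * indicator (harmonic w 1 ` K) (harmonic w 1 x))"
  proof (rule integral_cong_AE)
    have "closed (harmonic w 1 ` K)" by (intro compact_imp_closed compact_continuous_image continuous_harmonic K)
    then have "(\<lambda>x. indicator (harmonic w 1 ` K) (harmonic w 1 x) :: complex) \<in> borel_measurable (torus w)"
      by (intro measurable_compose[OF measurable_harmonic_torus]) auto
    then show "(\<lambda>x. h x * indicator (harmonic w 1 ` K) (harmonic w 1 x)) \<in> borel_measurable (torus w)" by measurable
    have "(indicator K :: real \<Rightarrow> complex) \<in> borel_measurable borel" using Kb by simp
    then have "(indicator K :: real \<Rightarrow> complex) \<in> borel_measurable (torus w)"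
      by (intro measurable_torus borel_lebesgue)
    then show "(\<lambda>x. h x * indicator K x) \<in> borel_measurable (torus w)" by measurable
    have "AE x in torus w. x \<in> space (torus w)" by (rule AE_space)
    with AE_torus_less show "AE x in torus w. h x * indicator K x = h x * indicator (harmonic w 1 ` K) (harmonic w 1 x)"
    proof eventually_elim
      case (elim x)
      then have x: "0 \<le> x" "x < period w" by auto
      have "x \<in> K" if "y \<in> K" "harmonic w 1 x = harmonic w 1 y" for y
      proof -
        have "0 \<le> y" "y < period w" using that K(2) by auto
        with harmonic_inj[OF w x] that show ?thesis by metis
      qed
      then have "harmonic w 1 x \<in> harmonic w 1 ` K \<longleftrightarrow> x \<in> K" by blast
      then show ?case by (simp add: indicator_def)
    qed
  qed
  ultimately show ?thesis by simp
qed simp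

text \<open>
The integral of $h$ vanishes over every compact subset of the period, since such a set is the
preimage of a compact subset of the circle; by inner regularity it vanishes over every measurable
set.
\<close>
lemma annihilates_zero:
  assumes w: "w \<noteq> 0" and h: "annihilates w h"
  shows "AE x in torus w. h x = 0"
proof -
  interpret finite_measure "torus w" by (rule finite_measure_torus)
  have hi [measurable]: "integrable (torus w) h" using h by (simp add: annihilates_def)
  show ?thesis
  proof (rule density_zero[OF hi])
    fix A assume A: "A \<in> sets (torus w)"
    have A': "A \<inter> {0..<period w} \<in> sets lebesgue" using A by (auto simp: sets_restrict_space intro!: sets.Int)
    obtain C T where CT: "fsigma C" "T \<in> null_sets lebesgue" "C \<union> T = A \<inter> {0..<period w}" "disjnt C T"
      using lebesgue_set_almost_fsigma[OF A'] by metis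
    obtain F :: "nat \<Rightarrow> real set" where F: "\<And>i. compact (F i)" "C = \<Union>(range F)"
      using CT(1) fsigma_Union_compact[of C] by (auto simp: image_subset_iff)
    define G where "G k = (\<Union>i\<le>k. F i)" for k
    have G: "compact (G k)" "G k \<subseteq> {0..<period w}" for k
      unfolding G_def using F CT(3) by (auto intro!: compact_UN)
    have Gb: "(indicator (G k) :: real \<Rightarrow> complex) \<in> borel_measurable (torus w)" for k
      using G(1)[of k] by (intro measurable_torus borel_lebesgue borel_measurable_indicator borel_compact)
    have limI: "(\<lambda>k. indicator (G k) x :: complex) \<longlonglongrightarrow> indicator C x" for x
    proof (cases "x \<in> C")
      case True
      then obtain N where "x \<in> F N" using F(2) by auto
      then have "indicator (G k) x = (1::complex)" if "k \<ge> N" for k using that by (auto simp: G_def indicator_def)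
      then show ?thesis using True by (intro tendsto_eventually) (auto intro: eventually_sequentiallyI)
    next
      case False
      then have "indicator (G k) x = (0::complex)" for k using F(2) by (auto simp: G_def indicator_def)
      then show ?thesis using False by simp
    qed
    have "(\<lambda>k. LINT x|torus w. h x * indicator (G k) x) \<longlonglongrightarrow> (LINT x|torus w. h x * indicator C x)"
    proof (rule integral_dominated_convergence[where w="\<lambda>x. cmod (h x)"])
      have "(\<lambda>x. indicator C x :: complex) \<in> borel_measurable (torus w)"
        by (rule borel_measurable_LIMSEQ_metric[OF Gb limI])
      then show "(\<lambda>x. h x * indicator C x) \<in> borel_measurable (torus w)" by measurable
      show "(\<lambda>x. h x * indicator (G k) x) \<in> borel_measurable (torus w)" for k using Gb by measurable
      show "AE x in torus w. (\<lambda>k. h x * indicator (G k) x) \<longlonglongrightarrow> h x * indicator C x"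
        by (intro AE_I2 tendsto_mult tendsto_const limI)
      show "AE x in torus w. norm (h x * indicator (G k) x) \<le> cmod (h x)" for k
        by (auto simp: norm_mult indicator_def)
    qed (use hi in auto)
    then have C0: "(LINT x|torus w. h x * indicator C x) = 0"
      using annihilates_compact_subset[OF w h G] by (simp add: LIMSEQ_const_iff)
    have "AE x in lebesgue. x \<notin> T" by (rule AE_not_in[OF CT(2)])
    then have T: "AE x in torus w. x \<notin> T" by (subst AE_restrict_space_iff) auto
    have "AE x in torus w. x \<in> space (torus w)" by (rule AE_space)
    with T AE_torus_less have "AE x in torus w. indicator A x *\<^sub>R h x = h x * indicator C x"
    proof eventually_elim
      case (elim x)
      then have "x \<in> {0..<period w}" "x \<notin> T" by auto
      then have "x \<in> A \<longleftrightarrow> x \<in> C" using CT(3) by blast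
      then show ?case by (simp add: indicator_def)
    qed
    moreover have "(\<lambda>x. indicator C x :: complex) \<in> borel_measurable (torus w)"
      by (rule borel_measurable_LIMSEQ_metric[OF Gb limI])
    ultimately have "(LINT x|torus w. indicator A x *\<^sub>R h x) = (LINT x|torus w. h x * indicator C x)"
      using A by (intro integral_cong_AE) auto
    with C0 show "set_lebesgue_integral (torus w) A h = 0" by (simp add: set_lebesgue_integral_def)
  qed
qed

section \<open>Fourier series of square-summable sequences\<close>

definition trig_sum :: "real \<Rightarrow> (int \<Rightarrow> complex) \<Rightarrow> int set \<Rightarrow> real \<Rightarrow> complex" where
  "trig_sum w c F x = (\<Sum>n\<in>F. c n * harmonic w n x)"

lemma sq_int_harmonic [simp]: "sq_int (torus w) (harmonic w' n)"
  using emeasure_torus[of w] by (simp add: sq_int_def sq_norm_def)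

lemma sq_int_trig_sum [simp]: "sq_int (torus w) (trig_sum w' c F)"
  unfolding trig_sum_def[abs_def] by (intro sq_int_sum sq_int_cmult sq_int_harmonic)

lemma measurable_trig_sum [measurable]: "trig_sum w c F \<in> borel_measurable borel"
  unfolding trig_sum_def[abs_def] by measurable

lemma iprod_trig_sum_harmonic: "w \<noteq> 0 \<Longrightarrow> finite F \<Longrightarrow>
   iprod (torus w) (trig_sum w c F) (harmonic w m) = (if m \<in> F then of_real (period w) * c m else 0)"
  unfolding trig_sum_def[abs_def]
  by (subst iprod_sum_left) (auto simp: sq_int_cmult iprod_cmult_left iprod_harmonic if_distrib sum.delta cong: if_cong)

lemma L2norm_trig_sum:
  assumes w: "w \<noteq> 0" and F: "finite F"
  shows "(L2norm (torus w) (trig_sum w c F))\<^sup>2 = period w * (\<Sum>n\<in>F. (cmod (c n))\<^sup>2)"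
proof -
  have "complex_of_real ((L2norm (torus w) (trig_sum w c F))\<^sup>2) = iprod (torus w) (trig_sum w c F) (trig_sum w c F)"
    by (simp add: iprod_self)
  also have "\<dots> = iprod (torus w) (\<lambda>x. \<Sum>n\<in>F. c n * harmonic w n x) (trig_sum w c F)"
    by (simp add: trig_sum_def[abs_def])
  also have "\<dots> = (\<Sum>n\<in>F. c n * iprod (torus w) (harmonic w n) (trig_sum w c F))"
    by (subst iprod_sum_left) (simp_all add: iprod_cmult_left sq_int_cmult)
  also have "\<dots> = (\<Sum>n\<in>F. c n * cnj (iprod (torus w) (trig_sum w c F) (harmonic w n)))"
    by (simp add: iprod_cnj)
  also have "\<dots> = (\<Sum>n\<in>F. of_real (period w * (cmod (c n))\<^sup>2))"
    unfolding of_real_mult complex_norm_square using F by (intro sum.cong) (auto simp: iprod_trig_sum_harmonic w)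
  also have "\<dots> = of_real (period w * (\<Sum>n\<in>F. (cmod (c n))\<^sup>2))"
    by (simp add: sum_distrib_left)
  finally show ?thesis by (simp only: of_real_eq_iff)
qed

lemma trig_sum_diff:
  assumes F: "finite F" "finite G"
  shows "trig_sum w c F x - trig_sum w c G x = trig_sum w (\<lambda>n. c n * ((if n \<in> F then 1 else 0) - (if n \<in> G then 1 else 0))) (F \<union> G) x"
proof -
  have "trig_sum w c F x = (\<Sum>n\<in>F \<union> G. if n \<in> F then c n * harmonic w n x else 0)"
    unfolding trig_sum_def using F by (intro sum.mono_neutral_cong_left) auto
  moreover have "trig_sum w c G x = (\<Sum>n\<in>F \<union> G. if n \<in> G then c n * harmonic w n x else 0)"
    unfolding trig_sum_def using F by (intro sum.mono_neutral_cong_left) auto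
  ultimately show ?thesis
    unfolding trig_sum_def by (simp add: sum_subtractf[symmetric]) (intro sum.cong, auto)
qed

lemma trig_sum_diff_bound:
  assumes w: "w \<noteq> 0" and F: "finite F" "finite G"
  shows "(L2norm (torus w) (\<lambda>x. trig_sum w c F x - trig_sum w c G x))\<^sup>2 \<le> period w * (\<Sum>n\<in>(F-G) \<union> (G-F). (cmod (c n))\<^sup>2)"
proof -
  let ?d = "\<lambda>n. c n * ((if n \<in> F then 1 else 0) - (if n \<in> G then 1 else 0))"
  have "(\<lambda>x. trig_sum w c F x - trig_sum w c G x) = trig_sum w ?d (F \<union> G)"
    by (rule ext) (rule trig_sum_diff[OF F])
  then have "(L2norm (torus w) (\<lambda>x. trig_sum w c F x - trig_sum w c G x))\<^sup>2 = (L2norm (torus w) (trig_sum w ?d (F \<union> G)))\<^sup>2"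
    by simp
  also have "\<dots> = period w * (\<Sum>n\<in>F \<union> G. (cmod (?d n))\<^sup>2)" using F by (intro L2norm_trig_sum w) auto
  also have "(\<Sum>n\<in>F \<union> G. (cmod (?d n))\<^sup>2) = (\<Sum>n\<in>(F-G) \<union> (G-F). (cmod (c n))\<^sup>2)"
    using F by (intro sum.mono_neutral_cong_right) auto
  finally show ?thesis by simp
qed

text \<open>
This is the Cauchy criterion for the unordered sum of squares, in the form needed for
differences of two trigonometric sums.
\<close>
lemma symdiff_tail:
  fixes c :: "int \<Rightarrow> complex"
  assumes c: "l2_seq c" and e: "e > 0"
  shows "\<exists>P. eventually P (finite_subsets_at_top (UNIV::int set)) \<and>
    (\<forall>F G. P F \<longrightarrow> P G \<longrightarrow> finite F \<and> finite G \<and> (\<Sum>n\<in>(F-G) \<union> (G-F). (cmod (c n))\<^sup>2) \<le> e)"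
proof -
  obtain F0 where F0: "finite F0" "\<And>F. finite F \<Longrightarrow> F \<inter> F0 = {} \<Longrightarrow> (\<Sum>n\<in>F. (cmod (c n))\<^sup>2) \<le> e"
    using l2_tail[OF c e] by blast
  show ?thesis
  proof (intro exI[of _ "\<lambda>F. finite F \<and> F0 \<subseteq> F"] conjI allI impI)
    show "\<forall>\<^sub>F x in finite_subsets_at_top UNIV. finite x \<and> F0 \<subseteq> x"
      using F0(1) by (auto simp: eventually_finite_subsets_at_top)
    fix F G assume "finite F \<and> F0 \<subseteq> F" "finite G \<and> F0 \<subseteq> G"
    then show "(\<Sum>n\<in>F - G \<union> (G - F). (cmod (c n))\<^sup>2) \<le> e" by (intro F0(2)) auto
  qed auto
qed

lemma fourier_sum_exists:
  assumes w: "w \<noteq> 0" and c: "l2_seq c"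
  shows "\<exists>f. f \<in> borel_measurable borel \<and> (\<forall>x k. f (x + of_int k * period w) = f x) \<and>
     L2_conv (torus w) (trig_sum w c) f (finite_subsets_at_top UNIV)"
proof -
  let ?r = "\<lambda>k::nat. {- int k..int k}"
  have "\<exists>s. strict_mono s \<and> L2_conv (torus w) (trig_sum w c) (\<lambda>x. lim (\<lambda>k. trig_sum w c (?r (s k)) x)) (finite_subsets_at_top UNIV)"
  proof (rule L2_complete[OF _ filterlim_symmetric_interval])
    fix e :: real assume e: "e > 0"
    obtain P where P: "eventually P (finite_subsets_at_top (UNIV::int set))"
      "\<And>F G. P F \<Longrightarrow> P G \<Longrightarrow> finite F \<and> finite G \<and> (\<Sum>n\<in>(F-G) \<union> (G-F). (cmod (c n))\<^sup>2) \<le> e / period w"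
      using symdiff_tail[OF c, of "e / period w"] e period_pos[OF w] by auto
    have "sq_norm (torus w) (\<lambda>x. trig_sum w c F x - trig_sum w c G x) \<le> ennreal e" if "P F" "P G" for F G
    proof -
      have FG: "finite F" "finite G" "(\<Sum>n\<in>(F-G) \<union> (G-F). (cmod (c n))\<^sup>2) \<le> e / period w" using P(2)[OF that] by auto
      have "(L2norm (torus w) (\<lambda>x. trig_sum w c F x - trig_sum w c G x))\<^sup>2 \<le> period w * (e / period w)"
        using trig_sum_diff_bound[OF w FG(1,2), of c] FG(3) period_pos[OF w] by (meson mult_left_mono order_trans less_imp_le)
      also have "\<dots> = e" using period_pos[OF w] by simp
      finally show ?thesis by (simp add: sq_norm_L2norm sq_int_diff ennreal_leI)
    qed
    then show "\<exists>P. eventually P (finite_subsets_at_top UNIV) \<and>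
         (\<forall>i j. P i \<longrightarrow> P j \<longrightarrow> sq_norm (torus w) (\<lambda>x. trig_sum w c i x - trig_sum w c j x) \<le> ennreal e)"
      using P(1) by blast
  qed (simp add: sq_intD)
  then obtain s where s: "L2_conv (torus w) (trig_sum w c) (\<lambda>x. lim (\<lambda>k. trig_sum w c (?r (s k)) x)) (finite_subsets_at_top UNIV)"
    by blast
  have "trig_sum w c F (x + of_int k * period w) = trig_sum w c F x" for F x k
    unfolding trig_sum_def by (simp add: harmonic_periodic[OF w])
  then show ?thesis using s
    by (intro exI[of _ "\<lambda>x. lim (\<lambda>k. trig_sum w c (?r (s k)) x)"]) auto
qed

text \<open>
The choice of a Borel measurable and exactly periodic representative makes it possible to evaluate
the sum on the whole line, where it enters the transform, and to argue on one period otherwise.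
\<close>
definition fourier_sum :: "real \<Rightarrow> (int \<Rightarrow> complex) \<Rightarrow> real \<Rightarrow> complex" where
  "fourier_sum w c = (SOME f. f \<in> borel_measurable borel \<and> (\<forall>x k. f (x + of_int k * period w) = f x) \<and>
     L2_conv (torus w) (trig_sum w c) f (finite_subsets_at_top UNIV))"

lemma
  assumes "w \<noteq> 0" "l2_seq c"
  shows fourier_sum_borel: "fourier_sum w c \<in> borel_measurable borel"
    and fourier_sum_periodic: "fourier_sum w c (x + of_int k * period w) = fourier_sum w c x"
    and fourier_sum_lim: "L2_conv (torus w) (trig_sum w c) (fourier_sum w c) (finite_subsets_at_top UNIV)"
  using someI_ex[OF fourier_sum_exists[OF assms]] unfolding fourier_sum_def[symmetric] by auto

lemma fourier_sum_measurable [measurable]: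
  "w \<noteq> 0 \<Longrightarrow> l2_seq c \<Longrightarrow> fourier_sum w c \<in> borel_measurable lebesgue"
  by (intro borel_lebesgue fourier_sum_borel)

lemma fourier_sum_sq_int: "w \<noteq> 0 \<Longrightarrow> l2_seq c \<Longrightarrow> sq_int (torus w) (fourier_sum w c)"
  by (rule L2_conv_sq_int[OF _ _ fourier_sum_lim]) (auto intro: measurable_torus fourier_sum_measurable)

definition fourier_coef :: "real \<Rightarrow> (real \<Rightarrow> complex) \<Rightarrow> int \<Rightarrow> complex" where
  "fourier_coef w f n = iprod (torus w) f (harmonic w n) / of_real (period w)"

lemma fourier_coef_add_cmult:
  assumes "sq_int (torus w) f" "sq_int (torus w) g"
  shows "fourier_coef w (\<lambda>x. a * f x + g x) n = a * fourier_coef w f n + fourier_coef w g n"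
  unfolding fourier_coef_def
  by (subst iprod_add_left) (auto simp: assms sq_int_cmult iprod_cmult_left add_divide_distrib)

lemma fourier_coef_cmult: "fourier_coef w (\<lambda>\<xi>. a * H \<xi>) n = a * fourier_coef w H n"
  by (simp add: fourier_coef_def iprod_cmult_left)

lemma fourier_coef_fourier_sum:
  assumes w: "w \<noteq> 0" and c: "l2_seq c"
  shows "fourier_coef w (fourier_sum w c) n = c n"
proof -
  have "((\<lambda>F. iprod (torus w) (trig_sum w c F) (harmonic w n)) \<longlongrightarrow> iprod (torus w) (fourier_sum w c) (harmonic w n)) (finite_subsets_at_top UNIV)"
    by (rule L2_conv_iprod[OF _ fourier_sum_sq_int[OF w c] _ fourier_sum_lim[OF w c]]) auto
  moreover have "\<forall>\<^sub>F F in finite_subsets_at_top UNIV. iprod (torus w) (trig_sum w c F) (harmonic w n) = of_real (period w) * c n"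
    unfolding eventually_finite_subsets_at_top using iprod_trig_sum_harmonic[OF w]
    by (intro exI[of _ "{n}"]) auto
  ultimately have "((\<lambda>F::int set. of_real (period w) * c n) \<longlongrightarrow> iprod (torus w) (fourier_sum w c) (harmonic w n)) (finite_subsets_at_top UNIV)"
    using tendsto_cong by fast
  then have "iprod (torus w) (fourier_sum w c) (harmonic w n) = of_real (period w) * c n"
    using tendsto_unique[OF finite_subsets_at_top_neq_bot _ tendsto_const] by metis
  then show ?thesis using period_pos[OF w] by (simp add: fourier_coef_def)
qed

lemma fourier_sum_Parseval:
  assumes w: "w \<noteq> 0" and c: "l2_seq c"
  shows "(L2norm (torus w) (fourier_sum w c))\<^sup>2 = period w * l2sq c"
proof (rule tendsto_unique[OF finite_subsets_at_top_neq_bot])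
  show "((\<lambda>F. (L2norm (torus w) (trig_sum w c F))\<^sup>2) \<longlongrightarrow> (L2norm (torus w) (fourier_sum w c))\<^sup>2) (finite_subsets_at_top UNIV)"
    by (intro tendsto_power L2_conv_L2norm_tendsto fourier_sum_sq_int w c fourier_sum_lim) auto
  have "((\<lambda>F. period w * (\<Sum>n\<in>F. (cmod (c n))\<^sup>2)) \<longlongrightarrow> period w * l2sq c) (finite_subsets_at_top UNIV)"
    by (intro tendsto_mult tendsto_const l2sq_lim c)
  moreover have "\<forall>\<^sub>F F in finite_subsets_at_top UNIV. (L2norm (torus w) (trig_sum w c F))\<^sup>2 = period w * (\<Sum>n\<in>F. (cmod (c n))\<^sup>2)"
    by (rule eventually_finite_subsets_at_top_weakI) (simp add: L2norm_trig_sum w)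
  ultimately show "((\<lambda>F. (L2norm (torus w) (trig_sum w c F))\<^sup>2) \<longlongrightarrow> period w * l2sq c) (finite_subsets_at_top UNIV)"
    by (simp add: tendsto_cong)
qed

lemma fourier_coef_cong_AE: "f \<in> borel_measurable (torus w) \<Longrightarrow> g \<in> borel_measurable (torus w) \<Longrightarrow> (AE x in torus w. f x = g x) \<Longrightarrow> fourier_coef w f n = fourier_coef w g n"
  unfolding fourier_coef_def iprod_def by (intro arg_cong2[where f="(/)"] integral_cong_AE) auto

text \<open>
Bessel's inequality: expand $0 \le \|f - \sum_{n\in F} c_n e_n\|^2$ for the Fourier coefficients
$c_n$ of $f$.
\<close>
lemma fourier_coef_Bessel:
  assumes w: "w \<noteq> 0" and f: "sq_int (torus w) f"
  shows "l2_seq (fourier_coef w f)"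
proof (rule l2_seq_bounded(2))
  fix F :: "int set" assume F: "finite F"
  let ?c = "fourier_coef w f" let ?p = "trig_sum w ?c F"
  have "iprod (torus w) f ?p = cnj (iprod (torus w) ?p f)" by (simp add: iprod_cnj)
  also have "\<dots> = (\<Sum>n\<in>F. cnj (?c n) * iprod (torus w) f (harmonic w n))"
    unfolding trig_sum_def[abs_def] by (subst iprod_sum_left) (auto simp: iprod_cmult_left iprod_cnj sq_int_cmult f)
  also have "\<dots> = (\<Sum>n\<in>F. of_real (period w * (cmod (?c n))\<^sup>2))"
    using period_pos[OF w] unfolding of_real_mult complex_norm_square
    by (intro sum.cong) (auto simp: fourier_coef_def)
  finally have ipfp: "iprod (torus w) f ?p = of_real (period w * (\<Sum>n\<in>F. (cmod (?c n))\<^sup>2))"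
    by (simp add: sum_distrib_left)
  have "0 \<le> (L2norm (torus w) (\<lambda>x. f x + (-1) * ?p x))\<^sup>2" by simp
  also have "\<dots> = (L2norm (torus w) f)\<^sup>2 + (L2norm (torus w) (\<lambda>x. (-1) * ?p x))\<^sup>2 + 2 * Re (iprod (torus w) f (\<lambda>x. (-1) * ?p x))"
    by (intro L2norm_add_sq f sq_int_cmult sq_int_trig_sum)
  also have "iprod (torus w) f (\<lambda>x. (-1) * ?p x) = - iprod (torus w) f ?p" by (simp add: iprod_def)
  also have "(L2norm (torus w) (\<lambda>x. (-1) * ?p x))\<^sup>2 = period w * (\<Sum>n\<in>F. (cmod (?c n))\<^sup>2)"
    by (subst L2norm_cmult) (auto simp: L2norm_trig_sum w F)
  finally have "period w * (\<Sum>n\<in>F. (cmod (?c n))\<^sup>2) \<le> (L2norm (torus w) f)\<^sup>2" by (simp add: ipfp)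
  then show "(\<Sum>n\<in>F. (cmod (?c n))\<^sup>2) \<le> (L2norm (torus w) f)\<^sup>2 / period w"
    using period_pos[OF w] by (simp add: field_simps)
qed

lemma sq_int_integrable: 
  assumes "sq_int (torus w) f" shows "integrable (torus w) f"
  using iprod_integrable[OF assms sq_int_harmonic[of w 0 0]] by simp

lemma fourier_coef_unique:
  assumes w: "w \<noteq> 0" and f: "sq_int (torus w) f" and g: "sq_int (torus w) g"
    and eq: "\<And>n. fourier_coef w f n = fourier_coef w g n"
  shows "AE x in torus w. f x = g x"
proof -
  have "annihilates w (\<lambda>x. f x - g x)"
    unfolding annihilates_def
  proof (intro conjI allI)
    show "integrable (torus w) (\<lambda>x. f x - g x)" by (intro sq_int_integrable sq_int_diff f g)
    fix n
    have "iprod (torus w) f (harmonic w (-n)) = iprod (torus w) g (harmonic w (-n))"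
      using eq[of "-n"] period_pos[OF w] by (simp add: fourier_coef_def)
    then have "iprod (torus w) (\<lambda>x. f x - g x) (harmonic w (-n)) = 0" by (simp add: iprod_diff_left f g)
    then show "(LINT x|torus w. (f x - g x) * harmonic w n x) = 0" by (simp add: iprod_def cnj_harmonic)
  qed
  from annihilates_zero[OF w this] show ?thesis by simp
qed

text \<open>
By the theorem of Riesz and Fischer the series has a sum with the coefficients of $f$; by
completeness of the harmonics it is $f$.
\<close>
lemma fourier_sum_fourier_coef:
  assumes w: "w \<noteq> 0" and f: "sq_int (torus w) f"
  shows "AE x in torus w. fourier_sum w (fourier_coef w f) x = f x"
  by (intro fourier_coef_unique w fourier_sum_sq_int fourier_coef_Bessel f) (simp add: fourier_coef_fourier_sum w fourier_coef_Bessel f)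

lemma fourier_coef_Parseval:
  assumes w: "w \<noteq> 0" and f: "sq_int (torus w) f"
  shows "l2sq (fourier_coef w f) = (L2norm (torus w) f)\<^sup>2 / period w"
  using fourier_sum_Parseval[OF w fourier_coef_Bessel[OF w f]] L2norm_cong_AE[OF fourier_sum_fourier_coef[OF w f]] period_pos[OF w]
  by (simp add: field_simps)

lemma Parseval_iprod:
  assumes w: "w \<noteq> 0" and c: "l2_seq c" and g: "sq_int (torus w) g"
  shows "((\<lambda>n. c n * cnj (fourier_coef w g n)) has_sum (iprod (torus w) (fourier_sum w c) g / of_real (period w))) UNIV"
proof -
  have "((\<lambda>F. iprod (torus w) (trig_sum w c F) g / of_real (period w)) \<longlongrightarrow> iprod (torus w) (fourier_sum w c) g / of_real (period w)) (finite_subsets_at_top UNIV)"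
    using period_pos[OF w] by (intro tendsto_divide L2_conv_iprod[OF _ fourier_sum_sq_int[OF w c] g fourier_sum_lim[OF w c]]) auto
  moreover have "iprod (torus w) (trig_sum w c F) g / of_real (period w) = (\<Sum>n\<in>F. c n * cnj (fourier_coef w g n))" for F
    unfolding trig_sum_def[abs_def]
    by (subst iprod_sum_left) (auto simp: sq_int_cmult g iprod_cmult_left fourier_coef_def iprod_cnj sum_divide_distrib)
  ultimately show ?thesis by (simp add: has_sum_def)
qed

section \<open>Chirps and the kernel of the fractional Fourier transform\<close>

lemma L2_fun_sq_int: "L2_fun f \<longleftrightarrow> sq_int lebesgue f"
  and L2_norm_sq_sq_norm: "L2_norm_sq f = sq_norm lebesgue f"
  by (auto simp: L2_fun_def sq_int_def L2_norm_sq_def sq_norm_def)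

lemma chirp_cis: "chirp \<theta> x = cis (frft_a \<theta> * x\<^sup>2)"
  by (simp add: chirp_def cis_conv_exp)

lemma norm_chirp [simp]: "cmod (chirp \<theta> x) = 1" by (simp add: chirp_cis)

lemma chirp_cnj [simp]: "chirp \<theta> x * cnj (chirp \<theta> x) = 1" "cnj (chirp \<theta> x) * chirp \<theta> x = 1"
  by (simp_all add: chirp_cis cis_cnj cis_mult)

lemma chirp_neq_0 [simp]: "chirp \<theta> x \<noteq> 0" by (simp add: chirp_cis)

lemma chirp_measurable_borel [measurable]: "chirp \<theta> \<in> borel_measurable borel"
  unfolding chirp_def[abs_def] by (intro borel_measurable_continuous_onI continuous_intros)

lemma chirp_measurable [measurable]: "chirp \<theta> \<in> borel_measurable lebesgue"
  by (intro borel_lebesgue chirp_measurable_borel)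

lemma kernel_cis:
  "frft_kernel \<theta> t \<xi> = frft_c \<theta> * chirp \<theta> t * chirp \<theta> \<xi> * cis (- (frft_b \<theta> * t * \<xi>))"
  by (simp add: frft_kernel_def chirp_cis cis_conv_exp exp_add[symmetric]
      algebra_simps)

lemma norm_frft_c:
  assumes "sin \<theta> \<noteq> 0"
  shows "(cmod (frft_c \<theta>))\<^sup>2 = \<bar>frft_b \<theta>\<bar> / (2 * pi)"
proof -
  have "(cmod (frft_c \<theta>))\<^sup>2 = cmod ((frft_c \<theta>)\<^sup>2)" by (simp add: norm_power)
  also have "(frft_c \<theta>)\<^sup>2 = (1 - \<i> * complex_of_real (cot \<theta>)) / complex_of_real (2 * pi)"
    unfolding frft_c_def by (rule power2_csqrt)
  also have "cmod \<dots> = cmod (1 - \<i> * complex_of_real (cot \<theta>)) / (2 * pi)"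
    by (simp add: norm_divide norm_mult)
  also have "cmod (1 - \<i> * complex_of_real (cot \<theta>)) = sqrt (1 + (cot \<theta>)\<^sup>2)"
    by (simp add: cmod_def)
  also have "1 + (cot \<theta>)\<^sup>2 = (1 / sin \<theta>)\<^sup>2"
    using assms sin_cos_squared_add[of \<theta>] by (simp add: cot_def field_simps)
  finally show ?thesis by (simp add: frft_b_def)
qed

lemma frft_b_neq_0: "sin \<theta> \<noteq> 0 \<Longrightarrow> frft_b \<theta> \<noteq> 0" by (simp add: frft_b_def)

lemma frft_Delta_period: "frft_Delta \<theta> = period (frft_b \<theta>)" by (simp add: frft_Delta_def period_def)

lemma norm_frft_c_period: "sin \<theta> \<noteq> 0 \<Longrightarrow> (cmod (frft_c \<theta>))\<^sup>2 = 1 / period (frft_b \<theta>)"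
  by (simp add: norm_frft_c period_def)

section \<open>Plancherel for functions of bounded support\<close>

text \<open>
The Fourier integral with frequency scaled by $b = \csc\theta$, to which the fractional transform
reduces after multiplication by chirps.
\<close>
definition fourier_int :: "real \<Rightarrow> (real \<Rightarrow> complex) \<Rightarrow> real \<Rightarrow> complex" where
  "fourier_int b g \<xi> = (LINT t|lebesgue. g t * cis (- (b * t * \<xi>)))"

lemma cis_measurable [measurable]: "(\<lambda>t. cis (- (b * t * \<xi>))) \<in> borel_measurable lebesgue"
  unfolding cis_conv_exp by (intro borel_lebesgue borel_measurable_continuous_onI continuous_intros)

lemma fourier_int_continuous:
  assumes g: "integrable lebesgue g"
  shows "continuous_on UNIV (fourier_int b g)"
proof -
  have "isCont (fourier_int b g) \<xi>" for \<xi>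
    unfolding continuous_at_sequentially
  proof (intro allI impI)
    fix x assume x: "x \<longlonglongrightarrow> \<xi>"
    show "(fourier_int b g \<circ> x) \<longlonglongrightarrow> fourier_int b g \<xi>"
      unfolding fourier_int_def[abs_def] comp_def
    proof (rule integral_dominated_convergence[where w="\<lambda>t. cmod (g t)"])
      show "AE t in lebesgue. (\<lambda>i. g t * cis (- (b * t * x i))) \<longlonglongrightarrow> g t * cis (- (b * t * \<xi>))"
        unfolding cis_conv_exp by (intro AE_I2 tendsto_intros x)
    qed (use g in \<open>auto simp: norm_mult\<close>)
  qed
  then show ?thesis by (simp add: continuous_on_eq_continuous_at)
qed

lemma fourier_int_measurable: "integrable lebesgue g \<Longrightarrow> fourier_int b g \<in> borel_measurable lebesgue"
  by (intro borel_lebesgue borel_measurable_continuous_onI fourier_int_continuous)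

lemma bounded_supp_integrable:
  fixes u v :: real
  assumes g: "sq_int lebesgue g" and supp: "\<And>t. t \<notin> {u..v} \<Longrightarrow> g t = 0"
  shows "integrable lebesgue g"
proof -
  have "sq_int lebesgue (indicator {u..v} :: real \<Rightarrow> complex)"
  proof -
    have "sq_norm lebesgue (indicator {u..v} :: real \<Rightarrow> complex) = (\<integral>\<^sup>+x. indicator {u..v} x \<partial>lebesgue)"
      unfolding sq_norm_def by (intro nn_integral_cong) (auto simp: indicator_def)
    also have "\<dots> < \<infinity>" by (simp add: emeasure_lborel_Icc_eq)
    finally show ?thesis by (simp add: sq_int_def borel_measurable_indicator)
  qed
  from iprod_integrable[OF g this] show ?thesis
  proof (rule back_subst[where P="integrable lebesgue"])
    show "(\<lambda>x. g x * cnj (indicator {u..v} x)) = g" using supp by (auto simp: indicator_def fun_eq_iff)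
  qed
qed

text \<open>
For $\xi$ fixed, the values at the points $\xi + nQ$ are $P$ times the Fourier coefficients of
$g(t)e^{-ibt\xi}$ on $[0,P]$. By Parseval their squares add up to $P\|g\|^2$, whatever $\xi$ is, and
integration over $\xi \in [0,Q]$ gives $PQ\|g\|^2 = 2\pi\|g\|^2/|b|$.
\<close>
lemma Plancherel_unit:
  assumes b: "b \<noteq> 0" and P: "P > 0" and g: "sq_int lebesgue g" and supp: "\<And>t. t \<notin> {0..P} \<Longrightarrow> g t = 0"
  shows "sq_norm lebesgue (fourier_int b g) = ennreal (2 * pi / \<bar>b\<bar>) * sq_norm lebesgue g"
proof -
  \<comment> \<open>With the sign of $b$ the grid spacing $Q$ is positive, and $bQ = w$ turns a grid step into a
    harmonic of period $P$.\<close>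
  define w where "w = 2 * pi / P * sgn b"
  define Q where "Q = w / b"
  have w: "w \<noteq> 0" using b P by (simp add: w_def sgn_if)
  have period: "period w = P" using b P by (simp add: w_def period_def abs_mult sgn_if)
  have Q: "Q > 0" "b * Q = w" using b P by (auto simp: Q_def w_def sgn_if zero_less_divide_iff mult_less_0_iff divide_less_0_iff)
  have gi: "integrable lebesgue g" by (rule bounded_supp_integrable[OF g supp])
  have [measurable]: "fourier_int b g \<in> borel_measurable lebesgue" by (rule fourier_int_measurable[OF gi])
  have [measurable]: "g \<in> borel_measurable lebesgue" using g by (simp add: sq_int_def)
  define gg where "gg \<xi> t = g t * cis (- (b * t * \<xi>))" for \<xi> t
  have ggm [measurable]: "gg \<xi> \<in> borel_measurable lebesgue" for \<xi> unfolding gg_def[abs_def] by measurable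
  have gn: "sq_norm (torus w) (gg \<xi>) = sq_norm lebesgue g" for \<xi>
    unfolding sq_norm_def using supp
    by (subst nn_integral_restrict_space) (auto intro!: nn_integral_cong simp: gg_def norm_mult period indicator_def)
  have ggs: "sq_int (torus w) (gg \<xi>)" for \<xi>
    using g gn[of \<xi>] by (auto simp: sq_int_def intro: measurable_torus)
  have co: "fourier_int b g (\<xi> + of_int n * Q) = of_real P * fourier_coef w (gg \<xi>) n" for \<xi> n
  proof -
    have e: "cis (- (b * t * (\<xi> + of_int n * Q))) = cis (- (b * t * \<xi>)) * cnj (harmonic w n t)" for t
      unfolding harmonic_def cis_cnj cis_mult Q(2)[symmetric] by (simp add: algebra_simps)
    have "fourier_int b g (\<xi> + of_int n * Q) = (LINT t|lebesgue. gg \<xi> t * cnj (harmonic w n t))"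
      unfolding fourier_int_def gg_def e by (simp only: mult.assoc)
    also have "\<dots> = (LINT t|lebesgue. indicator {0..P} t *\<^sub>R (gg \<xi> t * cnj (harmonic w n t)))"
      using supp by (intro Bochner_Integration.integral_cong) (auto simp: gg_def indicator_def)
    also have "\<dots> = iprod (torus w) (gg \<xi>) (harmonic w n)"
      unfolding iprod_def by (subst integral_restrict_space) (auto simp: period)
    finally show ?thesis using P by (simp add: fourier_coef_def period)
  qed
  have key: "(\<integral>\<^sup>+n. ennreal ((cmod (fourier_int b g (\<xi> + of_int n * Q)))\<^sup>2) \<partial>count_space (UNIV::int set)) = ennreal P * sq_norm lebesgue g" for \<xi>
  proof -
    have l: "l2_seq (fourier_coef w (gg \<xi>))" by (rule fourier_coef_Bessel[OF w ggs])
    have "(\<integral>\<^sup>+n. ennreal ((cmod (fourier_int b g (\<xi> + of_int n * Q)))\<^sup>2) \<partial>count_space (UNIV::int set))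
        = (\<integral>\<^sup>+n. ennreal (P\<^sup>2) * ennreal ((cmod (fourier_coef w (gg \<xi>) n))\<^sup>2) \<partial>count_space UNIV)"
      by (intro nn_integral_cong) (simp add: co norm_mult power_mult_distrib ennreal_mult)
    also have "\<dots> = ennreal (P\<^sup>2) * l2_norm_sq (fourier_coef w (gg \<xi>))"
      by (simp add: nn_integral_cmult l2_norm_sq_def infsum_ennreal_nn_integral)
    also have "\<dots> = ennreal (P\<^sup>2 * ((L2norm (torus w) (gg \<xi>))\<^sup>2 / P))"
      by (simp add: l2_norm_sq_l2sq[OF l] fourier_coef_Parseval[OF w ggs] period ennreal_mult[symmetric] P less_imp_le)
    also have "\<dots> = ennreal P * ennreal ((L2norm (torus w) (gg \<xi>))\<^sup>2)"
      using P by (simp add: ennreal_mult[symmetric] power2_eq_square)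
    also have "\<dots> = ennreal P * sq_norm lebesgue g" by (simp add: sq_norm_L2norm[OF ggs, symmetric] gn)
    finally show ?thesis .
  qed
  have "sq_norm lebesgue (fourier_int b g) = (\<integral>\<^sup>+x. ennreal P * sq_norm lebesgue g \<partial>lebesgue_on {0..Q})"
    unfolding sq_norm_def
    by (subst nn_integral_periodize[OF _ Q(1)]) (auto simp: key[unfolded sq_norm_def])
  also have "\<dots> = ennreal P * sq_norm lebesgue g * ennreal Q"
    using Q(1) by (simp add: emeasure_restrict_space)
  also have "\<dots> = ennreal (P * Q) * sq_norm lebesgue g"
    using P Q(1) by (simp add: ennreal_mult mult_ac)
  also have "P * Q = 2 * pi / \<bar>b\<bar>" using P b by (simp add: Q_def w_def sgn_if)
  finally show ?thesis .
qed

lemma Plancherel_bounded_supp: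
  assumes b: "b \<noteq> 0" and g: "sq_int lebesgue g" and supp: "\<And>t. t \<notin> {u..v} \<Longrightarrow> g t = 0"
  shows "sq_norm lebesgue (fourier_int b g) = ennreal (2 * pi / \<bar>b\<bar>) * sq_norm lebesgue g"
proof -
  define P where "P = max 1 (v - u)"
  have P: "P > 0" by (simp add: P_def)
  define h where "h t = g (t + u)" for t
  have gm [measurable]: "g \<in> borel_measurable lebesgue" using g by (simp add: sq_int_def)
  have "fourier_int b g \<xi> = cis (- (b * u * \<xi>)) * fourier_int b h \<xi>" for \<xi>
  proof -
    have "fourier_int b g \<xi> = (LINT t|lebesgue. g (t + u) * cis (- (b * (t + u) * \<xi>)))"
      unfolding fourier_int_def by (rule integral_shift[symmetric]) measurable
    also have "\<dots> = (LINT t|lebesgue. cis (- (b * u * \<xi>)) * (h t * cis (- (b * t * \<xi>))))"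
      by (intro Bochner_Integration.integral_cong refl) (simp add: h_def cis_mult mult.left_commute algebra_simps)
    finally show ?thesis by (simp add: fourier_int_def)
  qed
  then have "sq_norm lebesgue (fourier_int b g) = sq_norm lebesgue (fourier_int b h)"
    by (simp add: sq_norm_def norm_mult)
  also have "\<dots> = ennreal (2 * pi / \<bar>b\<bar>) * sq_norm lebesgue h"
  proof (rule Plancherel_unit[OF b P])
    show "sq_int lebesgue h" unfolding h_def[abs_def] by (rule sq_int_shift[OF g])
    fix t assume "t \<notin> {0..P}"
    then show "h t = 0" unfolding h_def by (intro supp) (auto simp: P_def)
  qed
  also have "sq_norm lebesgue h = sq_norm lebesgue g"
    unfolding h_def[abs_def] by (rule sq_norm_shift[OF gm])
  finally show ?thesis .
qed

definition frft_int :: "real \<Rightarrow> (real \<Rightarrow> complex) \<Rightarrow> real \<Rightarrow> complex" where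
  "frft_int \<theta> f \<xi> = (LINT t|lebesgue. f t * frft_kernel \<theta> t \<xi>)"

lemma frft_int_fourier_int: "frft_int \<theta> f \<xi> = frft_c \<theta> * chirp \<theta> \<xi> * fourier_int (frft_b \<theta>) (\<lambda>t. chirp \<theta> t * f t) \<xi>"
  unfolding frft_int_def fourier_int_def kernel_cis
  by (subst integral_mult_right_zero[symmetric]) (simp add: mult_ac)

lemma sq_int_chirp: "sq_int lebesgue f \<Longrightarrow> sq_int lebesgue (\<lambda>t. chirp \<theta> t * f t)"
  by (rule sq_int_bounded[of _ f _ 1]) (auto simp: norm_mult sq_int_def)

lemma frft_int_measurable:
  assumes f: "sq_int lebesgue f" and supp: "\<And>t. t \<notin> {u..v} \<Longrightarrow> f t = 0"
  shows "frft_int \<theta> f \<in> borel_measurable lebesgue"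
proof -
  have "integrable lebesgue (\<lambda>t. chirp \<theta> t * f t)"
    by (rule bounded_supp_integrable[OF sq_int_chirp[OF f], of u v]) (simp add: supp)
  from fourier_int_measurable[OF this] show ?thesis
    unfolding frft_int_fourier_int[abs_def] by measurable
qed

text \<open>
The factor $|c(\theta)|^2 = |b|/(2\pi)$ is exactly the inverse of the constant in Plancherel's
formula, and chirps are unimodular.
\<close>
lemma frft_int_isometry:
  assumes \<theta>: "sin \<theta> \<noteq> 0" and f: "sq_int lebesgue f" and supp: "\<And>t. t \<notin> {u..v} \<Longrightarrow> f t = 0"
  shows "sq_norm lebesgue (frft_int \<theta> f) = sq_norm lebesgue f"
proof -
  let ?b = "frft_b \<theta>"
  let ?g = "\<lambda>t. chirp \<theta> t * f t"
  have gi: "integrable lebesgue ?g"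
    by (rule bounded_supp_integrable[OF sq_int_chirp[OF f], of u v]) (simp add: supp)
  have "sq_norm lebesgue (frft_int \<theta> f) = sq_norm lebesgue (\<lambda>\<xi>. chirp \<theta> \<xi> * (frft_c \<theta> * fourier_int ?b ?g \<xi>))"
    by (simp add: frft_int_fourier_int[abs_def] mult_ac)
  also have "\<dots> = sq_norm lebesgue (\<lambda>\<xi>. frft_c \<theta> * fourier_int ?b ?g \<xi>)"
    by (rule sq_norm_unimodular) simp
  also have "\<dots> = ennreal ((cmod (frft_c \<theta>))\<^sup>2) * sq_norm lebesgue (fourier_int ?b ?g)"
    by (rule sq_norm_cmult[OF fourier_int_measurable[OF gi]])
  also have "\<dots> = ennreal ((cmod (frft_c \<theta>))\<^sup>2) * (ennreal (2 * pi / \<bar>?b\<bar>) * sq_norm lebesgue ?g)"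
    by (subst Plancherel_bounded_supp[OF frft_b_neq_0[OF \<theta>] sq_int_chirp[OF f], of u v]) (auto simp: supp)
  also have "\<dots> = ennreal ((cmod (frft_c \<theta>))\<^sup>2 * (2 * pi / \<bar>?b\<bar>)) * sq_norm lebesgue ?g"
    by (subst ennreal_mult) (simp_all add: mult.assoc)
  also have "(cmod (frft_c \<theta>))\<^sup>2 * (2 * pi / \<bar>?b\<bar>) = 1"
    using frft_b_neq_0[OF \<theta>] by (simp add: norm_frft_c[OF \<theta>])
  also have "sq_norm lebesgue ?g = sq_norm lebesgue f" by (rule sq_norm_unimodular) simp
  finally show ?thesis by simp
qed

lemma kernel_integrable:
  assumes f: "sq_int lebesgue f" and supp: "\<And>t. t \<notin> {u..v} \<Longrightarrow> f t = 0"
  shows "integrable lebesgue (\<lambda>t. f t * frft_kernel \<theta> t \<xi>)"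
proof (rule Bochner_Integration.integrable_bound[OF integrable_mult_right[OF bounded_supp_integrable[OF f supp], of "frft_c \<theta>"]])
  have [measurable]: "f \<in> borel_measurable lebesgue" using f by (simp add: sq_int_def)
  show "(\<lambda>t. f t * frft_kernel \<theta> t \<xi>) \<in> borel_measurable lebesgue" unfolding kernel_cis by measurable
  show "AE t in lebesgue. norm (f t * frft_kernel \<theta> t \<xi>) \<le> norm (frft_c \<theta> * f t)"
    by (simp add: kernel_cis norm_mult)
qed auto

lemma frft_int_add_cmult:
  assumes f: "sq_int lebesgue f" "\<And>t. t \<notin> {u..v} \<Longrightarrow> f t = 0" and g: "sq_int lebesgue g" "\<And>t. t \<notin> {u..v} \<Longrightarrow> g t = 0"
  shows "frft_int \<theta> (\<lambda>t. c * f t + g t) \<xi> = c * frft_int \<theta> f \<xi> + frft_int \<theta> g \<xi>"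
  unfolding frft_int_def using kernel_integrable[OF f, where \<theta>=\<theta> and \<xi>=\<xi>] kernel_integrable[OF g, where \<theta>=\<theta> and \<xi>=\<xi>]
  by (simp add: distrib_right mult.assoc)

section \<open>The fractional Fourier transform of square-integrable functions\<close>

definition trunc :: "real \<Rightarrow> (real \<Rightarrow> complex) \<Rightarrow> real \<Rightarrow> complex" where
  "trunc R f t = indicator {-R..R} t * f t"

lemma trunc_supp: "t \<notin> {-R..R} \<Longrightarrow> trunc R f t = 0" by (simp add: trunc_def)

lemma trunc_sq_int: 
  assumes f: "sq_int lebesgue f" shows "sq_int lebesgue (trunc R f)"
proof (rule sq_int_bounded[OF f, of _ 1])
  have [measurable]: "f \<in> borel_measurable lebesgue" using f by (simp add: sq_int_def)
  have [measurable]: "(indicator {-R..R} :: real \<Rightarrow> complex) \<in> borel_measurable lebesgue"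
    by (intro borel_lebesgue) simp
  show "trunc R f \<in> borel_measurable lebesgue" unfolding trunc_def[abs_def] by measurable
qed (auto simp: trunc_def indicator_def)

lemma trunc_lim:
  assumes f: "sq_int lebesgue f" shows "L2_conv lebesgue (\<lambda>R. trunc R f) f at_top"
proof -
  have fm [measurable]: "f \<in> borel_measurable lebesgue" using f by (simp add: sq_int_def)
  have [measurable]: "trunc R f \<in> borel_measurable lebesgue" for R using trunc_sq_int[OF f] by (simp add: sq_int_def)
  have "(\<lambda>n. sq_norm lebesgue (\<lambda>t. f t - trunc (real n) f t)) \<longlonglongrightarrow> (\<integral>\<^sup>+t. 0 \<partial>(lebesgue::real measure))"
    unfolding sq_norm_def
  proof (rule nn_integral_dominated_convergence[where w="\<lambda>t. ennreal ((cmod (f t))\<^sup>2)"])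
    show "(\<integral>\<^sup>+t. ennreal ((cmod (f t))\<^sup>2) \<partial>lebesgue) < \<infinity>" using f by (simp add: sq_int_def sq_norm_def)
    show "AE t in lebesgue. ennreal ((cmod (f t - trunc (real n) f t))\<^sup>2) \<le> ennreal ((cmod (f t))\<^sup>2)" for n
      by (auto simp: trunc_def indicator_def)
    show "AE t in lebesgue. (\<lambda>n. ennreal ((cmod (f t - trunc (real n) f t))\<^sup>2)) \<longlonglongrightarrow> 0"
    proof (rule AE_I2, rule tendsto_eventually)
      fix t :: real
      have "f t - trunc (real n) f t = 0" if "n \<ge> nat \<lceil>\<bar>t\<bar>\<rceil>" for n
        using that by (auto simp: trunc_def indicator_def nat_le_iff ceiling_le_iff)
      then show "\<forall>\<^sub>F n in sequentially. ennreal ((cmod (f t - trunc (real n) f t))\<^sup>2) = 0"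
        by (intro eventually_sequentiallyI[of "nat \<lceil>\<bar>t\<bar>\<rceil>"]) (simp del: right_minus_eq)
    qed
  qed auto
  then have lim: "(\<lambda>n. sq_norm lebesgue (\<lambda>t. f t - trunc (real n) f t)) \<longlonglongrightarrow> 0" by simp
  show ?thesis unfolding L2_conv_def
  proof (rule tendsto_zero_ennreal)
    fix r :: real assume "0 < r"
    from eventually_happens[OF sq_norm_small_ev[OF lim this]]
    obtain n where n: "sq_norm lebesgue (\<lambda>t. f t - trunc (real n) f t) < ennreal r" by auto
    have "sq_norm lebesgue (\<lambda>t. f t - trunc R f t) \<le> sq_norm lebesgue (\<lambda>t. f t - trunc (real n) f t)" if "R \<ge> real n" for R
      using that by (intro sq_norm_mono_AE) (auto simp: trunc_def indicator_def)
    with n show "\<forall>\<^sub>F R in at_top. sq_norm lebesgue (\<lambda>t. f t - trunc R f t) < ennreal r"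
      unfolding eventually_at_top_linorder by (meson order.strict_trans1)
  qed
qed

lemma sq_norm_frft_int_diff:
  assumes \<theta>: "sin \<theta> \<noteq> 0" and f: "sq_int lebesgue f" "\<And>t. t \<notin> {u..v} \<Longrightarrow> f t = 0" and g: "sq_int lebesgue g" "\<And>t. t \<notin> {u'..v'} \<Longrightarrow> g t = 0"
  shows "sq_norm lebesgue (\<lambda>\<xi>. frft_int \<theta> f \<xi> - frft_int \<theta> g \<xi>) = sq_norm lebesgue (\<lambda>t. f t - g t)"
proof -
  let ?u = "min u u'" and ?v = "max v v'"
  have f0: "t \<notin> {?u..?v} \<Longrightarrow> f t = 0" and g0: "t \<notin> {?u..?v} \<Longrightarrow> g t = 0" for t
    using f(2)[of t] g(2)[of t] by (auto simp: min_def max_def split: if_splits)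
  have "frft_int \<theta> f \<xi> - frft_int \<theta> g \<xi> = frft_int \<theta> (\<lambda>t. f t - g t) \<xi>" for \<xi>
  proof -
    have "(\<lambda>t. f t - g t) = (\<lambda>t. (-1) * g t + f t)" by auto
    then show ?thesis
      using frft_int_add_cmult[OF g(1) g0 f(1) f0, where \<theta>=\<theta> and c="-1" and \<xi>=\<xi>] by simp
  qed
  then have "sq_norm lebesgue (\<lambda>\<xi>. frft_int \<theta> f \<xi> - frft_int \<theta> g \<xi>) = sq_norm lebesgue (frft_int \<theta> (\<lambda>t. f t - g t))" by simp
  also have "\<dots> = sq_norm lebesgue (\<lambda>t. f t - g t)"
    by (rule frft_int_isometry[OF \<theta> sq_int_diff[OF f(1) g(1)], of ?u ?v]) (simp add: f0 g0)
  finally show ?thesis .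
qed

text \<open>
Differences of transforms of truncations are transforms of functions of bounded support, so the
isometry carries the Cauchy property from the truncations to their transforms. The following two
facts are the content of the definition of \<open>frft\<close> for square-integrable functions.
\<close>
lemma frft_exists:
  assumes \<theta>: "sin \<theta> \<noteq> 0" and f: "sq_int lebesgue f"
  shows "\<exists>g. sq_int lebesgue g \<and> L2_conv lebesgue (\<lambda>R. frft_int \<theta> (trunc R f)) g at_top"
proof -
  have m: "frft_int \<theta> (trunc R f) \<in> borel_measurable lebesgue" for R
    by (rule frft_int_measurable[OF trunc_sq_int[OF f] trunc_supp])
  have s: "sq_int lebesgue (frft_int \<theta> (trunc R f))" for R
    using frft_int_isometry[OF \<theta> trunc_sq_int[OF f] trunc_supp] trunc_sq_int[OF f, of R] m by (simp add: sq_int_def)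
  have "\<exists>s. strict_mono s \<and> L2_conv lebesgue (\<lambda>R. frft_int \<theta> (trunc R f)) (\<lambda>x. lim (\<lambda>k. frft_int \<theta> (trunc (real (s k)) f) x)) at_top"
  proof (rule L2_complete[OF m filterlim_real_sequentially])
    fix e :: real assume "e > 0"
    show "\<exists>P. eventually P at_top \<and> (\<forall>i j. P i \<longrightarrow> P j \<longrightarrow> sq_norm lebesgue (\<lambda>x. frft_int \<theta> (trunc i f) x - frft_int \<theta> (trunc j f) x) \<le> ennreal e)"
      using L2_conv_Cauchy[OF sq_intD[OF trunc_sq_int[OF f]] sq_intD[OF f] trunc_lim[OF f] \<open>e > 0\<close>]
      by (simp only: sq_norm_frft_int_diff[OF \<theta> trunc_sq_int[OF f] trunc_supp trunc_sq_int[OF f] trunc_supp])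
  qed
  then obtain s where "L2_conv lebesgue (\<lambda>R. frft_int \<theta> (trunc R f)) (\<lambda>x. lim (\<lambda>k. frft_int \<theta> (trunc (real (s k)) f) x)) at_top"
    by metis
  moreover have "(\<lambda>x. lim (\<lambda>k. frft_int \<theta> (trunc (real (s k)) f) x)) \<in> borel_measurable lebesgue"
    by (rule borel_measurable_lim_metric) (rule m)
  ultimately show ?thesis
    using L2_conv_sq_int[where f="\<lambda>R. frft_int \<theta> (trunc R f)", OF s] trivial_limit_at_top_linorder by blast
qed

lemma
  assumes \<theta>: "sin \<theta> \<noteq> 0" and f: "sq_int lebesgue f"
  shows frft_sq_int: "sq_int lebesgue (frft \<theta> f)"
    and frft_lim: "L2_conv lebesgue (\<lambda>R. frft_int \<theta> (trunc R f)) (frft \<theta> f) at_top"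
proof -
  have e: "(LINT t:{-R..R}|lebesgue. f t * frft_kernel \<theta> t \<xi>) = frft_int \<theta> (trunc R f) \<xi>" for R \<xi>
    unfolding set_lebesgue_integral_def frft_int_def trunc_def
    by (intro Bochner_Integration.integral_cong) (auto simp: indicator_def)
  have "frft \<theta> f = (SOME g. sq_int lebesgue g \<and> L2_conv lebesgue (\<lambda>R. frft_int \<theta> (trunc R f)) g at_top)"
    by (simp add: frft_def e L2_conv_def L2_fun_sq_int L2_norm_sq_sq_norm)
  then have "sq_int lebesgue (frft \<theta> f) \<and> L2_conv lebesgue (\<lambda>R. frft_int \<theta> (trunc R f)) (frft \<theta> f) at_top"
    using someI_ex[OF frft_exists[OF assms]] by simp
  then show "sq_int lebesgue (frft \<theta> f)" "L2_conv lebesgue (\<lambda>R. frft_int \<theta> (trunc R f)) (frft \<theta> f) at_top" by auto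
qed

lemma frft_isometry:
  assumes \<theta>: "sin \<theta> \<noteq> 0" and f: "sq_int lebesgue f"
  shows "L2norm lebesgue (frft \<theta> f) = L2norm lebesgue f"
proof (rule tendsto_unique[OF trivial_limit_at_top_linorder])
  have m: "frft_int \<theta> (trunc R f) \<in> borel_measurable lebesgue" for R
    by (rule frft_int_measurable[OF trunc_sq_int[OF f] trunc_supp])
  have n: "sq_norm lebesgue (frft_int \<theta> (trunc R f)) = sq_norm lebesgue (trunc R f)" for R
    by (rule frft_int_isometry[OF \<theta> trunc_sq_int[OF f] trunc_supp])
  have s: "sq_int lebesgue (frft_int \<theta> (trunc R f))" for R
    using n trunc_sq_int[OF f, of R] m by (simp add: sq_int_def)
  show "((\<lambda>R. L2norm lebesgue (frft_int \<theta> (trunc R f))) \<longlongrightarrow> L2norm lebesgue (frft \<theta> f)) at_top"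
    by (rule L2_conv_L2norm_tendsto[OF s frft_sq_int[OF \<theta> f] frft_lim[OF \<theta> f]])
  show "((\<lambda>R. L2norm lebesgue (frft_int \<theta> (trunc R f))) \<longlongrightarrow> L2norm lebesgue f) at_top"
    using L2_conv_L2norm_tendsto[OF trunc_sq_int[OF f] f trunc_lim[OF f]] by (simp add: L2norm_def n)
qed

lemma frft_int_trunc_sq_int:
  assumes \<theta>: "sin \<theta> \<noteq> 0" and f: "sq_int lebesgue f"
  shows "sq_int lebesgue (frft_int \<theta> (trunc R f))"
  using frft_int_isometry[OF \<theta> trunc_sq_int[OF f] trunc_supp] trunc_sq_int[OF f, of R]
    frft_int_measurable[OF trunc_sq_int[OF f] trunc_supp] by (simp add: sq_int_def)

lemma frft_add_cmult:
  assumes \<theta>: "sin \<theta> \<noteq> 0" and f: "sq_int lebesgue f" and g: "sq_int lebesgue g"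
  shows "AE \<xi> in lebesgue. frft \<theta> (\<lambda>t. c * f t + g t) \<xi> = c * frft \<theta> f \<xi> + frft \<theta> g \<xi>"
proof -
  have h: "sq_int lebesgue (\<lambda>t. c * f t + g t)" by (intro sq_int_add sq_int_cmult f g)
  have tr: "frft_int \<theta> (trunc R (\<lambda>t. c * f t + g t)) = (\<lambda>\<xi>. c * frft_int \<theta> (trunc R f) \<xi> + frft_int \<theta> (trunc R g) \<xi>)" for R
  proof
    fix \<xi>
    have "trunc R (\<lambda>t. c * f t + g t) = (\<lambda>t. c * trunc R f t + trunc R g t)"
      by (simp add: trunc_def fun_eq_iff algebra_simps)
    then show "frft_int \<theta> (trunc R (\<lambda>t. c * f t + g t)) \<xi> = c * frft_int \<theta> (trunc R f) \<xi> + frft_int \<theta> (trunc R g) \<xi>"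
      using frft_int_add_cmult[OF trunc_sq_int[OF f] trunc_supp trunc_sq_int[OF g] trunc_supp] by simp
  qed
  have l: "L2_conv lebesgue (\<lambda>R. frft_int \<theta> (trunc R (\<lambda>t. c * f t + g t))) (\<lambda>\<xi>. c * frft \<theta> f \<xi> + frft \<theta> g \<xi>) at_top"
    unfolding tr
    by (rule L2_conv_add_cmult[OF frft_int_trunc_sq_int[OF \<theta> f] frft_sq_int[OF \<theta> f] frft_lim[OF \<theta> f]
       frft_int_trunc_sq_int[OF \<theta> g] frft_sq_int[OF \<theta> g] frft_lim[OF \<theta> g]])
  have s: "sq_int lebesgue (\<lambda>\<xi>. c * frft \<theta> f \<xi> + frft \<theta> g \<xi>)"
    by (intro sq_int_add sq_int_cmult frft_sq_int \<theta> f g)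
  show ?thesis
    by (rule L2_conv_unique[OF sq_intD[OF frft_int_trunc_sq_int[OF \<theta> h]] sq_intD[OF frft_sq_int[OF \<theta> h]] sq_intD[OF s]
       frft_lim[OF \<theta> h] l trivial_limit_at_top_linorder])
qed

lemma frft_diff:
  assumes \<theta>: "sin \<theta> \<noteq> 0" and f: "sq_int lebesgue f" and g: "sq_int lebesgue g"
  shows "AE \<xi> in lebesgue. frft \<theta> (\<lambda>t. f t - g t) \<xi> = frft \<theta> f \<xi> - frft \<theta> g \<xi>"
  using frft_add_cmult[OF \<theta> g f, of "-1"] by simp

lemma frft_sq_norm_diff:
  assumes \<theta>: "sin \<theta> \<noteq> 0" and f: "sq_int lebesgue f" and g: "sq_int lebesgue g"
  shows "sq_norm lebesgue (\<lambda>\<xi>. frft \<theta> f \<xi> - frft \<theta> g \<xi>) = sq_norm lebesgue (\<lambda>t. f t - g t)"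
proof -
  have d: "sq_int lebesgue (\<lambda>t. f t - g t)" by (intro sq_int_diff f g)
  have "sq_norm lebesgue (\<lambda>\<xi>. frft \<theta> f \<xi> - frft \<theta> g \<xi>) = sq_norm lebesgue (frft \<theta> (\<lambda>t. f t - g t))"
    using frft_diff[OF \<theta> f g] by (intro sq_norm_cong_AE) auto
  also have "\<dots> = sq_norm lebesgue (\<lambda>t. f t - g t)"
    by (simp add: sq_norm_L2norm frft_sq_int[OF \<theta> d] d frft_isometry[OF \<theta> d])
  finally show ?thesis .
qed

lemma frft_sum:
  assumes \<theta>: "sin \<theta> \<noteq> 0" and F: "finite F" and f: "\<And>i. i \<in> F \<Longrightarrow> sq_int lebesgue (f i)"
  shows "AE \<xi> in lebesgue. frft \<theta> (\<lambda>t. \<Sum>i\<in>F. c i * f i t) \<xi> = (\<Sum>i\<in>F. c i * frft \<theta> (f i) \<xi>)"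
  using F f
proof (induction F)
  case empty
  have "L2norm lebesgue (frft \<theta> (\<lambda>t. 0)) = 0"
    using frft_isometry[OF \<theta> sq_int_zero] by (simp add: L2norm_def sq_norm_def)
  then show ?case using L2norm_eq_0[OF frft_sq_int[OF \<theta> sq_int_zero]] by simp
next
  case (insert i F)
  have "sq_int lebesgue (\<lambda>t. \<Sum>i\<in>F. c i * f i t)" by (intro sq_int_sum sq_int_cmult insert.prems) auto
  note step = frft_add_cmult[OF \<theta> insert.prems[OF insertI1] this, of "c i"]
  have "AE \<xi> in lebesgue. frft \<theta> (\<lambda>t. \<Sum>i\<in>F. c i * f i t) \<xi> = (\<Sum>i\<in>F. c i * frft \<theta> (f i) \<xi>)"
    by (rule insert.IH) (rule insert.prems[OF insertI2])
  with step show ?case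
  proof eventually_elim
    case (elim \<xi>)
    then show ?case using insert.hyps by simp
  qed
qed

lemma frft_iprod:
  assumes \<theta>: "sin \<theta> \<noteq> 0" and f: "sq_int lebesgue f" and g: "sq_int lebesgue g"
  shows "iprod lebesgue (frft \<theta> f) (frft \<theta> g) = iprod lebesgue f g"
proof -
  have re: "Re (iprod lebesgue (frft \<theta> h) (frft \<theta> g)) = Re (iprod lebesgue h g)" if h: "sq_int lebesgue h" for h
  proof -
    have "(L2norm lebesgue (\<lambda>\<xi>. frft \<theta> h \<xi> + frft \<theta> g \<xi>))\<^sup>2 = (L2norm lebesgue (frft \<theta> (\<lambda>t. h t + g t)))\<^sup>2"
      using frft_add_cmult[OF \<theta> h g, of 1]
      by (intro arg_cong[where f="\<lambda>x. x\<^sup>2"] L2norm_cong_AE) auto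
    also have "\<dots> = (L2norm lebesgue (\<lambda>t. h t + g t))\<^sup>2"
      by (simp add: frft_isometry[OF \<theta> sq_int_add[OF h g]])
    finally show ?thesis
      using L2norm_add_sq[OF h g] L2norm_add_sq[OF frft_sq_int[OF \<theta> h] frft_sq_int[OF \<theta> g]]
      by (simp add: frft_isometry[OF \<theta> h] frft_isometry[OF \<theta> g])
  qed
  have i: "sq_int lebesgue (\<lambda>t. \<i> * f t)" by (rule sq_int_cmult[OF f])
  have "AE \<xi> in lebesgue. frft \<theta> (\<lambda>t. \<i> * f t) \<xi> = \<i> * frft \<theta> f \<xi>"
    using frft_sum[OF \<theta>, of "{()}" "\<lambda>_. f" "\<lambda>_. \<i>"] f by simp
  then have "iprod lebesgue (frft \<theta> (\<lambda>t. \<i> * f t)) (frft \<theta> g) = iprod lebesgue (\<lambda>\<xi>. \<i> * frft \<theta> f \<xi>) (frft \<theta> g)"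
    unfolding iprod_def
    using sq_intD[OF frft_sq_int[OF \<theta> i]] sq_intD[OF frft_sq_int[OF \<theta> f]] sq_intD[OF frft_sq_int[OF \<theta> g]]
    by (intro integral_cong_AE) auto
  then have "Im (iprod lebesgue (frft \<theta> f) (frft \<theta> g)) = Im (iprod lebesgue f g)"
    using re[OF i] by (simp add: iprod_cmult_left)
  with re[OF f] show ?thesis by (simp add: complex_eq_iff)
qed

text \<open>
For bounded support the truncations are eventually the function itself.
\<close>
lemma frft_bounded_supp:
  assumes \<theta>: "sin \<theta> \<noteq> 0" and f: "sq_int lebesgue f" and supp: "\<And>t. t \<notin> {u..v} \<Longrightarrow> f t = 0"
  shows "AE \<xi> in lebesgue. frft \<theta> f \<xi> = frft_int \<theta> f \<xi>"
proof -
  have ev: "trunc R f = f" if "R \<ge> max (-u) v" for R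
  proof
    fix t show "trunc R f t = f t"
      using that supp[of t] by (cases "t \<in> {u..v}") (auto simp: trunc_def indicator_def)
  qed
  have "L2_conv lebesgue (\<lambda>R. frft_int \<theta> (trunc R f)) (frft_int \<theta> f) at_top"
    unfolding L2_conv_def
  proof (rule tendsto_eventually)
    show "\<forall>\<^sub>F R in at_top. sq_norm lebesgue (\<lambda>\<xi>. frft_int \<theta> f \<xi> - frft_int \<theta> (trunc R f) \<xi>) = 0"
      using eventually_ge_at_top[of "max (-u) v"] by eventually_elim (simp only: ev, simp add: sq_norm_def)
  qed
  then show ?thesis
    by (intro L2_conv_unique[where f="\<lambda>R. frft_int \<theta> (trunc R f)", OF sq_intD[OF frft_int_trunc_sq_int[OF \<theta> f]] sq_intD[OF frft_sq_int[OF \<theta> f]] frft_int_measurable[OF f supp]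
       frft_lim[OF \<theta> f] _ trivial_limit_at_top_linorder])
qed

text \<open>
The unitary shift of the fractional theory: an ordinary translation of $\lambda f$.
\<close>
definition chirp_shift :: "real \<Rightarrow> real \<Rightarrow> (real \<Rightarrow> complex) \<Rightarrow> real \<Rightarrow> complex" where
  "chirp_shift \<theta> s f t = cnj (chirp \<theta> t) * (chirp \<theta> (t - s) * f (t - s))"

lemma chirp_shift_measurable: "f \<in> borel_measurable lebesgue \<Longrightarrow> chirp_shift \<theta> s f \<in> borel_measurable lebesgue"
  using measurable_shift[of "\<lambda>t. chirp \<theta> t * f t" "-s"] unfolding chirp_shift_def[abs_def] by simp

lemma chirp_shift_sq_norm: "f \<in> borel_measurable lebesgue \<Longrightarrow> sq_norm lebesgue (chirp_shift \<theta> s f) = sq_norm lebesgue f"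
  using sq_norm_shift[of f "-s"] by (simp add: chirp_shift_def[abs_def] sq_norm_def norm_mult)

lemma chirp_shift_sq_int: "sq_int lebesgue f \<Longrightarrow> sq_int lebesgue (chirp_shift \<theta> s f)"
  by (simp add: sq_int_def chirp_shift_sq_norm chirp_shift_measurable)

lemma frft_int_chirp_shift:
  assumes f: "f \<in> borel_measurable lebesgue"
  shows "frft_int \<theta> (chirp_shift \<theta> s f) \<xi> = cis (- (frft_b \<theta> * s * \<xi>)) * frft_int \<theta> f \<xi>"
proof -
  have [measurable]: "f \<in> borel_measurable lebesgue" by fact
  have hm: "(\<lambda>t. chirp \<theta> (t - s) * f (t - s)) \<in> borel_measurable lebesgue"
    using measurable_shift[of "\<lambda>t. chirp \<theta> t * f t" "-s"] by simp
  have e: "cis (- (frft_b \<theta> * (t + s) * \<xi>)) = cis (- (frft_b \<theta> * s * \<xi>)) * cis (- (frft_b \<theta> * t * \<xi>))" for t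
    by (simp add: cis_mult algebra_simps)
  let ?g = "\<lambda>t. frft_c \<theta> * chirp \<theta> \<xi> * (chirp \<theta> (t - s) * f (t - s)) * cis (- (frft_b \<theta> * t * \<xi>))"
  have "frft_int \<theta> (chirp_shift \<theta> s f) \<xi> = (LINT t|lebesgue. ?g t)"
    unfolding frft_int_def kernel_cis chirp_shift_def
    by (intro Bochner_Integration.integral_cong refl) (simp add: mult_ac)
  also have "\<dots> = (LINT t|lebesgue. ?g (t + s))"
    by (rule integral_shift[symmetric]) (rule borel_measurable_times[OF borel_measurable_times[OF borel_measurable_const hm] cis_measurable])
  also have "\<dots> = (LINT t|lebesgue. cis (- (frft_b \<theta> * s * \<xi>)) * (f t * frft_kernel \<theta> t \<xi>))"
    unfolding kernel_cis e
    by (intro Bochner_Integration.integral_cong refl) (simp add: mult_ac)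
  finally show ?thesis by (simp add: frft_int_def)
qed

text \<open>
The identity is a change of variables for bounded support. Both sides are isometric in $f$, so it
extends along truncations.
\<close>
lemma frft_chirp_shift:
  assumes \<theta>: "sin \<theta> \<noteq> 0" and f: "sq_int lebesgue f"
  shows "AE \<xi> in lebesgue. frft \<theta> (chirp_shift \<theta> s f) \<xi> = cis (- (frft_b \<theta> * s * \<xi>)) * frft \<theta> f \<xi>"
proof -
  let ?e = "\<lambda>\<xi>. cis (- (frft_b \<theta> * s * \<xi>))"
  have em [measurable]: "?e \<in> borel_measurable lebesgue" 
    unfolding cis_conv_exp by (intro borel_lebesgue borel_measurable_continuous_onI continuous_intros)
  have fm: "f \<in> borel_measurable lebesgue" using f by (simp add: sq_int_def)
  have tm: "trunc R f \<in> borel_measurable lebesgue" for R using trunc_sq_int[OF f] by (simp add: sq_int_def)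
  have cs: "sq_int lebesgue (chirp_shift \<theta> s f)" by (rule chirp_shift_sq_int[OF f])
  have ct: "sq_int lebesgue (chirp_shift \<theta> s (trunc R f))" for R by (rule chirp_shift_sq_int[OF trunc_sq_int[OF f]])
  have AE1: "AE \<xi> in lebesgue. frft \<theta> (chirp_shift \<theta> s (trunc R f)) \<xi> = ?e \<xi> * frft_int \<theta> (trunc R f) \<xi>" for R
    unfolding frft_int_chirp_shift[OF tm, symmetric]
    by (rule frft_bounded_supp[where u="s - R" and v="s + R", OF \<theta> ct]) (auto simp: chirp_shift_def trunc_def)
  have l1: "L2_conv lebesgue (\<lambda>R. \<lambda>\<xi>. ?e \<xi> * frft_int \<theta> (trunc R f) \<xi>) (frft \<theta> (chirp_shift \<theta> s f)) at_top"
  proof -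
    have "sq_norm lebesgue (\<lambda>\<xi>. frft \<theta> (chirp_shift \<theta> s f) \<xi> - ?e \<xi> * frft_int \<theta> (trunc R f) \<xi>) = sq_norm lebesgue (\<lambda>t. f t - trunc R f t)" for R
    proof -
      have "sq_norm lebesgue (\<lambda>\<xi>. frft \<theta> (chirp_shift \<theta> s f) \<xi> - ?e \<xi> * frft_int \<theta> (trunc R f) \<xi>)
          = sq_norm lebesgue (\<lambda>\<xi>. frft \<theta> (chirp_shift \<theta> s f) \<xi> - frft \<theta> (chirp_shift \<theta> s (trunc R f)) \<xi>)"
        using AE1[of R] by (intro sq_norm_cong_AE) auto
      also have "\<dots> = sq_norm lebesgue (\<lambda>t. chirp_shift \<theta> s f t - chirp_shift \<theta> s (trunc R f) t)"
        by (rule frft_sq_norm_diff[OF \<theta> cs ct])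
      also have "(\<lambda>t. chirp_shift \<theta> s f t - chirp_shift \<theta> s (trunc R f) t) = chirp_shift \<theta> s (\<lambda>t. f t - trunc R f t)"
        by (simp add: chirp_shift_def fun_eq_iff algebra_simps)
      also have "sq_norm lebesgue \<dots> = sq_norm lebesgue (\<lambda>t. f t - trunc R f t)"
        using fm tm by (intro chirp_shift_sq_norm) auto
      finally show ?thesis .
    qed
    then show ?thesis using trunc_lim[OF f] by (simp add: L2_conv_def)
  qed
  have l2: "L2_conv lebesgue (\<lambda>R. \<lambda>\<xi>. ?e \<xi> * frft_int \<theta> (trunc R f) \<xi>) (\<lambda>\<xi>. ?e \<xi> * frft \<theta> f \<xi>) at_top"
    using frft_lim[OF \<theta> f] sq_norm_unimodular[of ?e lebesgue]
    by (simp add: L2_conv_def right_diff_distrib[symmetric])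
  have im: "frft_int \<theta> (trunc R f) \<in> borel_measurable lebesgue" for R using frft_int_trunc_sq_int[OF \<theta> f] by (simp add: sq_int_def)
  have fm': "frft \<theta> f \<in> borel_measurable lebesgue" using frft_sq_int[OF \<theta> f] by (simp add: sq_int_def)
  show ?thesis
    by (rule L2_conv_unique[OF borel_measurable_times[OF em im] sq_intD[OF frft_sq_int[OF \<theta> cs]]
       borel_measurable_times[OF em fm'] l1 l2 trivial_limit_at_top_linorder])
qed

section \<open>Chirp-modulated shift-invariant spaces\<close>

locale chirp_space =
  fixes \<theta> :: real and \<phi> :: "real \<Rightarrow> complex" and A B :: real
  assumes sin: "sin \<theta> \<noteq> 0"
    and phi: "sq_int lebesgue \<phi>"
    and AB: "0 < A" "A \<le> B"
    and G: "AE \<xi> in lebesgue. \<xi> \<in> {0..frft_Delta \<theta>} \<longrightarrow> ennreal A \<le> G_fun \<theta> \<phi> \<xi> \<and> G_fun \<theta> \<phi> \<xi> \<le> ennreal B"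
    and C: "\<And>t. C_fun \<theta> \<phi> t < \<infinity>"
begin

text \<open>
The sign is chosen so that \<open>harmonic w n\<close> is $e^{-ibn\xi}$, the factor that the transform
acquires under a shift by $n$.
\<close>
definition w where "w = - frft_b \<theta>"

lemma w: "w \<noteq> 0" using frft_b_neq_0[OF sin] by (simp add: w_def)

lemma Delta: "frft_Delta \<theta> = period w" by (simp add: frft_Delta_period w_def)

lemma Delta_pos: "0 < period w" using period_pos[OF w] .

lemma norm_c: "(cmod (frft_c \<theta>))\<^sup>2 = 1 / period w" using norm_frft_c_period[OF sin] by (simp add: w_def)

lemma c_neq_0: "frft_c \<theta> \<noteq> 0" using norm_c Delta_pos by auto

abbreviation \<kappa> where "\<kappa> \<equiv> frft_c \<theta>"

abbreviation \<psi> where "\<psi> \<equiv> chirp_mod \<theta> \<phi>"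

abbreviation fsets where "fsets \<equiv> finite_subsets_at_top (UNIV :: int set)"

lemma psi_l2: "l2_seq (\<lambda>n. \<psi> (t - of_int n))"
  using C[of t] by (simp add: C_fun_def l2_seq_def l2_norm_sq_def)

lemma C_l2sq: "C_fun \<theta> \<phi> t = ennreal (l2sq (\<lambda>n. \<psi> (t - of_int n)))"
  using l2_norm_sq_l2sq[OF psi_l2] by (simp add: C_fun_def l2_norm_sq_def)

definition gen :: "int \<Rightarrow> real \<Rightarrow> complex" where
  "gen n t = \<kappa> * cnj (chirp \<theta> t) * \<psi> (t - of_int n)"

text \<open>
\<open>frac_conv\<close> with the chirp already absorbed in the coefficients, so that it depends on them
through an ordinary series.
\<close>
definition synth :: "(int \<Rightarrow> complex) \<Rightarrow> real \<Rightarrow> complex" where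
  "synth c t = \<kappa> * cnj (chirp \<theta> t) * (\<Sum>\<^sub>\<infinity>n. c n * \<psi> (t - of_int n))"

definition synth_fin :: "(int \<Rightarrow> complex) \<Rightarrow> int set \<Rightarrow> real \<Rightarrow> complex" where
  "synth_fin c F t = (\<Sum>n\<in>F. c n * gen n t)"

lemma gen_chirp_shift: "gen n t = \<kappa> * chirp_shift \<theta> (of_int n) \<phi> t"
  by (simp add: gen_def chirp_shift_def chirp_mod_def)

lemma gen_sq_int: "sq_int lebesgue (gen n)"
  unfolding gen_chirp_shift[abs_def] by (intro sq_int_cmult chirp_shift_sq_int phi)

lemma synth_fin_sq_int: "sq_int lebesgue (synth_fin c F)"
  unfolding synth_fin_def[abs_def] by (intro sq_int_sum sq_int_cmult gen_sq_int)

lemma frft_gen: "AE \<xi> in lebesgue. frft \<theta> (gen n) \<xi> = \<kappa> * (harmonic w n \<xi> * frft \<theta> \<phi> \<xi>)"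
proof -
  have "AE \<xi> in lebesgue. frft \<theta> (\<lambda>t. \<Sum>i\<in>{n}. \<kappa> * chirp_shift \<theta> (of_int i) \<phi> t) \<xi> = (\<Sum>i\<in>{n}. \<kappa> * frft \<theta> (chirp_shift \<theta> (of_int i) \<phi>) \<xi>)"
    by (intro frft_sum sin chirp_shift_sq_int phi) auto
  with frft_chirp_shift[OF sin phi, of "of_int n"] show ?thesis
  proof eventually_elim
    case (elim \<xi>)
    then show ?case by (simp add: gen_chirp_shift[abs_def] harmonic_def w_def mult.assoc)
  qed
qed

lemma frft_synth_fin:
  assumes F: "finite F"
  shows "AE \<xi> in lebesgue. frft \<theta> (synth_fin c F) \<xi> = \<kappa> * trig_sum w c F \<xi> * frft \<theta> \<phi> \<xi>"
proof -
  have "AE \<xi> in lebesgue. frft \<theta> (\<lambda>t. \<Sum>i\<in>F. c i * gen i t) \<xi> = (\<Sum>i\<in>F. c i * frft \<theta> (gen i) \<xi>)"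
    by (intro frft_sum sin F gen_sq_int)
  moreover have "AE \<xi> in lebesgue. \<forall>i\<in>F. frft \<theta> (gen i) \<xi> = \<kappa> * (harmonic w i \<xi> * frft \<theta> \<phi> \<xi>)"
    using frft_gen by (intro AE_finite_allI F)
  ultimately show ?thesis
  proof eventually_elim
    case (elim \<xi>)
    then show ?case
      by (simp add: synth_fin_def[abs_def] trig_sum_def sum_distrib_left sum_distrib_right mult_ac)
  qed
qed

lemma phihat: "frft \<theta> \<phi> \<in> borel_measurable lebesgue"
  using frft_sq_int[OF sin phi] by (simp add: sq_int_def)

text \<open>
Periodization: $h$ factors out of the sum over translates, and what remains is $G$.
\<close>
lemma weighted_norm:
  assumes h: "h \<in> borel_measurable lebesgue" and period: "\<And>x k. h (x + of_int k * period w) = h x"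
  shows "sq_norm lebesgue (\<lambda>\<xi>. \<kappa> * h \<xi> * frft \<theta> \<phi> \<xi>)
     = ennreal (1 / period w) * (\<integral>\<^sup>+\<xi>. ennreal ((cmod (h \<xi>))\<^sup>2) * G_fun \<theta> \<phi> \<xi> \<partial>torus w)"
proof -
  note [measurable] = h phihat
  have "sq_norm lebesgue (\<lambda>\<xi>. \<kappa> * (h \<xi> * frft \<theta> \<phi> \<xi>)) = ennreal ((cmod \<kappa>)\<^sup>2) * sq_norm lebesgue (\<lambda>\<xi>. h \<xi> * frft \<theta> \<phi> \<xi>)"
    by (rule sq_norm_cmult) measurable
  also have "sq_norm lebesgue (\<lambda>\<xi>. h \<xi> * frft \<theta> \<phi> \<xi>)
     = (\<integral>\<^sup>+\<xi>. (\<integral>\<^sup>+n. ennreal ((cmod (h (\<xi> + of_int n * period w) * frft \<theta> \<phi> (\<xi> + of_int n * period w)))\<^sup>2) \<partial>count_space (UNIV::int set)) \<partial>torus w)"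
    unfolding sq_norm_def by (rule nn_integral_periodize[OF _ Delta_pos]) measurable
  also have "\<dots> = (\<integral>\<^sup>+\<xi>. ennreal ((cmod (h \<xi>))\<^sup>2) * G_fun \<theta> \<phi> \<xi> \<partial>torus w)"
    by (intro nn_integral_cong)
       (simp add: period norm_mult power_mult_distrib ennreal_mult nn_integral_cmult G_fun_def infsum_ennreal_nn_integral Delta)
  finally show ?thesis by (simp add: norm_c mult.assoc)
qed

lemma G_torus: "AE \<xi> in torus w. ennreal A \<le> G_fun \<theta> \<phi> \<xi> \<and> G_fun \<theta> \<phi> \<xi> \<le> ennreal B"
  using G by (simp only: AE_torus_iff Delta)

lemma weighted_bounds:
  assumes h: "h \<in> borel_measurable (torus w)"
  shows "ennreal (1 / period w) * (\<integral>\<^sup>+\<xi>. ennreal ((cmod (h \<xi>))\<^sup>2) * G_fun \<theta> \<phi> \<xi> \<partial>torus w) \<le> ennreal (B / period w) * sq_norm (torus w) h"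
    and "ennreal (A / period w) * sq_norm (torus w) h \<le> ennreal (1 / period w) * (\<integral>\<^sup>+\<xi>. ennreal ((cmod (h \<xi>))\<^sup>2) * G_fun \<theta> \<phi> \<xi> \<partial>torus w)"
proof -
  note [measurable] = h
  have e: "ennreal (K / period w) * sq_norm (torus w) h = ennreal (1 / period w) * (\<integral>\<^sup>+\<xi>. ennreal ((cmod (h \<xi>))\<^sup>2) * ennreal K \<partial>torus w)"
    if "0 \<le> K" for K
  proof -
    have "(\<integral>\<^sup>+\<xi>. ennreal ((cmod (h \<xi>))\<^sup>2) * ennreal K \<partial>torus w) = sq_norm (torus w) h * ennreal K"
      unfolding sq_norm_def by (rule nn_integral_multc) measurable
    moreover have "ennreal (K / period w) = ennreal (1 / period w) * ennreal K"
      using that Delta_pos by (simp add: ennreal_mult[symmetric])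
    ultimately show ?thesis by (simp add: mult_ac)
  qed
  show "ennreal (1 / period w) * (\<integral>\<^sup>+\<xi>. ennreal ((cmod (h \<xi>))\<^sup>2) * G_fun \<theta> \<phi> \<xi> \<partial>torus w) \<le> ennreal (B / period w) * sq_norm (torus w) h"
    using AB G_torus by (subst e) (auto intro!: mult_left_mono nn_integral_mono_AE elim!: AE_mp)
  show "ennreal (A / period w) * sq_norm (torus w) h \<le> ennreal (1 / period w) * (\<integral>\<^sup>+\<xi>. ennreal ((cmod (h \<xi>))\<^sup>2) * G_fun \<theta> \<phi> \<xi> \<partial>torus w)"
    using AB G_torus by (subst e) (auto intro!: mult_left_mono nn_integral_mono_AE elim!: AE_mp)
qed

lemma trig_sum_periodic: "trig_sum w c F (x + of_int k * period w) = trig_sum w c F x"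
  unfolding trig_sum_def by (simp add: harmonic_periodic[OF w])

lemma trig_sum_lebesgue: "trig_sum w c F \<in> borel_measurable lebesgue"
  by (intro borel_lebesgue measurable_trig_sum)

lemma synth_fin_diff_bound:
  assumes F: "finite F" "finite F'"
  shows "sq_norm lebesgue (\<lambda>t. synth_fin c F t - synth_fin c F' t) \<le> ennreal (B / period w) * sq_norm (torus w) (\<lambda>\<xi>. trig_sum w c F \<xi> - trig_sum w c F' \<xi>)"
proof -
  let ?h = "\<lambda>\<xi>. trig_sum w c F \<xi> - trig_sum w c F' \<xi>"
  have hm: "?h \<in> borel_measurable lebesgue" using trig_sum_lebesgue by (intro borel_measurable_diff)
  have "sq_norm lebesgue (\<lambda>t. synth_fin c F t - synth_fin c F' t) = sq_norm lebesgue (\<lambda>\<xi>. frft \<theta> (synth_fin c F) \<xi> - frft \<theta> (synth_fin c F') \<xi>)"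
    by (rule frft_sq_norm_diff[OF sin synth_fin_sq_int synth_fin_sq_int, symmetric])
  also have "\<dots> = sq_norm lebesgue (\<lambda>\<xi>. \<kappa> * ?h \<xi> * frft \<theta> \<phi> \<xi>)"
  proof (rule sq_norm_cong_AE, use frft_synth_fin[OF F(1), of c] frft_synth_fin[OF F(2), of c] in eventually_elim)
    case (elim \<xi>) then show ?case by (simp add: algebra_simps)
  qed
  also have "\<dots> = ennreal (1 / period w) * (\<integral>\<^sup>+\<xi>. ennreal ((cmod (?h \<xi>))\<^sup>2) * G_fun \<theta> \<phi> \<xi> \<partial>torus w)"
    by (rule weighted_norm[OF hm]) (simp add: trig_sum_periodic)
  also have "\<dots> \<le> ennreal (B / period w) * sq_norm (torus w) ?h"
    by (intro weighted_bounds measurable_torus hm)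
  finally show ?thesis .
qed

lemma synth_has_sum:
  assumes c: "l2_seq c"
  shows "((\<lambda>n. c n * gen n t) has_sum synth c t) UNIV"
proof -
  have "((\<lambda>n. c n * \<psi> (t - of_int n)) has_sum (\<Sum>\<^sub>\<infinity>n. c n * \<psi> (t - of_int n))) UNIV"
    by (rule has_sum_infsum[OF abs_summable_summable[OF l2_mult_summable[OF c psi_l2]]])
  from has_sum_cmult_right[OF this, of "\<kappa> * cnj (chirp \<theta> t)"]
  show ?thesis by (simp add: synth_def gen_def mult_ac)
qed

lemma synth_seq_lim:
  assumes c: "l2_seq c" shows "(\<lambda>k::nat. synth_fin c {-int k..int k} t) \<longlonglongrightarrow> synth c t"
  using filterlim_compose[OF synth_has_sum[OF c, of t, unfolded has_sum_def] filterlim_symmetric_interval]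
  by (simp add: synth_fin_def)

lemma synth_measurable: assumes c: "l2_seq c" shows "synth c \<in> borel_measurable lebesgue"
  by (rule borel_measurable_LIMSEQ_metric[OF sq_intD[OF synth_fin_sq_int] synth_seq_lim[OF c]])

text \<open>
The series is defined pointwise. Its convergence in square mean comes from Fatou's lemma, applied
along symmetric partial sums, whose differences are controlled by their symbols.
\<close>
lemma synth_lim:
  assumes c: "l2_seq c" shows "L2_conv lebesgue (synth_fin c) (synth c) fsets"
  unfolding L2_conv_def
proof (rule tendsto_zero_ennreal)
  fix r :: real assume r: "0 < r"
  define e where "e = r / 2 * period w / B"
  have B0: "B > 0" using AB by simp
  have e: "e > 0" using r B0 Delta_pos by (simp add: e_def)
  obtain P where P: "eventually P fsets" "\<And>F F'. P F \<Longrightarrow> P F' \<Longrightarrow> sq_norm (torus w) (\<lambda>x. trig_sum w c F x - trig_sum w c F' x) \<le> ennreal e"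
    using L2_conv_Cauchy[where f="trig_sum w c", OF sq_intD[OF sq_int_trig_sum] sq_intD[OF fourier_sum_sq_int[OF w c]] fourier_sum_lim[OF w c] e] by blast
  have evk: "\<forall>\<^sub>F k in sequentially. P {-int k..int k}"
    using filterlim_symmetric_interval P(1) by (simp add: filterlim_iff)
  have "sq_norm lebesgue (\<lambda>t. synth c t - synth_fin c F t) \<le> ennreal (r/2)" if F: "P F" "finite F" for F
  proof (rule sq_norm_Fatou[where f="\<lambda>k t. synth_fin c {-int k..int k} t - synth_fin c F t"])
    show "(\<lambda>t. synth_fin c {- int k..int k} t - synth_fin c F t) \<in> borel_measurable lebesgue" for k
      by (intro sq_intD sq_int_diff synth_fin_sq_int)
    show "AE t in lebesgue. (\<lambda>k. synth_fin c {- int k..int k} t - synth_fin c F t) \<longlonglongrightarrow> synth c t - synth_fin c F t"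
      by (intro AE_I2 tendsto_diff tendsto_const synth_seq_lim c)
    show "\<forall>\<^sub>F k in sequentially. sq_norm lebesgue (\<lambda>t. synth_fin c {- int k..int k} t - synth_fin c F t) \<le> ennreal (r / 2)"
      using evk
    proof eventually_elim
      case (elim k)
      have "sq_norm lebesgue (\<lambda>t. synth_fin c {- int k..int k} t - synth_fin c F t) \<le> ennreal (B / period w) * sq_norm (torus w) (\<lambda>\<xi>. trig_sum w c {- int k..int k} \<xi> - trig_sum w c F \<xi>)"
        by (rule synth_fin_diff_bound) (use F in auto)
      also have "\<dots> \<le> ennreal (B / period w) * ennreal e" by (intro mult_left_mono P(2) elim F) auto
      also have "\<dots> = ennreal (r/2)" using B0 Delta_pos e by (simp add: ennreal_mult[symmetric] e_def)
      finally show ?case .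
    qed
  qed
  then have small: "sq_norm lebesgue (\<lambda>t. synth c t - synth_fin c F t) < ennreal r" if "P F" "finite F" for F
    using r by (intro order.strict_trans1[OF _ ennreal_lessI, of _ "r/2" r]) (use that in auto)
  show "\<forall>\<^sub>F F in fsets. sq_norm lebesgue (\<lambda>t. synth c t - synth_fin c F t) < ennreal r"
    using P(1) eventually_fin by eventually_elim (auto intro: small)
qed

lemma synth_sq_int: "l2_seq c \<Longrightarrow> sq_int lebesgue (synth c)"
  by (rule L2_conv_sq_int[OF synth_fin_sq_int synth_measurable synth_lim]) auto

text \<open>
Both sides are limits of the transforms of the finite sums: the left one because the transform is
isometric, the right one because $G \le B$.
\<close>
lemma frft_synth:
  assumes c: "l2_seq c"
  shows "AE \<xi> in lebesgue. frft \<theta> (synth c) \<xi> = \<kappa> * fourier_sum w c \<xi> * frft \<theta> \<phi> \<xi>"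
proof -
  have FSm: "fourier_sum w c \<in> borel_measurable lebesgue" by (rule fourier_sum_measurable[OF w c])
  note sI = synth_fin_sq_int synth_sq_int[OF c]
  have l1: "L2_conv lebesgue (\<lambda>F. frft \<theta> (synth_fin c F)) (frft \<theta> (synth c)) fsets"
    using synth_lim[OF c] by (simp add: L2_conv_def frft_sq_norm_diff[OF sin sI(2) sI(1)])
  have l2: "L2_conv lebesgue (\<lambda>F. frft \<theta> (synth_fin c F)) (\<lambda>\<xi>. \<kappa> * fourier_sum w c \<xi> * frft \<theta> \<phi> \<xi>) fsets"
    unfolding L2_conv_def
  proof (rule tendsto_sandwich[OF _ _ tendsto_const])
    show "((\<lambda>F. ennreal (B / period w) * sq_norm (torus w) (\<lambda>\<xi>. fourier_sum w c \<xi> - trig_sum w c F \<xi>)) \<longlongrightarrow> 0) fsets"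
      using ennreal_tendsto_cmult[OF _ fourier_sum_lim[OF w c, unfolded L2_conv_def], of "ennreal (B / period w)"] by simp
    show "\<forall>\<^sub>F F in fsets. sq_norm lebesgue (\<lambda>\<xi>. \<kappa> * fourier_sum w c \<xi> * frft \<theta> \<phi> \<xi> - frft \<theta> (synth_fin c F) \<xi>)
       \<le> ennreal (B / period w) * sq_norm (torus w) (\<lambda>\<xi>. fourier_sum w c \<xi> - trig_sum w c F \<xi>)"
    proof (rule eventually_finite_subsets_at_top_weakI)
      fix F :: "int set" assume F: "finite F"
      let ?h = "\<lambda>\<xi>. fourier_sum w c \<xi> - trig_sum w c F \<xi>"
      have hm: "?h \<in> borel_measurable lebesgue" using trig_sum_lebesgue FSm by (intro borel_measurable_diff)
      have "sq_norm lebesgue (\<lambda>\<xi>. \<kappa> * fourier_sum w c \<xi> * frft \<theta> \<phi> \<xi> - frft \<theta> (synth_fin c F) \<xi>) = sq_norm lebesgue (\<lambda>\<xi>. \<kappa> * ?h \<xi> * frft \<theta> \<phi> \<xi>)"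
      proof (rule sq_norm_cong_AE, use frft_synth_fin[OF F, of c] in eventually_elim)
        case (elim \<xi>) then show ?case by (simp add: algebra_simps)
      qed
      also have "\<dots> = ennreal (1 / period w) * (\<integral>\<^sup>+\<xi>. ennreal ((cmod (?h \<xi>))\<^sup>2) * G_fun \<theta> \<phi> \<xi> \<partial>torus w)"
        by (rule weighted_norm[OF hm]) (simp add: trig_sum_periodic fourier_sum_periodic[OF w c])
      also have "\<dots> \<le> ennreal (B / period w) * sq_norm (torus w) ?h"
        by (intro weighted_bounds measurable_torus hm)
      finally show "sq_norm lebesgue (\<lambda>\<xi>. \<kappa> * fourier_sum w c \<xi> * frft \<theta> \<phi> \<xi> - frft \<theta> (synth_fin c F) \<xi>) \<le> ennreal (B / period w) * sq_norm (torus w) ?h" .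
    qed
  qed simp
  show ?thesis
  proof (rule L2_conv_unique[OF _ _ _ l1 l2])
    show "frft \<theta> (synth_fin c i) \<in> borel_measurable lebesgue" for i by (rule sq_intD[OF frft_sq_int[OF sin sI(1)]])
    show "frft \<theta> (synth c) \<in> borel_measurable lebesgue" by (rule sq_intD[OF frft_sq_int[OF sin sI(2)]])
    show "(\<lambda>\<xi>. \<kappa> * fourier_sum w c \<xi> * frft \<theta> \<phi> \<xi>) \<in> borel_measurable lebesgue"
      using FSm phihat by (intro borel_measurable_times borel_measurable_const)
  qed simp
qed

lemma synth_norm:
  assumes c: "l2_seq c"
  shows "sq_norm lebesgue (synth c) = ennreal (1 / period w) * (\<integral>\<^sup>+\<xi>. ennreal ((cmod (fourier_sum w c \<xi>))\<^sup>2) * G_fun \<theta> \<phi> \<xi> \<partial>torus w)"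
proof -
  have "sq_norm lebesgue (synth c) = sq_norm lebesgue (frft \<theta> (synth c))"
    by (simp add: sq_norm_L2norm synth_sq_int[OF c] frft_sq_int[OF sin] frft_isometry[OF sin])
  also have "\<dots> = sq_norm lebesgue (\<lambda>\<xi>. \<kappa> * fourier_sum w c \<xi> * frft \<theta> \<phi> \<xi>)"
    by (rule sq_norm_cong_AE[OF frft_synth[OF c]])
  also have "\<dots> = ennreal (1 / period w) * (\<integral>\<^sup>+\<xi>. ennreal ((cmod (fourier_sum w c \<xi>))\<^sup>2) * G_fun \<theta> \<phi> \<xi> \<partial>torus w)"
    by (rule weighted_norm[OF fourier_sum_measurable[OF w c] fourier_sum_periodic[OF w c]])
  finally show ?thesis .
qed

lemma synth_add_cmult:
  assumes "l2_seq c" "l2_seq d"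
  shows "synth (\<lambda>n. a * c n + d n) t = a * synth c t + synth d t"
proof (rule has_sum_unique)
  show "((\<lambda>n. (a * c n + d n) * gen n t) has_sum synth (\<lambda>n. a * c n + d n) t) UNIV"
    by (intro synth_has_sum l2_seq_add_cmult assms)
  show "((\<lambda>n. (a * c n + d n) * gen n t) has_sum (a * synth c t + synth d t)) UNIV"
    using has_sum_add[OF has_sum_cmult_right[OF synth_has_sum[OF assms(1)], of a] synth_has_sum[OF assms(2)]]
    by (simp add: algebra_simps)
qed

lemma synth_pointwise_bound:
  assumes c: "l2_seq c"
  shows "cmod (synth c t) \<le> cmod \<kappa> * (sqrt (l2sq c) * sqrt (l2sq (\<lambda>n. \<psi> (t - of_int n))))"
  using l2_mult_bound[OF c psi_l2[of t]] by (simp add: synth_def norm_mult mult_left_mono)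

lemma chirp_seq_l2: "l2_seq (chirp_mod_seq \<theta> c) \<longleftrightarrow> l2_seq c"
  by (simp add: l2_seq_def l2_norm_sq_def chirp_mod_seq_def norm_mult)

lemma frac_conv_synth: "frac_conv \<theta> c \<phi> = synth (chirp_mod_seq \<theta> c)"
  by (simp add: frac_conv_def synth_def fun_eq_iff)

lemma synth_in_SIS:
  assumes c: "l2_seq c" shows "synth c \<in> chirp_SIS \<theta> \<phi>"
  unfolding chirp_SIS_def L2_closed_span_def
proof (safe)
  show "L2_fun (synth c)" by (simp add: L2_fun_sq_int synth_sq_int c)
  fix e :: real assume "e > 0"
  have "\<forall>\<^sub>F F in fsets. finite F \<and> sq_norm lebesgue (\<lambda>t. synth c t - synth_fin c F t) < ennreal e"
    using sq_norm_small_ev[OF synth_lim[OF c, unfolded L2_conv_def] \<open>e > 0\<close>]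
      eventually_fin by eventually_elim auto
  then obtain F where "finite F" "sq_norm lebesgue (\<lambda>t. synth c t - synth_fin c F t) < ennreal e"
    using eventually_happens finite_subsets_at_top_neq_bot by blast
  then show "\<exists>F c'. finite F \<and> L2_norm_sq (\<lambda>t. synth c t - (\<Sum>n\<in>F. c' n * (\<kappa> * cnj (chirp \<theta> t) * \<psi> (t - of_int n)))) < ennreal e"
    by (intro exI[of _ F] exI[of _ c]) (auto simp: L2_norm_sq_sq_norm synth_fin_def gen_def)
qed

lemma SIS_pt_eq: "chirp_SIS_pt \<theta> \<phi> = synth ` {c. l2_seq c}"
proof (intro set_eqI iffI)
  fix f assume "f \<in> chirp_SIS_pt \<theta> \<phi>"
  then show "f \<in> synth ` {c. l2_seq c}" by (auto simp: chirp_SIS_pt_def frac_conv_synth chirp_seq_l2)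
next
  fix f assume "f \<in> synth ` {c. l2_seq c}"
  then obtain c where c: "l2_seq c" "f = synth c" by auto
  define d where "d n = cnj (chirp \<theta> (of_int n)) * c n" for n
  have "chirp_mod_seq \<theta> d = c" by (simp add: fun_eq_iff chirp_mod_seq_def d_def mult.assoc[symmetric])
  then show "f \<in> chirp_SIS_pt \<theta> \<phi>"
    using c synth_in_SIS[OF c(1)] chirp_seq_l2[of d] by (auto simp: chirp_SIS_pt_def frac_conv_synth intro!: exI[of _ d])
qed

end

section \<open>Symbols and sampling\<close>

locale chirp_sampling = chirp_space + fixes \<sigma> :: real
begin

lemma psi_l2_plus: "l2_seq (\<lambda>n. \<psi> (\<sigma> + of_int n))"
proof -
  have "l2_norm_sq (\<lambda>n. \<psi> (\<sigma> - of_int (- n))) = l2_norm_sq (\<lambda>n. \<psi> (\<sigma> - of_int n))"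
    by (rule l2_norm_sq_bij) (auto intro!: bij_uminus)
  then show ?thesis using psi_l2[of \<sigma>] by (simp add: l2_seq_def)
qed

text \<open>
The function $D(\xi) = \sum_n \psi(\sigma+n) e^{-ibn\xi}$.
\<close>
definition symbol :: "real \<Rightarrow> complex" where "symbol = fourier_sum w (\<lambda>n. \<psi> (\<sigma> + of_int n))"

lemma symbol_measurable: "symbol \<in> borel_measurable lebesgue"
  and symbol_periodic: "symbol (x + of_int k * period w) = symbol x"
  and symbol_sq_int: "sq_int (torus w) symbol"
  and symbol_fourier_coef: "fourier_coef w symbol n = \<psi> (\<sigma> + of_int n)"
  unfolding symbol_def
  using fourier_sum_measurable[OF w psi_l2_plus] fourier_sum_periodic[OF w psi_l2_plus] fourier_sum_sq_int[OF w psi_l2_plus] fourier_coef_fourier_sum[OF w psi_l2_plus]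
  by auto

text \<open>
A convolution of two square-summable sequences is the sequence of Fourier coefficients of the
product of their sums. The product is only integrable in general, so the coefficients on the
right need not be square-summable.
\<close>
lemma synth_sample:
  assumes c: "l2_seq c"
  shows "synth c (\<sigma> + of_int k) = \<kappa> * cnj (chirp \<theta> (\<sigma> + of_int k)) * fourier_coef w (\<lambda>\<xi>. fourier_sum w c \<xi> * symbol \<xi>) k"
proof -
  let ?g = "\<lambda>\<xi>. cnj (symbol \<xi>) * harmonic w k \<xi>"
  have Zm: "symbol \<in> borel_measurable (torus w)" by (rule sq_intD[OF symbol_sq_int])
  have g: "sq_int (torus w) ?g"
    by (rule sq_int_bounded[OF symbol_sq_int, of _ 1])
       (use Zm in \<open>auto simp: norm_mult\<close>)
  have fg: "fourier_coef w ?g m = cnj (\<psi> (\<sigma> + of_int k - of_int m))" for m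
  proof -
    have "iprod (torus w) ?g (harmonic w m) = iprod (torus w) (\<lambda>\<xi>. cnj (symbol \<xi>)) (\<lambda>\<xi>. cnj (harmonic w (k - m) \<xi>))"
      unfolding iprod_def by (simp add: cnj_harmonic mult.assoc harmonic_mult)
    also have "\<dots> = cnj (iprod (torus w) symbol (harmonic w (k - m)))"
      unfolding iprod_def by (subst Bochner_Integration.integral_cnj[symmetric]) simp
    finally have "fourier_coef w ?g m = cnj (fourier_coef w symbol (k - m))" by (simp add: fourier_coef_def)
    then show ?thesis by (simp add: symbol_fourier_coef algebra_simps)
  qed
  have "((\<lambda>n. c n * \<psi> (\<sigma> + of_int k - of_int n)) has_sum (iprod (torus w) (fourier_sum w c) ?g / of_real (period w))) UNIV"
    using Parseval_iprod[OF w c g] by (simp add: fg)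
  also have "iprod (torus w) (fourier_sum w c) ?g = iprod (torus w) (\<lambda>\<xi>. fourier_sum w c \<xi> * symbol \<xi>) (harmonic w k)"
    unfolding iprod_def by (simp add: mult_ac)
  finally show ?thesis by (simp add: synth_def fourier_coef_def infsumI)
qed

text \<open>
Elements of the space are parametrized by symbols on one period instead of coefficient sequences:
in terms of symbols, sampling is a multiplication.
\<close>
definition from_symbol :: "(real \<Rightarrow> complex) \<Rightarrow> real \<Rightarrow> complex" where "from_symbol H = synth (fourier_coef w H)"

context
  fixes H assumes H: "sq_int (torus w) H"
begin

lemma fourier_coef_l2: "l2_seq (fourier_coef w H)" by (rule fourier_coef_Bessel[OF w H])

lemma from_symbol_pt: "from_symbol H \<in> chirp_SIS_pt \<theta> \<phi>"
  unfolding SIS_pt_eq from_symbol_def using fourier_coef_l2 by blast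

lemma from_symbol_sq_int: "sq_int lebesgue (from_symbol H)" unfolding from_symbol_def by (rule synth_sq_int[OF fourier_coef_l2])

lemma frft_from_symbol: "AE \<xi> in lebesgue. frft \<theta> (from_symbol H) \<xi> = \<kappa> * fourier_sum w (fourier_coef w H) \<xi> * frft \<theta> \<phi> \<xi>"
  unfolding from_symbol_def by (rule frft_synth[OF fourier_coef_l2])

lemma
  shows from_symbol_upper: "(L2norm lebesgue (from_symbol H))\<^sup>2 \<le> B / period w * (L2norm (torus w) H)\<^sup>2"
    and from_symbol_lower: "A / period w * (L2norm (torus w) H)\<^sup>2 \<le> (L2norm lebesgue (from_symbol H))\<^sup>2"
proof -
  let ?h = "fourier_sum w (fourier_coef w H)"
  have hm: "?h \<in> borel_measurable (torus w)" by (rule sq_intD[OF fourier_sum_sq_int[OF w fourier_coef_l2]])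
  have hs: "sq_norm (torus w) ?h = sq_norm (torus w) H" by (rule sq_norm_cong_AE[OF fourier_sum_fourier_coef[OF w H]])
  have 1: "sq_norm lebesgue (from_symbol H) = ennreal (1 / period w) * (\<integral>\<^sup>+\<xi>. ennreal ((cmod (?h \<xi>))\<^sup>2) * G_fun \<theta> \<phi> \<xi> \<partial>torus w)"
    unfolding from_symbol_def by (rule synth_norm[OF fourier_coef_l2])
  have "sq_norm lebesgue (from_symbol H) \<le> ennreal (B / period w) * sq_norm (torus w) H"
    using weighted_bounds(1)[OF hm] by (simp only: 1 hs)
  then show "(L2norm lebesgue (from_symbol H))\<^sup>2 \<le> B / period w * (L2norm (torus w) H)\<^sup>2"
    using AB Delta_pos by (simp add: sq_norm_L2norm from_symbol_sq_int H ennreal_mult[symmetric])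
  have "ennreal (A / period w) * sq_norm (torus w) H \<le> sq_norm lebesgue (from_symbol H)"
    using weighted_bounds(2)[OF hm] by (simp only: 1 hs)
  then show "A / period w * (L2norm (torus w) H)\<^sup>2 \<le> (L2norm lebesgue (from_symbol H))\<^sup>2"
    using AB Delta_pos by (simp add: sq_norm_L2norm from_symbol_sq_int H ennreal_mult[symmetric])
qed

lemma from_symbol_sample: "from_symbol H (\<sigma> + of_int k) = \<kappa> * cnj (chirp \<theta> (\<sigma> + of_int k)) * fourier_coef w (\<lambda>\<xi>. H \<xi> * symbol \<xi>) k"
proof -
  note [measurable] = sq_intD[OF symbol_sq_int] sq_intD[OF H] sq_intD[OF fourier_sum_sq_int[OF w fourier_coef_l2]]
  have "fourier_coef w (\<lambda>\<xi>. fourier_sum w (fourier_coef w H) \<xi> * symbol \<xi>) k = fourier_coef w (\<lambda>\<xi>. H \<xi> * symbol \<xi>) k"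
    using fourier_sum_fourier_coef[OF w H] by (intro fourier_coef_cong_AE borel_measurable_times) (auto elim: AE_mp)
  then show ?thesis unfolding from_symbol_def by (simp add: synth_sample[OF fourier_coef_l2])
qed

text \<open>
The reproducing kernel property: point evaluation is bounded by $\sqrt{C_{\phi,\theta}(t)}$.
\<close>
lemma from_symbol_pointwise_bound:
  "cmod (from_symbol H t) \<le> cmod \<kappa> / sqrt (period w) * sqrt (l2sq (\<lambda>n. \<psi> (t - of_int n))) * L2norm (torus w) H"
  using synth_pointwise_bound[OF fourier_coef_l2, of t] Delta_pos
  by (simp add: from_symbol_def fourier_coef_Parseval[OF w H] real_sqrt_divide mult_ac)

end

lemma from_symbol_surj: assumes "f \<in> chirp_SIS_pt \<theta> \<phi>" obtains H where "sq_int (torus w) H" "f = from_symbol H"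
proof -
  obtain c where c: "l2_seq c" "f = synth c" using assms by (auto simp: SIS_pt_eq)
  have "fourier_coef w (fourier_sum w c) = c" by (rule ext) (rule fourier_coef_fourier_sum[OF w c(1)])
  with that[OF fourier_sum_sq_int[OF w c(1)]] c show ?thesis by (simp add: from_symbol_def)
qed

lemma from_symbol_cong_AE:
  assumes "sq_int (torus w) H" "sq_int (torus w) H'" "AE \<xi> in torus w. H \<xi> = H' \<xi>" shows "from_symbol H = from_symbol H'"
proof -
  have "fourier_coef w H = fourier_coef w H'" using assms by (intro ext fourier_coef_cong_AE sq_intD)
  then show ?thesis by (simp add: from_symbol_def)
qed

lemma from_symbol_add_cmult:
  assumes H: "sq_int (torus w) H" and H': "sq_int (torus w) H'"
  shows "from_symbol (\<lambda>\<xi>. a * H \<xi> + H' \<xi>) t = a * from_symbol H t + from_symbol H' t"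
proof -
  have "fourier_coef w (\<lambda>\<xi>. a * H \<xi> + H' \<xi>) = (\<lambda>n. a * fourier_coef w H n + fourier_coef w H' n)"
    using assms by (intro ext fourier_coef_add_cmult)
  then show ?thesis unfolding from_symbol_def by (simp add: synth_add_cmult fourier_coef_l2 H H')
qed

lemma from_symbol_zero: "from_symbol (\<lambda>\<xi>. 0) t = 0"
  by (simp add: from_symbol_def synth_def fourier_coef_def iprod_def)

lemma from_symbol_sum:
  assumes "\<And>n. n \<in> F \<Longrightarrow> sq_int (torus w) (H n)"
  shows "from_symbol (\<lambda>\<xi>. \<Sum>n\<in>F. a n * H n \<xi>) t = (\<Sum>n\<in>F. a n * from_symbol (H n) t)"
  using assms
proof (induction F rule: infinite_finite_induct)
  case (insert n F)
  have "sq_int (torus w) (\<lambda>\<xi>. \<Sum>n\<in>F. a n * H n \<xi>)"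
    by (intro sq_int_sum sq_int_cmult insert.prems) auto
  then show ?case using insert by (simp add: from_symbol_add_cmult)
qed (simp_all add: from_symbol_zero)

text \<open>
The space is not an isometric copy of $L^2$ of the period, but symbols with disjoint supports do
give orthogonal functions, as the transforms have disjoint supports.
\<close>
lemma from_symbol_orthogonal:
  assumes u: "sq_int (torus w) u" and v: "sq_int (torus w) v" and uv: "AE \<xi> in torus w. u \<xi> = 0 \<or> v \<xi> = 0"
  shows "iprod lebesgue (from_symbol u) (from_symbol v) = 0"
proof -
  let ?u = "fourier_sum w (fourier_coef w u)" and ?v = "fourier_sum w (fourier_coef w v)"
  have "AE \<xi> in torus w. ?u \<xi> = 0 \<or> ?v \<xi> = 0"
    using fourier_sum_fourier_coef[OF w u] fourier_sum_fourier_coef[OF w v] uv by eventually_elim auto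
  then have z: "AE \<xi> in lebesgue. ?u \<xi> = 0 \<or> ?v \<xi> = 0"
    by (intro AE_periodic[OF w]) (auto simp: fourier_sum_periodic[OF w fourier_coef_l2[OF u]] fourier_sum_periodic[OF w fourier_coef_l2[OF v]])
  have "iprod lebesgue (from_symbol u) (from_symbol v) = iprod lebesgue (frft \<theta> (from_symbol u)) (frft \<theta> (from_symbol v))"
    by (simp add: frft_iprod[OF sin] from_symbol_sq_int u v)
  also have "\<dots> = 0"
    unfolding iprod_def
  proof (rule integral_eq_zero_AE)
    show "AE \<xi> in lebesgue. frft \<theta> (from_symbol u) \<xi> * cnj (frft \<theta> (from_symbol v) \<xi>) = 0"
      using frft_from_symbol[OF u] frft_from_symbol[OF v] z by eventually_elim auto
  qed
  finally show ?thesis .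
qed

section \<open>The Zak transform\<close>

text \<open>
The series of the Zak transform is $\bar\kappa\bar\lambda$ times the series of the symbol with
$n$ replaced by $-n$. Limits in square mean on all intervals $[-R,R]$ agree almost everywhere,
hence so does the chosen representative.
\<close>
lemma zak_eq: "AE \<xi> in lebesgue. zak \<theta> \<phi> \<sigma> \<xi> = cnj \<kappa> * cnj (chirp \<theta> \<xi>) * symbol \<xi>"
proof -
  define T where "T F \<xi> = (\<Sum>n\<in>F. \<psi> (\<sigma> - of_int n) * chirp \<theta> (of_int n) * cnj (frft_kernel \<theta> (of_int n) \<xi>))" for F \<xi>
  define J where "J R \<xi> = (indicator {-R..R} \<xi> :: complex)" for R \<xi> :: real
  define Q where "Q Z \<longleftrightarrow> Z \<in> borel_measurable lebesgue \<and>
    (\<forall>R>0. ((\<lambda>F. sq_norm lebesgue (\<lambda>\<xi>. J R \<xi> * (Z \<xi> - T F \<xi>))) \<longlongrightarrow> 0) fsets)" for Z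
  define Z0 where "Z0 \<xi> = cnj \<kappa> * cnj (chirp \<theta> \<xi>) * symbol \<xi>" for \<xi>
  let ?d = "\<lambda>n. \<psi> (\<sigma> + of_int n)"
  \<comment> \<open>Reindexing by $n \mapsto -n$ turns the series of the Zak transform into that of the symbol.\<close>
  have T: "T F \<xi> = cnj \<kappa> * cnj (chirp \<theta> \<xi>) * trig_sum w ?d (uminus ` F) \<xi>" for F \<xi>
  proof -
    have "trig_sum w ?d (uminus ` F) \<xi> = (\<Sum>n\<in>F. \<psi> (\<sigma> - of_int n) * harmonic w (-n) \<xi>)"
      unfolding trig_sum_def by (subst sum.reindex) (auto intro: inj_onI)
    moreover have "harmonic w (-n) \<xi> = cnj (cis (- (frft_b \<theta> * of_int n * \<xi>)))" for n
      by (simp add: harmonic_def w_def cis_cnj)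
    moreover have "chirp \<theta> (of_int n) * cnj (frft_kernel \<theta> (of_int n) \<xi>) = cnj \<kappa> * cnj (chirp \<theta> \<xi>) * cnj (cis (- (frft_b \<theta> * of_int n * \<xi>)))" for n
    proof -
      have "chirp \<theta> (of_int n) * cnj (frft_kernel \<theta> (of_int n) \<xi>) = (chirp \<theta> (of_int n) * cnj (chirp \<theta> (of_int n))) * (cnj \<kappa> * cnj (chirp \<theta> \<xi>) * cnj (cis (- (frft_b \<theta> * of_int n * \<xi>))))"
        by (simp only: kernel_cis complex_cnj_mult mult_ac)
      then show ?thesis by (simp only: chirp_cnj mult_1_left)
    qed
    ultimately show ?thesis unfolding T_def by (simp add: sum_distrib_left mult.assoc) (simp add: mult_ac)
  qed
  have Jm: "J R \<in> borel_measurable lebesgue" for R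
    unfolding J_def[abs_def] by (intro borel_lebesgue borel_measurable_indicator) simp
  have cm: "(\<lambda>\<xi>. cnj \<kappa> * cnj (chirp \<theta> \<xi>)) \<in> borel_measurable lebesgue"
    by (intro borel_measurable_times borel_measurable_const borel_measurable_cnj chirp_measurable)
  have Tm: "T F \<in> borel_measurable lebesgue" for F
    unfolding T[abs_def] by (intro borel_measurable_times[OF cm] trig_sum_lebesgue)
  have Z0m: "Z0 \<in> borel_measurable lebesgue"
    unfolding Z0_def[abs_def] by (intro borel_measurable_times[OF cm] symbol_measurable)
  have Q0: "Q Z0" unfolding Q_def
  proof (intro conjI allI impI Z0m)
    fix R :: real assume "R > 0"
    let ?D = "\<lambda>F \<xi>. symbol \<xi> - trig_sum w ?d F \<xi>"
    have Dm: "?D F \<in> borel_measurable lebesgue" for F using symbol_measurable trig_sum_lebesgue by (intro borel_measurable_diff)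
    let ?D2 = "\<lambda>F \<xi>. ennreal ((cmod (?D F \<xi>))\<^sup>2)"
    define N where "N = \<lceil>\<bar>R\<bar> / period w\<rceil> + 1"
    show "((\<lambda>F. sq_norm lebesgue (\<lambda>\<xi>. J R \<xi> * (Z0 \<xi> - T F \<xi>))) \<longlongrightarrow> 0) fsets"
    proof (rule tendsto_sandwich[OF _ _ tendsto_const])
      let ?K = "of_nat (card {-N..N}) * ennreal ((cmod \<kappa>)\<^sup>2)"
      have "((\<lambda>F. sq_norm (torus w) (?D F)) \<longlongrightarrow> 0) fsets"
        using fourier_sum_lim[OF w psi_l2_plus] by (simp add: L2_conv_def symbol_def)
      then have "((\<lambda>F. sq_norm (torus w) (?D (uminus ` F))) \<longlongrightarrow> 0) fsets"
        by (rule filterlim_compose[OF _ filterlim_image_uminus])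
      then have "((\<lambda>F. ?K * sq_norm (torus w) (?D (uminus ` F))) \<longlongrightarrow> ?K * 0) fsets"
        by (intro ennreal_tendsto_cmult) (auto simp: ennreal_mult_less_top of_nat_less_top)
      then show "((\<lambda>F. ?K * sq_norm (torus w) (?D (uminus ` F))) \<longlongrightarrow> 0) fsets" by simp
      have "sq_norm lebesgue (\<lambda>\<xi>. J R \<xi> * (Z0 \<xi> - T F \<xi>)) \<le> ?K * sq_norm (torus w) (?D (uminus ` F))" for F
      proof -
        let ?f = "\<lambda>\<xi>. ennreal ((cmod \<kappa>)\<^sup>2) * ?D2 (uminus ` F) \<xi>"
        have e: "Z0 \<xi> - T F \<xi> = cnj \<kappa> * cnj (chirp \<theta> \<xi>) * ?D (uminus ` F) \<xi>" for \<xi>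
          by (simp add: Z0_def T right_diff_distrib)
        have D2m: "?D2 (uminus ` F) \<in> borel_measurable lebesgue" using Dm[of "uminus ` F"] by measurable
        have "sq_norm lebesgue (\<lambda>\<xi>. J R \<xi> * (Z0 \<xi> - T F \<xi>)) = (\<integral>\<^sup>+\<xi>. ?f \<xi> * indicator {-R..R} \<xi> \<partial>lebesgue)"
          unfolding sq_norm_def e
          by (intro nn_integral_cong) (auto simp: J_def indicator_def norm_mult power_mult_distrib ennreal_mult)
        also have "\<dots> \<le> of_nat (card {-N..N}) * (\<integral>\<^sup>+\<xi>. ?f \<xi> \<partial>torus w)"
          unfolding N_def
          by (rule periodic_interval_bound[OF w]) (use D2m in \<open>auto simp: symbol_periodic trig_sum_periodic intro!: borel_measurable_times_ennreal\<close>)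
        also have "(\<integral>\<^sup>+\<xi>. ?f \<xi> \<partial>torus w) = ennreal ((cmod \<kappa>)\<^sup>2) * sq_norm (torus w) (?D (uminus ` F))"
          unfolding sq_norm_def by (rule nn_integral_cmult[OF measurable_torus[OF D2m]])
        finally show ?thesis by (simp add: mult.assoc)
      qed
      then show "\<forall>\<^sub>F F in fsets. sq_norm lebesgue (\<lambda>\<xi>. J R \<xi> * (Z0 \<xi> - T F \<xi>)) \<le> ?K * sq_norm (torus w) (?D (uminus ` F))"
        by (rule always_eventually[OF allI])
    qed simp
  qed
  have uniq: "AE \<xi> in lebesgue. Z \<xi> = Z' \<xi>" if Z: "Q Z" and Z': "Q Z'" for Z Z'
  proof -
    have "AE \<xi> in lebesgue. J (real (Suc k)) \<xi> * Z \<xi> = J (real (Suc k)) \<xi> * Z' \<xi>" for k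
    proof (rule L2_conv_unique[where f="\<lambda>F \<xi>. J (real (Suc k)) \<xi> * T F \<xi>" and F=fsets])
      show "L2_conv lebesgue (\<lambda>F \<xi>. J (real (Suc k)) \<xi> * T F \<xi>) (\<lambda>\<xi>. J (real (Suc k)) \<xi> * Z \<xi>) fsets"
        using Z unfolding Q_def L2_conv_def by (simp add: right_diff_distrib)
      show "L2_conv lebesgue (\<lambda>F \<xi>. J (real (Suc k)) \<xi> * T F \<xi>) (\<lambda>\<xi>. J (real (Suc k)) \<xi> * Z' \<xi>) fsets"
        using Z' unfolding Q_def L2_conv_def by (simp add: right_diff_distrib)
    qed (use Z Z' Jm Tm in \<open>auto simp: Q_def intro!: borel_measurable_times\<close>)
    then have "AE \<xi> in lebesgue. \<forall>k. J (real (Suc k)) \<xi> * Z \<xi> = J (real (Suc k)) \<xi> * Z' \<xi>"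
      by (subst AE_all_countable) auto
    then show ?thesis
    proof eventually_elim
      case (elim \<xi>)
      obtain k where "\<bar>\<xi>\<bar> \<le> real k" using real_arch_simple by blast
      then have "J (real (Suc k)) \<xi> = 1" by (auto simp: J_def indicator_def)
      with elim[rule_format, of k] show ?case by simp
    qed
  qed
  have "zak \<theta> \<phi> \<sigma> = (SOME Z. Q Z)"
    unfolding zak_def Q_def T_def J_def L2_norm_sq_sq_norm ..
  then have "Q (zak \<theta> \<phi> \<sigma>)" using someI[of Q, OF Q0] by simp
  from uniq[OF this Q0] show ?thesis by (simp add: Z0_def)
qed

end

context chirp_sampling
begin

section \<open>Bounds on the symbol that a sampling expansion enforces\<close>

lemma indicator_sq_int: "E \<in> sets lebesgue \<Longrightarrow> sq_int (torus w) (indicator E)"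
proof (rule sq_int_bounded[OF sq_int_harmonic[of w 0 0], of _ 1])
  assume "E \<in> sets lebesgue"
  then show "indicator E \<in> borel_measurable (torus w)" by (intro measurable_torus borel_measurable_indicator)
qed (simp add: indicator_def)

lemma level_sets: "{\<xi>. cmod (symbol \<xi>) < d} \<in> sets lebesgue" "{\<xi>. d < cmod (symbol \<xi>)} \<in> sets lebesgue"
proof -
  have "open {z::complex. cmod z < d}" "open {z::complex. d < cmod z}"
    by (intro open_Collect_less continuous_intros)+
  from this[THEN borel_open, THEN measurable_sets[OF symbol_measurable]]
  show "{\<xi>. cmod (symbol \<xi>) < d} \<in> sets lebesgue" "{\<xi>. d < cmod (symbol \<xi>)} \<in> sets lebesgue"
    by (simp_all add: vimage_def)
qed

lemma indicator_null:
  assumes E: "E \<in> sets lebesgue" and n: "L2norm (torus w) (indicator E) = 0"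
  shows "AE \<xi> in torus w. \<xi> \<notin> E"
proof -
  have "AE \<xi> in torus w. (indicator E \<xi> :: complex) = 0" using L2norm_eq_0[OF indicator_sq_int[OF E]] n by simp
  then show ?thesis
  proof eventually_elim
    case (elim \<xi>)
    then show ?case by (simp add: indicator_def split: if_splits)
  qed
qed

lemma kappa_pos: "0 < cmod \<kappa>" using c_neq_0 by simp

text \<open>
Test the expansion on the function whose symbol is the indicator of $\{|D| < \delta\}$. Its samples
are Fourier coefficients of a function bounded by $\delta$ on that set. The pointwise expansion and
Fatou's lemma bound its norm by the norm of the samples, while its symbol bounds it from below.
\<close>
theorem symbol_lower_bound:
  assumes samp: "sampling_expansion \<theta> \<phi> \<sigma> S" and S: "\<And>n. sq_int lebesgue (S n)" and K: "0 \<le> K"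
    and synth: "\<And>F a. finite F \<Longrightarrow> (L2norm lebesgue (\<lambda>t. \<Sum>n\<in>F. a n * S n t))\<^sup>2 \<le> K * (\<Sum>n\<in>F. (cmod (a n))\<^sup>2)"
  shows "\<exists>\<delta>>0. AE \<xi> in torus w. \<delta> \<le> cmod (symbol \<xi>)"
proof -
  \<comment> \<open>Any $\delta$ with $K|\kappa|^2\delta^2 < A$ serves; $K+1$ avoids division by 0.\<close>
  define \<delta> where "\<delta> = sqrt (A / (2 * (K + 1))) / cmod \<kappa>"
  have \<delta>: "\<delta> > 0" using AB K kappa_pos by (simp add: \<delta>_def)
  have \<delta>2: "(cmod \<kappa>)\<^sup>2 * \<delta>\<^sup>2 = A / (2 * (K + 1))"
    using AB K kappa_pos by (simp add: \<delta>_def power_divide)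
  let ?E = "{\<xi>. cmod (symbol \<xi>) < \<delta>}"
  let ?h = "indicator ?E :: real \<Rightarrow> complex"
  have h: "sq_int (torus w) ?h" by (rule indicator_sq_int[OF level_sets(1)])
  have hZm: "(\<lambda>\<xi>. ?h \<xi> * symbol \<xi>) \<in> borel_measurable (torus w)"
    by (intro borel_measurable_times sq_intD[OF h] sq_intD[OF symbol_sq_int])
  have hZb: "cmod (?h \<xi> * symbol \<xi>) \<le> cmod (of_real \<delta> * ?h \<xi>)" for \<xi>
    using \<delta> by (auto simp: indicator_def norm_mult)
  have hZ: "sq_int (torus w) (\<lambda>\<xi>. ?h \<xi> * symbol \<xi>)"
    by (rule sq_int_bounded[OF h hZm, of \<delta>]) (use hZb \<delta> in \<open>auto simp: norm_mult\<close>)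
  have hZn: "L2norm (torus w) (\<lambda>\<xi>. ?h \<xi> * symbol \<xi>) \<le> \<delta> * L2norm (torus w) ?h"
    using L2norm_mono_AE[OF sq_int_cmult[OF h, of "of_real \<delta>"], of "\<lambda>\<xi>. ?h \<xi> * symbol \<xi>"] hZb \<delta>
    by (simp add: L2norm_cmult[OF h])
  let ?f = "from_symbol ?h"
  define a where "a n = ?f (\<sigma> + of_int n)" for n
  define R where "R = K * ((cmod \<kappa>)\<^sup>2 * \<delta>\<^sup>2 * (L2norm (torus w) ?h)\<^sup>2 / period w)"
  have R0: "0 \<le> R" using K Delta_pos by (simp add: R_def)
  have a: "(\<Sum>n\<in>F. (cmod (a n))\<^sup>2) \<le> (cmod \<kappa>)\<^sup>2 * \<delta>\<^sup>2 * (L2norm (torus w) ?h)\<^sup>2 / period w" if F: "finite F" for F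
  proof -
    have "(\<Sum>n\<in>F. (cmod (a n))\<^sup>2) = (cmod \<kappa>)\<^sup>2 * (\<Sum>n\<in>F. (cmod (fourier_coef w (\<lambda>\<xi>. ?h \<xi> * symbol \<xi>) n))\<^sup>2)"
      by (simp add: a_def from_symbol_sample[OF h] norm_mult power_mult_distrib sum_distrib_left)
    also have "\<dots> \<le> (cmod \<kappa>)\<^sup>2 * l2sq (fourier_coef w (\<lambda>\<xi>. ?h \<xi> * symbol \<xi>))"
      by (intro mult_left_mono l2sq_ge_sum fourier_coef_l2[OF hZ] F) auto
    also have "\<dots> = (cmod \<kappa>)\<^sup>2 * ((L2norm (torus w) (\<lambda>\<xi>. ?h \<xi> * symbol \<xi>))\<^sup>2 / period w)"
      by (simp only: fourier_coef_Parseval[OF w hZ])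
    also have "\<dots> \<le> (cmod \<kappa>)\<^sup>2 * ((\<delta> * L2norm (torus w) ?h)\<^sup>2 / period w)"
      using Delta_pos by (intro mult_left_mono divide_right_mono power_mono hZn) auto
    finally show ?thesis by (simp add: power_mult_distrib)
  qed
  have "sq_norm lebesgue ?f \<le> ennreal R"
  proof (rule sq_norm_Fatou[where f="\<lambda>k t. \<Sum>n\<in>{-int k..int k}. a n * S n t"])
    show "(\<lambda>t. \<Sum>n\<in>{-int k..int k}. a n * S n t) \<in> borel_measurable lebesgue" for k
      by (intro sq_intD sq_int_sum sq_int_cmult S)
    show "AE t in lebesgue. (\<lambda>k. \<Sum>n\<in>{-int k..int k}. a n * S n t) \<longlonglongrightarrow> ?f t"
    proof (rule AE_I2)
      fix t
      have "((\<lambda>n. a n * S n t) has_sum ?f t) UNIV"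
        using samp from_symbol_pt[OF h] unfolding sampling_expansion_def a_def by blast
      then show "(\<lambda>k. \<Sum>n\<in>{-int k..int k}. a n * S n t) \<longlonglongrightarrow> ?f t"
        unfolding has_sum_def by (rule filterlim_compose[OF _ filterlim_symmetric_interval])
    qed
    have "sq_norm lebesgue (\<lambda>t. \<Sum>n\<in>{-int k..int k}. a n * S n t) \<le> ennreal R" for k
    proof -
      have "(L2norm lebesgue (\<lambda>t. \<Sum>n\<in>{-int k..int k}. a n * S n t))\<^sup>2 \<le> K * (\<Sum>n\<in>{-int k..int k}. (cmod (a n))\<^sup>2)"
        by (rule synth) simp
      also have "\<dots> \<le> R" unfolding R_def by (intro mult_left_mono a K) simp
      finally show ?thesis by (simp add: sq_norm_L2norm sq_int_sum sq_int_cmult S ennreal_leI)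
    qed
    then show "\<forall>\<^sub>F k in sequentially. sq_norm lebesgue (\<lambda>t. \<Sum>n\<in>{-int k..int k}. a n * S n t) \<le> ennreal R"
      by simp
  qed
  then have "(L2norm lebesgue ?f)\<^sup>2 \<le> R" using R0 by (simp add: sq_norm_L2norm from_symbol_sq_int[OF h])
  then have "A / period w * (L2norm (torus w) ?h)\<^sup>2 \<le> R" using from_symbol_lower[OF h] by linarith
  then have "period w * (A / period w * (L2norm (torus w) ?h)\<^sup>2) \<le> period w * R"
    using Delta_pos by (intro mult_left_mono) auto
  moreover have "period w * R = K * (A / (2 * (K + 1))) * (L2norm (torus w) ?h)\<^sup>2"
    unfolding R_def \<delta>2 using Delta_pos by simp
  moreover have "period w * (A / period w * (L2norm (torus w) ?h)\<^sup>2) = A * (L2norm (torus w) ?h)\<^sup>2"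
    using Delta_pos by simp
  ultimately have "A * (L2norm (torus w) ?h)\<^sup>2 \<le> K * (A / (2 * (K + 1))) * (L2norm (torus w) ?h)\<^sup>2" by simp
  moreover have "K * (A / (2 * (K + 1))) < A"
  proof -
    have "0 \<le> K * A" using K AB by simp
    then have "K * A < A * (2 * (K + 1))" using AB by (simp add: algebra_simps)
    then have "K * A / (2 * (K + 1)) < A" using K by (subst pos_divide_less_eq) auto
    then show ?thesis by simp
  qed
  ultimately have "\<not> 0 < (L2norm (torus w) ?h)\<^sup>2"
    using mult_strict_right_mono[of "K * (A / (2 * (K + 1)))" A "(L2norm (torus w) ?h)\<^sup>2"] by linarith
  then have "L2norm (torus w) ?h = 0" by simp
  then have "AE \<xi> in torus w. \<xi> \<notin> ?E" by (intro indicator_null level_sets)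
  then have "AE \<xi> in torus w. \<delta> \<le> cmod (symbol \<xi>)" by eventually_elim simp
  then show ?thesis using \<delta> by blast
qed

text \<open>
Where $D$ vanishes the value is the default 0; under the lower bound this is a null set.
\<close>
definition over_symbol :: "(real \<Rightarrow> complex) \<Rightarrow> real \<Rightarrow> complex" where "over_symbol H \<xi> = H \<xi> / (\<kappa> * symbol \<xi>)"

text \<open>
Its symbol is $\lambda(\sigma+n) e^{-ibn\xi}/(\kappa D(\xi))$, which makes the samples a Kronecker
delta.
\<close>
definition samp_fun :: "int \<Rightarrow> real \<Rightarrow> complex" where
  "samp_fun n t = chirp \<theta> (\<sigma> + of_int n) * from_symbol (over_symbol (harmonic w n)) t"

text \<open>
Its symbol is $1/(\kappa D)$; all sampling functions are chirp-modulated shifts of it.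
\<close>
definition samp_gen :: "real \<Rightarrow> complex" where "samp_gen = from_symbol (over_symbol (\<lambda>_. 1))"

lemma fourier_coef_harmonic: "fourier_coef w (harmonic w n) k = (if n = k then 1 else 0)"
  using Delta_pos by (simp add: fourier_coef_def iprod_harmonic[OF w])

lemma one_sq_int: "sq_int (torus w) (\<lambda>_. 1)" using sq_int_harmonic[of w w 0] by (simp add: harmonic_def[abs_def])

context
  fixes \<delta> assumes \<delta>: "\<delta> > 0" and low: "AE \<xi> in torus w. \<delta> \<le> cmod (symbol \<xi>)"
begin

lemma over_symbol_sq_int: assumes H: "sq_int (torus w) H" shows "sq_int (torus w) (over_symbol H)"
proof (rule sq_int_bounded[OF H, of _ "1 / (cmod \<kappa> * \<delta>)"])
  show "over_symbol H \<in> borel_measurable (torus w)"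
    unfolding over_symbol_def[abs_def]
    by (intro borel_measurable_divide borel_measurable_times borel_measurable_const sq_intD[OF H] sq_intD[OF symbol_sq_int])
  show "AE \<xi> in torus w. cmod (over_symbol H \<xi>) \<le> 1 / (cmod \<kappa> * \<delta>) * cmod (H \<xi>)"
    using low
  proof eventually_elim
    case (elim \<xi>)
    have "cmod (H \<xi>) / (cmod \<kappa> * cmod (symbol \<xi>)) \<le> cmod (H \<xi>) / (cmod \<kappa> * \<delta>)"
      using elim \<delta> kappa_pos by (intro divide_left_mono mult_left_mono mult_pos_pos) auto
    then show ?case by (simp add: over_symbol_def norm_divide norm_mult)
  qed
qed

lemma over_symbol_norm: assumes H: "sq_int (torus w) H" shows "L2norm (torus w) (over_symbol H) \<le> L2norm (torus w) H / (cmod \<kappa> * \<delta>)"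
proof -
  have "L2norm (torus w) (over_symbol H) \<le> L2norm (torus w) (\<lambda>\<xi>. of_real (1 / (cmod \<kappa> * \<delta>)) * H \<xi>)"
  proof (rule L2norm_mono_AE[OF sq_int_cmult[OF H]], use low in eventually_elim)
    case (elim \<xi>)
    have "cmod (H \<xi>) / (cmod \<kappa> * cmod (symbol \<xi>)) \<le> cmod (H \<xi>) / (cmod \<kappa> * \<delta>)"
      using elim \<delta> kappa_pos by (intro divide_left_mono mult_left_mono mult_pos_pos) auto
    then show ?case using \<delta> by (simp add: over_symbol_def norm_divide norm_mult)
  qed
  also have "\<dots> = cmod (of_real (1 / (cmod \<kappa> * \<delta>))) * L2norm (torus w) H" by (rule L2norm_cmult[OF H])
  also have "\<dots> = L2norm (torus w) H / (cmod \<kappa> * \<delta>)" unfolding norm_of_real using \<delta> by simp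
  finally show ?thesis .
qed

lemma over_symbol_symbol: "AE \<xi> in torus w. over_symbol H \<xi> * symbol \<xi> = H \<xi> / \<kappa>"
  using low
proof eventually_elim
  case (elim \<xi>)
  then have "symbol \<xi> \<noteq> 0" using \<delta> by auto
  then show ?case by (simp add: over_symbol_def)
qed

lemma from_symbol_over_symbol_sample:
  assumes H: "sq_int (torus w) H"
  shows "from_symbol (over_symbol H) (\<sigma> + of_int k) = cnj (chirp \<theta> (\<sigma> + of_int k)) * fourier_coef w H k"
proof -
  have "fourier_coef w (\<lambda>\<xi>. over_symbol H \<xi> * symbol \<xi>) k = fourier_coef w (\<lambda>\<xi>. (1 / \<kappa>) * H \<xi>) k"
    using over_symbol_symbol[of H]
    by (intro fourier_coef_cong_AE borel_measurable_times borel_measurable_const sq_intD[OF H] sq_intD[OF symbol_sq_int] sq_intD[OF over_symbol_sq_int[OF H]]) simp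
  then show ?thesis
    using c_neq_0 by (simp add: from_symbol_sample[OF over_symbol_sq_int[OF H]] fourier_coef_cmult del: times_divide_eq_left)
qed

lemma samp_fun_sq_int: "sq_int lebesgue (samp_fun n)"
  unfolding samp_fun_def[abs_def] by (intro sq_int_cmult from_symbol_sq_int over_symbol_sq_int sq_int_harmonic)

lemma sum_samp_fun:
  "(\<Sum>n\<in>F. a n * samp_fun n t) = from_symbol (over_symbol (trig_sum w (\<lambda>n. chirp \<theta> (\<sigma> + of_int n) * a n) F)) t"
proof -
  have "over_symbol (trig_sum w (\<lambda>n. chirp \<theta> (\<sigma> + of_int n) * a n) F) = (\<lambda>\<xi>. \<Sum>n\<in>F. (chirp \<theta> (\<sigma> + of_int n) * a n) * over_symbol (harmonic w n) \<xi>)"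
    by (simp add: over_symbol_def trig_sum_def fun_eq_iff sum_divide_distrib)
  then show ?thesis
    using from_symbol_sum[of F "\<lambda>n. over_symbol (harmonic w n)" "\<lambda>n. chirp \<theta> (\<sigma> + of_int n) * a n" t]
    by (simp add: over_symbol_sq_int samp_fun_def mult_ac)
qed

lemma samp_fun_pt: "samp_fun n \<in> chirp_SIS_pt \<theta> \<phi>"
proof -
  have "samp_fun n = from_symbol (over_symbol (trig_sum w (\<lambda>n. chirp \<theta> (\<sigma> + of_int n) * 1) {n}))"
    using sum_samp_fun[where a="\<lambda>_. 1" and F="{n}"] by (simp add: fun_eq_iff)
  then show ?thesis using from_symbol_pt[OF over_symbol_sq_int[OF sq_int_trig_sum]] by metis
qed

lemma samp_fun_sample: "samp_fun n (\<sigma> + of_int k) = (if n = k then 1 else 0)"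
  by (simp add: samp_fun_def from_symbol_over_symbol_sample fourier_coef_harmonic)

text \<open>
Insert \<open>samp_fun n\<close> into the expansion: only the term of index $n$ survives.
\<close>
lemma sampling_unique:
  assumes "sampling_expansion \<theta> \<phi> \<sigma> S" shows "S = samp_fun"
proof (intro ext)
  fix n t
  have "((\<lambda>k. samp_fun n (\<sigma> + of_int k) * S k t) has_sum samp_fun n t) UNIV"
    using assms samp_fun_pt unfolding sampling_expansion_def by blast
  moreover have "((\<lambda>k. samp_fun n (\<sigma> + of_int k) * S k t) has_sum S n t) UNIV"
    using has_sum_finite_neutralI[of "{n}" UNIV "\<lambda>k. samp_fun n (\<sigma> + of_int k) * S k t" "S n t"] by (simp add: samp_fun_sample)
  ultimately show "S n t = samp_fun n t" by (metis has_sum_unique)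
qed

lemma samp_gen_pt: "samp_gen \<in> chirp_SIS_pt \<theta> \<phi>"
  unfolding samp_gen_def by (intro from_symbol_pt over_symbol_sq_int one_sq_int)

lemma samp_fun_translate:
  "samp_fun n t = cnj (chirp \<theta> t) * chirp \<theta> (\<sigma> + of_int n) * chirp \<theta> (t - of_int n) * samp_gen (t - of_int n)"
proof -
  let ?c = "fourier_coef w (over_symbol (\<lambda>_. 1))"
  have fc: "fourier_coef w (over_symbol (harmonic w n)) m = ?c (m - n)" for m
  proof -
    have "iprod (torus w) (over_symbol (harmonic w n)) (harmonic w m) = iprod (torus w) (over_symbol (\<lambda>_. 1)) (harmonic w (m - n))"
      unfolding iprod_def over_symbol_def cnj_harmonic by (simp add: harmonic_mult)
    then show ?thesis by (simp add: fourier_coef_def)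
  qed
  have "(\<Sum>\<^sub>\<infinity>m. ?c (m - n) * \<psi> (t - of_int m)) = (\<Sum>\<^sub>\<infinity>m. ?c m * \<psi> (t - of_int n - of_int m))"
    using infsum_reindex_bij_betw[of "\<lambda>m. m + n" UNIV UNIV "\<lambda>m. ?c (m - n) * \<psi> (t - of_int m)"]
    by (simp add: bij_plus_right algebra_simps)
  then have "from_symbol (over_symbol (harmonic w n)) t = \<kappa> * cnj (chirp \<theta> t) * (\<Sum>\<^sub>\<infinity>m. ?c m * \<psi> (t - of_int n - of_int m))"
    by (simp add: from_symbol_def synth_def fc)
  also have "\<dots> = cnj (chirp \<theta> t) * (chirp \<theta> (t - of_int n) * cnj (chirp \<theta> (t - of_int n))) * (\<kappa> * (\<Sum>\<^sub>\<infinity>m. ?c m * \<psi> (t - of_int n - of_int m)))"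
    by (simp only: chirp_cnj) simp
  also have "\<dots> = cnj (chirp \<theta> t) * chirp \<theta> (t - of_int n) * samp_gen (t - of_int n)"
    unfolding samp_gen_def from_symbol_def synth_def by (simp only: mult_ac)
  finally show ?thesis by (simp add: samp_fun_def mult_ac)
qed

lemma frft_samp_gen: "AE \<xi> in lebesgue. frft \<theta> samp_gen \<xi> = cnj \<kappa> * frft \<theta> \<phi> \<xi> / (chirp \<theta> \<xi> * zak \<theta> \<phi> \<sigma> \<xi>)"
proof -
  have d1: "sq_int (torus w) (over_symbol (\<lambda>_. 1))" by (intro over_symbol_sq_int one_sq_int)
  let ?u = "fourier_sum w (fourier_coef w (over_symbol (\<lambda>_. 1)))"
  have "AE \<xi> in torus w. ?u \<xi> = over_symbol (\<lambda>_. 1) \<xi>" by (rule fourier_sum_fourier_coef[OF w d1])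
  then have "AE \<xi> in lebesgue. ?u \<xi> = over_symbol (\<lambda>_. 1) \<xi>"
    by (intro AE_periodic[OF w]) (simp_all add: fourier_sum_periodic[OF w fourier_coef_l2[OF d1]] over_symbol_def symbol_periodic)
  with frft_from_symbol[OF d1] zak_eq show ?thesis
  proof eventually_elim
    case (elim \<xi>)
    have "frft \<theta> samp_gen \<xi> = frft \<theta> \<phi> \<xi> / symbol \<xi>"
      using elim c_neq_0 by (simp add: samp_gen_def over_symbol_def)
    moreover have "chirp \<theta> \<xi> * zak \<theta> \<phi> \<sigma> \<xi> = cnj \<kappa> * symbol \<xi>"
    proof -
      have "chirp \<theta> \<xi> * zak \<theta> \<phi> \<sigma> \<xi> = (chirp \<theta> \<xi> * cnj (chirp \<theta> \<xi>)) * (cnj \<kappa> * symbol \<xi>)"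
        unfolding elim(2) by (simp only: mult_ac)
      then show ?thesis by simp
    qed
    ultimately show ?case using c_neq_0 by simp
  qed
qed

lemma samp_fun_synthesis_upper:
  assumes F: "finite F"
  shows "(L2norm lebesgue (\<lambda>t. \<Sum>n\<in>F. a n * samp_fun n t))\<^sup>2 \<le> B / ((cmod \<kappa> * \<delta>)\<^sup>2) * (\<Sum>n\<in>F. (cmod (a n))\<^sup>2)"
proof -
  let ?p = "trig_sum w (\<lambda>n. chirp \<theta> (\<sigma> + of_int n) * a n) F"
  have B0: "0 \<le> B / period w" using AB Delta_pos by simp
  have "(L2norm lebesgue (\<lambda>t. \<Sum>n\<in>F. a n * samp_fun n t))\<^sup>2 = (L2norm lebesgue (from_symbol (over_symbol ?p)))\<^sup>2" by (simp add: sum_samp_fun)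
  also have "\<dots> \<le> B / period w * (L2norm (torus w) (over_symbol ?p))\<^sup>2" by (intro from_symbol_upper over_symbol_sq_int sq_int_trig_sum)
  also have "\<dots> \<le> B / period w * (L2norm (torus w) ?p / (cmod \<kappa> * \<delta>))\<^sup>2"
    by (intro mult_left_mono power_mono over_symbol_norm sq_int_trig_sum B0) auto
  also have "\<dots> = B / ((cmod \<kappa> * \<delta>)\<^sup>2) * (\<Sum>n\<in>F. (cmod (a n))\<^sup>2)"
    using Delta_pos by (simp add: power_divide L2norm_trig_sum[OF w F] norm_mult)
  finally show ?thesis .
qed

text \<open>
On the set $\{|D| > M\}$ division by $\kappa D$ shrinks by the factor $|\kappa| M$; this is what
conflicts with a lower bound.
\<close>
lemma over_symbol_level:
  assumes M: "M > 0" and H: "sq_int (torus w) H" and supp: "\<And>\<xi>. \<not> M < cmod (symbol \<xi>) \<Longrightarrow> H \<xi> = 0"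
  shows "L2norm (torus w) (over_symbol H) \<le> L2norm (torus w) H / (cmod \<kappa> * M)"
proof -
  have "L2norm (torus w) (over_symbol H) \<le> L2norm (torus w) (\<lambda>\<xi>. of_real (1 / (cmod \<kappa> * M)) * H \<xi>)"
  proof (rule L2norm_mono_AE[OF sq_int_cmult[OF H]], rule AE_I2)
    fix \<xi>
    show "cmod (over_symbol H \<xi>) \<le> cmod (of_real (1 / (cmod \<kappa> * M)) * H \<xi>)"
    proof (cases "M < cmod (symbol \<xi>)")
      case True
      then have "cmod (H \<xi>) / (cmod \<kappa> * cmod (symbol \<xi>)) \<le> cmod (H \<xi>) / (cmod \<kappa> * M)"
        using M kappa_pos by (intro divide_left_mono mult_left_mono mult_pos_pos) auto
      then show ?thesis using M by (simp add: over_symbol_def norm_divide norm_mult)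
    next
      case False
      then show ?thesis by (simp add: over_symbol_def supp)
    qed
  qed
  also have "\<dots> = cmod (of_real (1 / (cmod \<kappa> * M))) * L2norm (torus w) H" by (rule L2norm_cmult[OF H])
  also have "\<dots> = L2norm (torus w) H / (cmod \<kappa> * M)" unfolding norm_of_real using M by simp
  finally show ?thesis .
qed

lemma AE_upper_from_indicator:
  assumes "L2norm (torus w) (indicator {\<xi>. M < cmod (symbol \<xi>)}) = 0"
  shows "AE \<xi> in torus w. cmod (symbol \<xi>) \<le> M"
proof -
  have "AE \<xi> in torus w. \<xi> \<notin> {\<xi>. M < cmod (symbol \<xi>)}" by (intro indicator_null level_sets assms)
  then show ?thesis by eventually_elim simp
qed

text \<open>
The lower Riesz inequality says that $\|q\|$ is bounded by a constant times $\|q/(\kappa D)\|$ for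
trigonometric sums $q$. Both sides are continuous in $q$, so it holds for the indicator of
$\{|D| > M\}$ too, and fails for large $M$ unless that set is null.
\<close>
theorem symbol_upper_bound_Riesz:
  assumes A': "A' > 0"
    and low': "\<And>F a. finite F \<Longrightarrow> A' * (\<Sum>n\<in>F. (cmod (a n))\<^sup>2) \<le> (L2norm lebesgue (\<lambda>t. \<Sum>n\<in>F. a n * samp_fun n t))\<^sup>2"
  shows "\<exists>M>0. AE \<xi> in torus w. cmod (symbol \<xi>) \<le> M"
proof -
  \<comment> \<open>With this $M$ the upper estimate below is half of what the lower bound demands.\<close>
  define M where "M = sqrt (2 * B / A') / cmod \<kappa>"
  have B0: "B > 0" using AB by simp
  have M: "M > 0" using B0 A' kappa_pos by (simp add: M_def)
  have M2: "(cmod \<kappa> * M)\<^sup>2 = 2 * B / A'" using B0 A' kappa_pos by (simp add: M_def)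
  let ?h = "indicator {\<xi>. M < cmod (symbol \<xi>)} :: real \<Rightarrow> complex"
  have h: "sq_int (torus w) ?h" by (rule indicator_sq_int[OF level_sets(2)])
  let ?d = "fourier_coef w ?h"
  have d: "l2_seq ?d" by (rule fourier_coef_l2[OF h])
  have fin: "A' * (\<Sum>n\<in>F. (cmod (?d n))\<^sup>2) \<le> B / period w * (L2norm (torus w) (over_symbol (trig_sum w ?d F)))\<^sup>2" if F: "finite F" for F
  proof -
    define a where "a n = cnj (chirp \<theta> (\<sigma> + of_int n)) * ?d n" for n
    have ad: "chirp \<theta> (\<sigma> + of_int n) * a n = ?d n" for n by (simp add: a_def mult.assoc[symmetric])
    have "A' * (\<Sum>n\<in>F. (cmod (?d n))\<^sup>2) = A' * (\<Sum>n\<in>F. (cmod (a n))\<^sup>2)" by (simp add: a_def norm_mult)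
    also have "\<dots> \<le> (L2norm lebesgue (\<lambda>t. \<Sum>n\<in>F. a n * samp_fun n t))\<^sup>2" by (rule low'[OF F])
    also have "\<dots> = (L2norm lebesgue (from_symbol (over_symbol (trig_sum w ?d F))))\<^sup>2" by (simp add: sum_samp_fun ad)
    also have "\<dots> \<le> B / period w * (L2norm (torus w) (over_symbol (trig_sum w ?d F)))\<^sup>2" by (intro from_symbol_upper over_symbol_sq_int sq_int_trig_sum)
    finally show ?thesis .
  qed
  have FSd: "sq_int (torus w) (fourier_sum w ?d)" by (rule fourier_sum_sq_int[OF w d])
  have "A' * l2sq ?d \<le> B / period w * (L2norm (torus w) (over_symbol (fourier_sum w ?d)))\<^sup>2"
  proof (rule tendsto_le[OF finite_subsets_at_top_neq_bot])
    show "((\<lambda>F. A' * (\<Sum>n\<in>F. (cmod (?d n))\<^sup>2)) \<longlongrightarrow> A' * l2sq ?d) fsets"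
      by (intro tendsto_mult tendsto_const l2sq_lim d)
    have "((\<lambda>F. L2norm (torus w) (\<lambda>\<xi>. fourier_sum w ?d \<xi> - trig_sum w ?d F \<xi>) / (cmod \<kappa> * \<delta>)) \<longlongrightarrow> 0) fsets"
      using tendsto_divide_zero L2_conv_L2norm[where f="trig_sum w ?d", OF sq_int_trig_sum FSd] fourier_sum_lim[OF w d] by blast
    then have "((\<lambda>F. L2norm (torus w) (over_symbol (trig_sum w ?d F)) - L2norm (torus w) (over_symbol (fourier_sum w ?d))) \<longlongrightarrow> 0) fsets"
    proof (rule Lim_null_comparison[rotated], intro always_eventually allI)
      fix F
      have "norm (L2norm (torus w) (over_symbol (trig_sum w ?d F)) - L2norm (torus w) (over_symbol (fourier_sum w ?d))) \<le> L2norm (torus w) (\<lambda>\<xi>. over_symbol (trig_sum w ?d F) \<xi> - over_symbol (fourier_sum w ?d) \<xi>)"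
        using L2norm_triangle_diff[OF over_symbol_sq_int[OF sq_int_trig_sum] over_symbol_sq_int[OF FSd]] by simp
      also have "\<dots> = L2norm (torus w) (over_symbol (\<lambda>\<xi>. fourier_sum w ?d \<xi> - trig_sum w ?d F \<xi>))"
        by (subst L2norm_minus_commute) (simp add: over_symbol_def[abs_def] diff_divide_distrib)
      also have "\<dots> \<le> L2norm (torus w) (\<lambda>\<xi>. fourier_sum w ?d \<xi> - trig_sum w ?d F \<xi>) / (cmod \<kappa> * \<delta>)"
        by (intro over_symbol_norm sq_int_diff FSd sq_int_trig_sum)
      finally show "norm (L2norm (torus w) (over_symbol (trig_sum w ?d F)) - L2norm (torus w) (over_symbol (fourier_sum w ?d))) \<le> L2norm (torus w) (\<lambda>\<xi>. fourier_sum w ?d \<xi> - trig_sum w ?d F \<xi>) / (cmod \<kappa> * \<delta>)" .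
    qed
    then have "((\<lambda>F. L2norm (torus w) (over_symbol (trig_sum w ?d F))) \<longlongrightarrow> L2norm (torus w) (over_symbol (fourier_sum w ?d))) fsets" by (rule Lim_null[THEN iffD2])
    then show "((\<lambda>F. B / period w * (L2norm (torus w) (over_symbol (trig_sum w ?d F)))\<^sup>2) \<longlongrightarrow> B / period w * (L2norm (torus w) (over_symbol (fourier_sum w ?d)))\<^sup>2) fsets"
      by (intro tendsto_mult tendsto_const tendsto_power)
    show "\<forall>\<^sub>F F in fsets. A' * (\<Sum>n\<in>F. (cmod (?d n))\<^sup>2) \<le> B / period w * (L2norm (torus w) (over_symbol (trig_sum w ?d F)))\<^sup>2"
      by (rule eventually_finite_subsets_at_top_weakI) (rule fin)
  qed
  also have "L2norm (torus w) (over_symbol (fourier_sum w ?d)) = L2norm (torus w) (over_symbol ?h)"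
  proof (rule L2norm_cong_AE, use fourier_sum_fourier_coef[OF w h] in eventually_elim)
    case (elim \<xi>) then show ?case by (simp add: over_symbol_def)
  qed
  also have "B / period w * (L2norm (torus w) (over_symbol ?h))\<^sup>2 \<le> B / period w * (L2norm (torus w) ?h / (cmod \<kappa> * M))\<^sup>2"
    using B0 Delta_pos by (intro mult_left_mono power_mono over_symbol_level M h) (auto simp: indicator_def)
  also have "\<dots> = (A' / 2) * ((L2norm (torus w) ?h)\<^sup>2 / period w)" unfolding power_divide M2 using B0 A' by (simp add: field_simps)
  also have "l2sq ?d = (L2norm (torus w) ?h)\<^sup>2 / period w" by (rule fourier_coef_Parseval[OF w h])
  finally have "A' * ((L2norm (torus w) ?h)\<^sup>2 / period w) \<le> (A' / 2) * ((L2norm (torus w) ?h)\<^sup>2 / period w)" .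
  then have "\<not> 0 < (L2norm (torus w) ?h)\<^sup>2 / period w" using A' mult_right_le_imp_le[of A' _ "A' / 2"] by fastforce
  then have "(L2norm (torus w) ?h)\<^sup>2 / period w \<le> 0" by (rule leI)
  then have "(L2norm (torus w) ?h)\<^sup>2 \<le> 0" using Delta_pos by (simp add: divide_le_0_iff)
  then have "L2norm (torus w) ?h = 0" by simp
  with M show ?thesis using AE_upper_from_indicator by blast
qed

text \<open>
Let $f$ have the indicator of $\{|D| > M\}$ as its symbol. By duality
$\sum_{n\in F} |\langle f, S_n\rangle|^2 = \langle f, g\rangle$, where $g$ has a symbol of the form
$q/(\kappa D)$ with a trigonometric sum $q$. By orthogonality only the part of that symbol on
$\{|D| > M\}$ counts, and there it is small. For large $M$ this contradicts the lower frame
inequality unless $f = 0$.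
\<close>
theorem symbol_upper_bound_frame:
  assumes A': "A' > 0"
    and low': "\<And>h. h \<in> chirp_SIS_pt \<theta> \<phi> \<Longrightarrow> ennreal A' * sq_norm lebesgue h \<le> (\<Sum>\<^sub>\<infinity>n. ennreal ((cmod (iprod lebesgue h (samp_fun n)))\<^sup>2))"
  shows "\<exists>M>0. AE \<xi> in torus w. cmod (symbol \<xi>) \<le> M"
proof -
  \<comment> \<open>With this $M$ the upper estimate below is half of what the lower bound demands.\<close>
  define M where "M = sqrt (2 * B / A') / cmod \<kappa>"
  have B0: "B > 0" using AB by simp
  have M: "M > 0" using B0 A' kappa_pos by (simp add: M_def)
  have M2: "(cmod \<kappa> * M)\<^sup>2 = 2 * B / A'" using B0 A' kappa_pos by (simp add: M_def)
  let ?h = "indicator {\<xi>. M < cmod (symbol \<xi>)} :: real \<Rightarrow> complex"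
  have h: "sq_int (torus w) ?h" by (rule indicator_sq_int[OF level_sets(2)])
  let ?f = "from_symbol ?h"
  have f: "sq_int lebesgue ?f" by (rule from_symbol_sq_int[OF h])
  have fin: "(\<Sum>n\<in>F. (cmod (iprod lebesgue ?f (samp_fun n)))\<^sup>2) \<le> A' / 2 * (L2norm lebesgue ?f)\<^sup>2" if F: "finite F" for F
  proof -
    define a where "a n = iprod lebesgue ?f (samp_fun n)" for n
    let ?X = "\<Sum>n\<in>F. (cmod (a n))\<^sup>2"
    have X0: "0 \<le> ?X" by (intro sum_nonneg) auto
    define q where "q = trig_sum w (\<lambda>n. chirp \<theta> (\<sigma> + of_int n) * a n) F"
    have q: "sq_int (torus w) q" by (simp add: q_def)
    let ?q1 = "\<lambda>\<xi>. ?h \<xi> * q \<xi>" and ?q2 = "\<lambda>\<xi>. (1 - ?h \<xi>) * q \<xi>"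
    have q1: "sq_int (torus w) ?q1"
    proof (rule sq_int_bounded[OF q, of _ 1])
      show "?q1 \<in> borel_measurable (torus w)" by (rule borel_measurable_times[OF sq_intD[OF h] sq_intD[OF q]])
    qed (simp add: indicator_def)
    have q2: "sq_int (torus w) ?q2"
      using sq_int_diff[OF q q1] by (simp add: left_diff_distrib)
    have split: "from_symbol (over_symbol q) t = 1 * from_symbol (over_symbol ?q1) t + from_symbol (over_symbol ?q2) t" for t
    proof -
      have "over_symbol q = (\<lambda>\<xi>. 1 * over_symbol ?q1 \<xi> + over_symbol ?q2 \<xi>)"
        by (simp add: fun_eq_iff over_symbol_def add_divide_distrib[symmetric] algebra_simps)
      then show ?thesis using from_symbol_add_cmult[OF over_symbol_sq_int[OF q1] over_symbol_sq_int[OF q2], of 1 t] by simp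
    qed
    have orth: "iprod lebesgue (from_symbol (over_symbol ?q2)) ?f = 0"
      by (rule from_symbol_orthogonal[OF over_symbol_sq_int[OF q2] h]) (auto simp: over_symbol_def indicator_def)
    have "complex_of_real ?X = iprod lebesgue ?f (\<lambda>t. \<Sum>n\<in>F. a n * samp_fun n t)"
      unfolding a_def by (rule sum_iprod_sq[OF samp_fun_sq_int f])
    also have "(\<lambda>t. \<Sum>n\<in>F. a n * samp_fun n t) = (\<lambda>t. from_symbol (over_symbol ?q1) t + from_symbol (over_symbol ?q2) t)"
      using split by (simp add: sum_samp_fun q_def fun_eq_iff)
    also have "iprod lebesgue ?f (\<lambda>t. from_symbol (over_symbol ?q1) t + from_symbol (over_symbol ?q2) t) = cnj (iprod lebesgue (\<lambda>t. from_symbol (over_symbol ?q1) t + from_symbol (over_symbol ?q2) t) ?f)"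
      by (simp add: iprod_cnj)
    also have "\<dots> = cnj (iprod lebesgue (from_symbol (over_symbol ?q1)) ?f)"
      by (subst iprod_add_left) (auto simp: from_symbol_sq_int over_symbol_sq_int q1 q2 f orth)
    finally have Xe: "complex_of_real ?X = cnj (iprod lebesgue (from_symbol (over_symbol ?q1)) ?f)" .
    have "?X = cmod (complex_of_real ?X)" using X0 by (simp only: norm_of_real abs_of_nonneg)
    also have "\<dots> = cmod (iprod lebesgue (from_symbol (over_symbol ?q1)) ?f)" by (simp only: Xe complex_mod_cnj)
    also have "\<dots> \<le> L2norm lebesgue (from_symbol (over_symbol ?q1)) * L2norm lebesgue ?f"
      by (intro iprod_bound from_symbol_sq_int over_symbol_sq_int q1 f)
    finally have "?X\<^sup>2 \<le> (L2norm lebesgue (from_symbol (over_symbol ?q1)) * L2norm lebesgue ?f)\<^sup>2" using X0 by (intro power_mono)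
    also have "\<dots> = (L2norm lebesgue (from_symbol (over_symbol ?q1)))\<^sup>2 * (L2norm lebesgue ?f)\<^sup>2" by (simp add: power_mult_distrib)
    also have "(L2norm lebesgue (from_symbol (over_symbol ?q1)))\<^sup>2 \<le> A' / 2 * ?X"
    proof -
      have "(L2norm lebesgue (from_symbol (over_symbol ?q1)))\<^sup>2 \<le> B / period w * (L2norm (torus w) (over_symbol ?q1))\<^sup>2" by (intro from_symbol_upper over_symbol_sq_int q1)
      also have "\<dots> \<le> B / period w * (L2norm (torus w) ?q1 / (cmod \<kappa> * M))\<^sup>2"
        using B0 Delta_pos by (intro mult_left_mono power_mono over_symbol_level M q1) (auto simp: indicator_def)
      also have "\<dots> \<le> B / period w * (L2norm (torus w) q / (cmod \<kappa> * M))\<^sup>2"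
        using B0 Delta_pos M by (intro mult_left_mono power_mono divide_right_mono L2norm_mono_AE q) (auto simp: indicator_def norm_mult)
      also have "\<dots> = B / period w * (period w * ?X / (2 * B / A'))"
        unfolding power_divide M2 q_def by (simp add: L2norm_trig_sum[OF w F] norm_mult)
      also have "\<dots> = A' / 2 * ?X" using B0 A' Delta_pos by (simp add: field_simps)
      finally show ?thesis .
    qed
    finally have "?X * ?X \<le> (A' / 2 * (L2norm lebesgue ?f)\<^sup>2) * ?X"
      by (simp add: power2_eq_square mult_ac mult_right_mono)
    moreover have "0 \<le> A' / 2 * (L2norm lebesgue ?f)\<^sup>2" using A' by simp
    ultimately have "?X \<le> A' / 2 * (L2norm lebesgue ?f)\<^sup>2" by (rule cancel_self_mult_le) (rule X0)
    then show ?thesis by (simp add: a_def)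
  qed
  have "ennreal A' * sq_norm lebesgue ?f \<le> ennreal (A' / 2 * (L2norm lebesgue ?f)\<^sup>2)"
    by (rule order_trans[OF low'[OF from_symbol_pt[OF h]] infsum_ennreal_le[OF fin]]) (use A' in auto)
  then have "A' * (L2norm lebesgue ?f)\<^sup>2 \<le> A' / 2 * (L2norm lebesgue ?f)\<^sup>2"
    using A' by (simp add: sq_norm_L2norm f ennreal_mult[symmetric])
  then have "(L2norm lebesgue ?f)\<^sup>2 \<le> 0" using A' by simp
  then have "A / period w * (L2norm (torus w) ?h)\<^sup>2 \<le> 0" using from_symbol_lower[OF h] by linarith
  then have "(L2norm (torus w) ?h)\<^sup>2 \<le> 0" using AB Delta_pos by (simp add: mult_le_0_iff divide_le_0_iff)
  then have "L2norm (torus w) ?h = 0" by simp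
  with M show ?thesis using AE_upper_from_indicator by blast
qed

end

end

context chirp_sampling
begin

section \<open>Sampling expansions from bounds on the symbol\<close>

lemma pt_sum:
  assumes S: "\<And>n. S n \<in> chirp_SIS_pt \<theta> \<phi>"
  shows "(\<lambda>t. \<Sum>n\<in>F. a n * S n t) \<in> chirp_SIS_pt \<theta> \<phi>"
proof -
  have "\<forall>n. \<exists>H. sq_int (torus w) H \<and> S n = from_symbol H" using S from_symbol_surj by metis
  then obtain H where H: "\<And>n. sq_int (torus w) (H n)" "\<And>n. S n = from_symbol (H n)" by metis
  have sq: "sq_int (torus w) (\<lambda>\<xi>. \<Sum>n\<in>F. a n * H n \<xi>)" by (intro sq_int_sum sq_int_cmult H(1))
  have eq: "(\<lambda>t. \<Sum>n\<in>F. a n * S n t) = from_symbol (\<lambda>\<xi>. \<Sum>n\<in>F. a n * H n \<xi>)"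
    by (rule ext) (simp add: H(2) from_symbol_sum[OF H(1)])
  show ?thesis unfolding eq by (rule from_symbol_pt[OF sq])
qed

lemma pt_sq_int: "f \<in> chirp_SIS_pt \<theta> \<phi> \<Longrightarrow> sq_int lebesgue f"
  by (metis from_symbol_surj from_symbol_sq_int)

text \<open>
The symbol of the error after summation over $F$.
\<close>
abbreviation rest :: "(int \<Rightarrow> complex) \<Rightarrow> int set \<Rightarrow> real \<Rightarrow> complex" where
  "rest d F \<equiv> over_symbol (\<lambda>\<xi>. fourier_sum w d \<xi> - trig_sum w d F \<xi>)"

text \<open>
The coefficient of \<open>samp_fun n\<close> that contributes $d_n$ to the symbol.
\<close>
abbreviation dechirp :: "(int \<Rightarrow> complex) \<Rightarrow> int \<Rightarrow> complex" where
  "dechirp d n \<equiv> cnj (chirp \<theta> (\<sigma> + of_int n)) * d n"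

context
  fixes \<delta> assumes \<delta>: "\<delta> > 0" and low: "AE \<xi> in torus w. \<delta> \<le> cmod (symbol \<xi>)"
begin

text \<open>
The symbol of the error tends to 0 in norm. Convergence in square mean and uniform convergence follow
from the two bounds of a function by its symbol, \<open>from_symbol_upper\<close> and
\<open>from_symbol_pointwise_bound\<close>.
\<close>
lemma rem_eq:
  assumes d: "l2_seq d"
  shows "from_symbol (over_symbol (fourier_sum w d)) t - (\<Sum>n\<in>F. dechirp d n * samp_fun n t)
       = from_symbol (rest d F) t"
proof -
  have FSd: "sq_int (torus w) (fourier_sum w d)" by (rule fourier_sum_sq_int[OF w d])
  have e: "chirp \<theta> (\<sigma> + of_int n) * dechirp d n = d n" for n
    by (simp add: mult.assoc[symmetric])
  have "rest d F = (\<lambda>\<xi>. (-1) * over_symbol (trig_sum w d F) \<xi> + over_symbol (fourier_sum w d) \<xi>)"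
    by (simp add: fun_eq_iff over_symbol_def diff_divide_distrib)
  then have "from_symbol (rest d F) t = (-1) * from_symbol (over_symbol (trig_sum w d F)) t + from_symbol (over_symbol (fourier_sum w d)) t"
    using from_symbol_add_cmult[OF over_symbol_sq_int[OF \<delta> low sq_int_trig_sum] over_symbol_sq_int[OF \<delta> low FSd], of "-1"] by metis
  then show ?thesis by (simp only: sum_samp_fun[OF \<delta> low] e) simp
qed

lemma rem_lim:
  assumes d: "l2_seq d"
  shows "((\<lambda>F. L2norm (torus w) (rest d F)) \<longlongrightarrow> 0) fsets"
proof (rule Lim_null_comparison)
  have FSd: "sq_int (torus w) (fourier_sum w d)" by (rule fourier_sum_sq_int[OF w d])
  show "((\<lambda>F. L2norm (torus w) (\<lambda>\<xi>. fourier_sum w d \<xi> - trig_sum w d F \<xi>) / (cmod \<kappa> * \<delta>)) \<longlongrightarrow> 0) fsets"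
    using tendsto_divide_zero L2_conv_L2norm[where f="trig_sum w d", OF sq_int_trig_sum FSd] fourier_sum_lim[OF w d] by blast
  show "\<forall>\<^sub>F F in fsets. norm (L2norm (torus w) (rest d F)) \<le> L2norm (torus w) (\<lambda>\<xi>. fourier_sum w d \<xi> - trig_sum w d F \<xi>) / (cmod \<kappa> * \<delta>)"
  proof (intro always_eventually allI)
    fix F
    show "norm (L2norm (torus w) (rest d F)) \<le> L2norm (torus w) (\<lambda>\<xi>. fourier_sum w d \<xi> - trig_sum w d F \<xi>) / (cmod \<kappa> * \<delta>)"
      using over_symbol_norm[OF \<delta> low sq_int_diff[OF FSd sq_int_trig_sum]] by simp
  qed
qed

lemma rem_sq_int: "l2_seq d \<Longrightarrow> sq_int (torus w) (rest d F)"
  by (intro over_symbol_sq_int[OF \<delta> low] sq_int_diff fourier_sum_sq_int w sq_int_trig_sum)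

lemma synthesis_L2:
  assumes d: "l2_seq d"
  shows "L2_has_sum (\<lambda>n t. dechirp d n * samp_fun n t) (from_symbol (over_symbol (fourier_sum w d)))"
  unfolding L2_has_sum_def L2_norm_sq_sq_norm rem_eq[OF d]
proof (rule iffD2[OF sq_norm_tendsto_0_iff])
  show "sq_int lebesgue (from_symbol (rest d F))" for F
    by (rule from_symbol_sq_int[OF rem_sq_int[OF d]])
  have K: "0 \<le> B / period w" using AB Delta_pos by simp
  show "((\<lambda>F. L2norm lebesgue (from_symbol (rest d F))) \<longlongrightarrow> 0) fsets"
  proof (rule Lim_null_comparison)
    show "((\<lambda>F. sqrt (B / period w) * L2norm (torus w) (rest d F)) \<longlongrightarrow> 0) fsets"
      by (rule tendsto_mult_right_zero[OF rem_lim[OF d]])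
    have "L2norm lebesgue (from_symbol (rest d F)) \<le> sqrt (B / period w) * L2norm (torus w) (rest d F)" for F
      using real_sqrt_le_mono[OF from_symbol_upper[OF rem_sq_int[OF d, of F]]] by (simp only: real_sqrt_mult real_sqrt_abs abs_of_nonneg L2norm_nonneg)
    then show "\<forall>\<^sub>F F in fsets. norm (L2norm lebesgue (from_symbol (rest d F))) \<le> sqrt (B / period w) * L2norm (torus w) (rest d F)"
      by (intro always_eventually allI) simp
  qed
qed

lemma synthesis_uniform:
  assumes d: "l2_seq d" and X: "\<And>t. t \<in> X \<Longrightarrow> C_fun \<theta> \<phi> t \<le> ennreal M"
  shows "uniform_limit X (\<lambda>F t. \<Sum>n\<in>F. dechirp d n * samp_fun n t) (from_symbol (over_symbol (fourier_sum w d))) fsets"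
proof (rule uniform_limitI)
  fix e :: real assume e: "e > 0"
  define K where "K = cmod \<kappa> / sqrt (period w) * sqrt (max 0 M)"
  have K0: "0 \<le> K" using Delta_pos by (simp add: K_def)
  have lim: "((\<lambda>F. K * L2norm (torus w) (rest d F)) \<longlongrightarrow> 0) fsets"
    by (rule tendsto_mult_right_zero[OF rem_lim[OF d]])
  have b: "dist (\<Sum>n\<in>F. dechirp d n * samp_fun n t) (from_symbol (over_symbol (fourier_sum w d)) t)
     \<le> K * L2norm (torus w) (rest d F)" if t: "t \<in> X" for F t
  proof -
    have "ennreal (l2sq (\<lambda>n. \<psi> (t - of_int n))) \<le> ennreal (max 0 M)"
      using X[OF t] unfolding C_l2sq by (rule order_trans) (simp add: ennreal_leI)
    then have lM: "l2sq (\<lambda>n. \<psi> (t - of_int n)) \<le> max 0 M" by (subst (asm) ennreal_le_iff) auto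
    have "dist (\<Sum>n\<in>F. dechirp d n * samp_fun n t) (from_symbol (over_symbol (fourier_sum w d)) t) = cmod (from_symbol (rest d F) t)"
      by (subst dist_commute) (simp only: dist_norm rem_eq[OF d])
    also have "\<dots> \<le> cmod \<kappa> / sqrt (period w) * sqrt (l2sq (\<lambda>n. \<psi> (t - of_int n))) * L2norm (torus w) (rest d F)"
      by (rule from_symbol_pointwise_bound[OF rem_sq_int[OF d]])
    also have "\<dots> \<le> K * L2norm (torus w) (rest d F)"
      unfolding K_def using Delta_pos lM by (intro mult_right_mono mult_left_mono real_sqrt_le_mono) auto
    finally show ?thesis .
  qed
  have "\<forall>\<^sub>F F in fsets. K * L2norm (torus w) (rest d F) < e"
    by (rule order_tendstoD(2)[OF lim e])
  then show "\<forall>\<^sub>F F in fsets. \<forall>t\<in>X. dist (\<Sum>n\<in>F. dechirp d n * samp_fun n t) (from_symbol (over_symbol (fourier_sum w d)) t) < e"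
    by eventually_elim (use b in \<open>blast intro: order.strict_trans1\<close>)
qed

context
  fixes M assumes M: "M > 0" and up: "AE \<xi> in torus w. cmod (symbol \<xi>) \<le> M"
begin

text \<open>
If $H$ is the symbol of $f$, take for $d$ the Fourier coefficients of $\kappa H D$, which is square
integrable because $D$ is bounded. Then $d$ gives the samples of $f$, and dividing $\kappa H D$ by
$\kappa D$ recovers $H$.
\<close>
lemma pt_coefficients:
  assumes f: "f \<in> chirp_SIS_pt \<theta> \<phi>"
  obtains d where "l2_seq d" "f = from_symbol (over_symbol (fourier_sum w d))" "\<And>n. f (\<sigma> + of_int n) = dechirp d n"
proof -
  obtain H where H: "sq_int (torus w) H" "f = from_symbol H" using from_symbol_surj[OF f] by metis
  let ?q = "\<lambda>\<xi>. \<kappa> * (H \<xi> * symbol \<xi>)"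
  have q: "sq_int (torus w) ?q"
  proof (rule sq_int_bounded[OF H(1), of _ "cmod \<kappa> * M"])
    show "?q \<in> borel_measurable (torus w)"
      by (intro borel_measurable_times borel_measurable_const sq_intD[OF H(1)] sq_intD[OF symbol_sq_int])
    show "AE \<xi> in torus w. cmod (?q \<xi>) \<le> cmod \<kappa> * M * cmod (H \<xi>)"
      using up
    proof eventually_elim
      case (elim \<xi>)
      then have "cmod \<kappa> * (cmod (H \<xi>) * cmod (symbol \<xi>)) \<le> cmod \<kappa> * (cmod (H \<xi>) * M)"
        by (intro mult_left_mono) auto
      then show ?case by (simp add: norm_mult mult_ac)
    qed
  qed
  let ?d = "fourier_coef w ?q"
  have d: "l2_seq ?d" by (rule fourier_coef_l2[OF q])
  have "f = from_symbol (over_symbol (fourier_sum w ?d))"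
    unfolding H(2)
  proof (rule from_symbol_cong_AE[OF H(1) over_symbol_sq_int[OF \<delta> low fourier_sum_sq_int[OF w d]]])
    show "AE \<xi> in torus w. H \<xi> = over_symbol (fourier_sum w ?d) \<xi>"
      using fourier_sum_fourier_coef[OF w q] low
    proof eventually_elim
      case (elim \<xi>)
      then have "symbol \<xi> \<noteq> 0" using \<delta> by auto
      then show ?case using elim c_neq_0 by (simp add: over_symbol_def)
    qed
  qed
  moreover have "f (\<sigma> + of_int n) = dechirp ?d n" for n
    unfolding H(2) from_symbol_sample[OF H(1)] fourier_coef_cmult by (simp add: mult_ac)
  ultimately show ?thesis using that d by blast
qed

theorem sampling_L2:
  assumes "f \<in> chirp_SIS_pt \<theta> \<phi>"
  shows "L2_has_sum (\<lambda>n t. f (\<sigma> + of_int n) * samp_fun n t) f"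
proof -
  obtain d where "l2_seq d" "f = from_symbol (over_symbol (fourier_sum w d))" "\<And>n. f (\<sigma> + of_int n) = dechirp d n"
    using pt_coefficients[OF assms] by metis
  then show ?thesis using synthesis_L2[of d] by simp
qed

theorem sampling_uniform:
  assumes "f \<in> chirp_SIS_pt \<theta> \<phi>" and "\<And>t. t \<in> X \<Longrightarrow> C_fun \<theta> \<phi> t \<le> ennreal M'"
  shows "uniform_limit X (\<lambda>F t. \<Sum>n\<in>F. f (\<sigma> + of_int n) * samp_fun n t) f fsets"
proof -
  obtain d where "l2_seq d" "f = from_symbol (over_symbol (fourier_sum w d))" "\<And>n. f (\<sigma> + of_int n) = dechirp d n"
    using pt_coefficients[OF assms(1)] by metis
  then show ?thesis using synthesis_uniform[of d, OF _ assms(2)] by simp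
qed

theorem samp_fun_sampling: "sampling_expansion \<theta> \<phi> \<sigma> samp_fun"
  unfolding sampling_expansion_def
proof (intro ballI allI)
  fix f t assume f: "f \<in> chirp_SIS_pt \<theta> \<phi>"
  have "uniform_limit {t} (\<lambda>F t. \<Sum>n\<in>F. f (\<sigma> + of_int n) * samp_fun n t) f fsets"
    by (rule sampling_uniform[OF f, of _ "l2sq (\<lambda>n. \<psi> (t - of_int n))"]) (simp add: C_l2sq)
  then have "((\<lambda>F. \<Sum>n\<in>F. f (\<sigma> + of_int n) * samp_fun n t) \<longlongrightarrow> f t) fsets" by (rule tendsto_uniform_limitI) simp
  then show "((\<lambda>n. f (\<sigma> + of_int n) * samp_fun n t) has_sum f t) UNIV" by (simp add: has_sum_def)
qed

lemma over_symbol_lower: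
  assumes H: "sq_int (torus w) H" shows "L2norm (torus w) H \<le> cmod \<kappa> * M * L2norm (torus w) (over_symbol H)"
proof -
  have "L2norm (torus w) H \<le> L2norm (torus w) (\<lambda>\<xi>. of_real (cmod \<kappa> * M) * over_symbol H \<xi>)"
  proof (rule L2norm_mono_AE[OF sq_int_cmult[OF over_symbol_sq_int[OF \<delta> low H]]], use low up in eventually_elim)
    case (elim \<xi>)
    have Z: "0 < cmod (symbol \<xi>)" using elim \<delta> by linarith
    have "cmod (H \<xi>) = (cmod \<kappa> * cmod (symbol \<xi>)) * (cmod (H \<xi>) / (cmod \<kappa> * cmod (symbol \<xi>)))"
      using Z kappa_pos by simp
    also have "\<dots> \<le> (cmod \<kappa> * M) * (cmod (H \<xi>) / (cmod \<kappa> * cmod (symbol \<xi>)))"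
      using elim by (intro mult_right_mono mult_left_mono) auto
    finally show ?case using M by (simp add: over_symbol_def norm_divide norm_mult)
  qed
  also have "\<dots> = cmod (of_real (cmod \<kappa> * M)) * L2norm (torus w) (over_symbol H)" by (rule L2norm_cmult[OF over_symbol_sq_int[OF \<delta> low H]])
  finally show ?thesis unfolding norm_of_real using M by simp
qed

text \<open>
Up to the bounds of $G$ this compares $\|q/(\kappa D)\|$ with $\|q\|$ for $q = \sum d_n e^{-ibn\xi}$.
\<close>
lemma synthesis_bounds:
  assumes d: "l2_seq d"
  shows "A / (cmod \<kappa> * M)\<^sup>2 * l2sq d \<le> (L2norm lebesgue (from_symbol (over_symbol (fourier_sum w d))))\<^sup>2"
    and "(L2norm lebesgue (from_symbol (over_symbol (fourier_sum w d))))\<^sup>2 \<le> B / (cmod \<kappa> * \<delta>)\<^sup>2 * l2sq d"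
proof -
  have FSd: "sq_int (torus w) (fourier_sum w d)" by (rule fourier_sum_sq_int[OF w d])
  have P: "(L2norm (torus w) (fourier_sum w d))\<^sup>2 = period w * l2sq d" by (rule fourier_sum_Parseval[OF w d])
  have kM: "0 < cmod \<kappa> * M" using kappa_pos M by simp
  have "A / (cmod \<kappa> * M)\<^sup>2 * l2sq d = A / period w * ((L2norm (torus w) (fourier_sum w d)) / (cmod \<kappa> * M))\<^sup>2"
    using Delta_pos by (simp add: power_divide P)
  also have "\<dots> \<le> A / period w * (L2norm (torus w) (over_symbol (fourier_sum w d)))\<^sup>2"
    using AB Delta_pos over_symbol_lower[OF FSd] kM by (intro mult_left_mono power_mono) (auto simp: pos_divide_le_eq mult_ac)
  also have "\<dots> \<le> (L2norm lebesgue (from_symbol (over_symbol (fourier_sum w d))))\<^sup>2" by (rule from_symbol_lower[OF over_symbol_sq_int[OF \<delta> low FSd]])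
  finally show "A / (cmod \<kappa> * M)\<^sup>2 * l2sq d \<le> (L2norm lebesgue (from_symbol (over_symbol (fourier_sum w d))))\<^sup>2" .
  have "(L2norm lebesgue (from_symbol (over_symbol (fourier_sum w d))))\<^sup>2 \<le> B / period w * (L2norm (torus w) (over_symbol (fourier_sum w d)))\<^sup>2" by (rule from_symbol_upper[OF over_symbol_sq_int[OF \<delta> low FSd]])
  also have "\<dots> \<le> B / period w * ((L2norm (torus w) (fourier_sum w d)) / (cmod \<kappa> * \<delta>))\<^sup>2"
    using AB Delta_pos by (intro mult_left_mono power_mono over_symbol_norm[OF \<delta> low FSd]) auto
  also have "\<dots> = B / (cmod \<kappa> * \<delta>)\<^sup>2 * l2sq d"
    using Delta_pos by (simp add: power_divide P)
  finally show "(L2norm lebesgue (from_symbol (over_symbol (fourier_sum w d))))\<^sup>2 \<le> B / (cmod \<kappa> * \<delta>)\<^sup>2 * l2sq d" .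
qed

definition lower_const where "lower_const = A / (cmod \<kappa> * M)\<^sup>2"

definition upper_const where "upper_const = B / (cmod \<kappa> * \<delta>)\<^sup>2"

lemma lower_const_pos: "0 < lower_const" using AB kappa_pos M by (simp add: lower_const_def)

lemma upper_const_nonneg: "0 \<le> upper_const" using AB by (simp add: upper_const_def)

text \<open>
The bounds are those of the preceding lemma, since \<open>dechirp\<close> preserves absolute values. Taking
a maximum for the upper constant makes it comparable to the lower one without a discussion of
$\delta$ and $M$.
\<close>
theorem samp_fun_riesz: "L2_riesz_basis (chirp_SIS_pt \<theta> \<phi>) samp_fun"
  unfolding L2_riesz_basis_def
proof (intro conjI allI subsetI)
  show "samp_fun n \<in> chirp_SIS_pt \<theta> \<phi>" for n by (rule samp_fun_pt[OF \<delta> low])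
  show "f \<in> L2_closed_span samp_fun" if f: "f \<in> chirp_SIS_pt \<theta> \<phi>" for f
    unfolding L2_closed_span_def
  proof safe
    show "L2_fun f" using pt_sq_int[OF f] by (simp add: L2_fun_sq_int)
    fix e :: real assume e: "e > 0"
    have "\<forall>\<^sub>F F in fsets. finite F \<and> L2_norm_sq (\<lambda>t. f t - (\<Sum>n\<in>F. f (\<sigma> + of_int n) * samp_fun n t)) < ennreal e"
      using order_tendstoD(2)[OF sampling_L2[OF f, unfolded L2_has_sum_def], of "ennreal e"] e eventually_fin
      by (intro eventually_conj) auto
    from eventually_happens[OF this] show "\<exists>F c. finite F \<and> L2_norm_sq (\<lambda>t. f t - (\<Sum>n\<in>F. c n * samp_fun n t)) < ennreal e"
      by auto
  qed
  show "\<exists>A B. 0 < A \<and> A \<le> B \<and> (\<forall>c. l2_seq c \<longrightarrow> (\<exists>g. L2_fun g \<and> L2_has_sum (\<lambda>n t. c n * samp_fun n t) g \<and>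
      ennreal A * l2_norm_sq c \<le> L2_norm_sq g \<and> L2_norm_sq g \<le> ennreal B * l2_norm_sq c))"
  proof (rule exI[of _ lower_const], rule exI[of _ "max lower_const upper_const"], intro conjI allI impI)
    fix c assume c: "l2_seq c"
    define d where "d n = chirp \<theta> (\<sigma> + of_int n) * c n" for n
    have d: "l2_seq d" "l2sq d = l2sq c"
      unfolding d_def using c by (simp_all add: unimodular_l2)
    have cd: "dechirp d n = c n" for n by (simp add: d_def mult.assoc[symmetric])
    let ?g = "from_symbol (over_symbol (fourier_sum w d))"
    have g: "sq_int lebesgue ?g" by (intro from_symbol_sq_int over_symbol_sq_int[OF \<delta> low] fourier_sum_sq_int w d)
    have 1: "lower_const * l2sq c \<le> (L2norm lebesgue ?g)\<^sup>2" using synthesis_bounds(1)[OF d(1)] by (simp add: lower_const_def d)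
    have "(L2norm lebesgue ?g)\<^sup>2 \<le> upper_const * l2sq c" using synthesis_bounds(2)[OF d(1)] by (simp add: upper_const_def d)
    also have "\<dots> \<le> max lower_const upper_const * l2sq c" by (intro mult_right_mono) auto
    finally have 2: "(L2norm lebesgue ?g)\<^sup>2 \<le> max lower_const upper_const * l2sq c" .
    have "ennreal lower_const * l2_norm_sq c = ennreal (lower_const * l2sq c)" "ennreal (max lower_const upper_const) * l2_norm_sq c = ennreal (max lower_const upper_const * l2sq c)"
      using lower_const_pos by (simp_all add: l2_norm_sq_l2sq[OF c] ennreal_mult' less_max_iff_disj max.coboundedI1 less_imp_le)
    then show "\<exists>g. L2_fun g \<and> L2_has_sum (\<lambda>n t. c n * samp_fun n t) g \<and> ennreal lower_const * l2_norm_sq c \<le> L2_norm_sq g \<and> L2_norm_sq g \<le> ennreal (max lower_const upper_const) * l2_norm_sq c"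
      using synthesis_L2[OF d(1)] 1 2 g
      by (intro exI[of _ ?g]) (simp add: cd L2_fun_sq_int L2_norm_sq_sq_norm sq_norm_L2norm ennreal_leI)
  qed (use lower_const_pos in auto)
qed

text \<open>
The upper bound is the Bessel inequality dual to the synthesis bound. For the lower one expand
$\langle h, h\rangle = \sum_n h(\sigma+n) \langle S_n, h\rangle$ and use that the samples are bounded
by $\|h\|$.
\<close>
theorem samp_fun_frame: "L2_frame (chirp_SIS_pt \<theta> \<phi>) samp_fun"
  unfolding L2_frame_def
proof (intro conjI allI)
  show "samp_fun n \<in> chirp_SIS_pt \<theta> \<phi>" for n by (rule samp_fun_pt[OF \<delta> low])
  show "\<exists>A B. 0 < A \<and> A \<le> B \<and> (\<forall>h\<in>chirp_SIS_pt \<theta> \<phi>. ennreal A * L2_norm_sq h \<le> (\<Sum>\<^sub>\<infinity>n. ennreal ((cmod (L2_inner h (samp_fun n)))\<^sup>2)) \<and>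
     (\<Sum>\<^sub>\<infinity>n. ennreal ((cmod (L2_inner h (samp_fun n)))\<^sup>2)) \<le> ennreal B * L2_norm_sq h)"
  proof (rule exI[of _ lower_const], rule exI[of _ "max lower_const upper_const"], intro conjI ballI)
    fix h assume hV: "h \<in> chirp_SIS_pt \<theta> \<phi>"
    have h: "sq_int lebesgue h" by (rule pt_sq_int[OF hV])
    define \<alpha> where "\<alpha> n = iprod lebesgue h (samp_fun n)" for n
    have L2i: "L2_inner h (samp_fun n) = \<alpha> n" for n by (simp add: L2_inner_def \<alpha>_def iprod_def)
    have bes: "(\<Sum>n\<in>F. (cmod (\<alpha> n))\<^sup>2) \<le> upper_const * (L2norm lebesgue h)\<^sup>2" if "finite F" for F
      unfolding \<alpha>_def using samp_fun_synthesis_upper[OF \<delta> low that]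
      by (intro Bessel_from_synthesis samp_fun_sq_int[OF \<delta> low] upper_const_nonneg h) (simp add: upper_const_def)
    have \<alpha>: "l2_seq \<alpha>" using bes by (rule l2_seq_bounded)
    have "(\<Sum>\<^sub>\<infinity>n. ennreal ((cmod (\<alpha> n))\<^sup>2)) \<le> ennreal (max lower_const upper_const * (L2norm lebesgue h)\<^sup>2)"
    proof (rule infsum_ennreal_le)
      fix F :: "int set" assume F: "finite F"
      have "upper_const * (L2norm lebesgue h)\<^sup>2 \<le> max lower_const upper_const * (L2norm lebesgue h)\<^sup>2" by (intro mult_right_mono) auto
      with bes[OF F] show "(\<Sum>n\<in>F. (cmod (\<alpha> n))\<^sup>2) \<le> max lower_const upper_const * (L2norm lebesgue h)\<^sup>2" by linarith
    qed (use lower_const_pos in \<open>auto simp: le_max_iff_disj\<close>)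
    also have "\<dots> = ennreal (max lower_const upper_const) * L2_norm_sq h"
      using lower_const_pos by (simp add: L2_norm_sq_sq_norm sq_norm_L2norm[OF h] ennreal_mult' max.coboundedI1 less_imp_le)
    finally show "(\<Sum>\<^sub>\<infinity>n. ennreal ((cmod (L2_inner h (samp_fun n)))\<^sup>2)) \<le> ennreal (max lower_const upper_const) * L2_norm_sq h" by (simp only: L2i)
    obtain d where d: "l2_seq d" "h = from_symbol (over_symbol (fourier_sum w d))" "\<And>n. h (\<sigma> + of_int n) = dechirp d n"
      using pt_coefficients[OF hV] by metis
    define a where "a n = dechirp d n" for n
    have a: "l2_seq a" "l2sq a = l2sq d" unfolding a_def using d(1) by (simp_all add: unimodular_l2)
    let ?N = "(L2norm lebesgue h)\<^sup>2"
    have N: "lower_const * l2sq a \<le> ?N" using synthesis_bounds(1)[OF d(1)] by (simp add: lower_const_def a d(2))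
    have "((\<lambda>F. iprod lebesgue (\<lambda>t. \<Sum>n\<in>F. a n * samp_fun n t) h) \<longlongrightarrow> iprod lebesgue h h) fsets"
    proof (rule L2_conv_iprod[OF _ h h])
      show "sq_int lebesgue (\<lambda>t. \<Sum>n\<in>F. a n * samp_fun n t)" for F by (intro sq_int_sum sq_int_cmult samp_fun_sq_int[OF \<delta> low])
      show "L2_conv lebesgue (\<lambda>F t. \<Sum>n\<in>F. a n * samp_fun n t) h fsets"
        using synthesis_L2[OF d(1)] by (simp add: L2_has_sum_def L2_conv_def L2_norm_sq_sq_norm a_def d(2))
    qed
    from tendsto_norm[OF this] have lim: "((\<lambda>F. cmod (iprod lebesgue (\<lambda>t. \<Sum>n\<in>F. a n * samp_fun n t) h)) \<longlongrightarrow> cmod (iprod lebesgue h h)) fsets" .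
    have "cmod (iprod lebesgue h h) \<le> sqrt (l2sq a) * sqrt (l2sq \<alpha>)"
    proof (rule tendsto_upperbound[OF lim _ finite_subsets_at_top_neq_bot], rule eventually_finite_subsets_at_top_weakI)
      fix F :: "int set" assume F: "finite F"
      have "iprod lebesgue (\<lambda>t. \<Sum>n\<in>F. a n * samp_fun n t) h = (\<Sum>n\<in>F. a n * cnj (\<alpha> n))"
        by (subst iprod_sum_left) (simp_all add: samp_fun_sq_int[OF \<delta> low] sq_int_cmult h iprod_cmult_left \<alpha>_def iprod_cnj)
      also have "cmod \<dots> \<le> sqrt (\<Sum>n\<in>F. (cmod (a n))\<^sup>2) * sqrt (\<Sum>n\<in>F. (cmod (cnj (\<alpha> n)))\<^sup>2)" by (rule l2_mult_bound_finite)
      also have "\<dots> \<le> sqrt (l2sq a) * sqrt (l2sq \<alpha>)"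
        unfolding complex_mod_cnj by (intro mult_mono real_sqrt_le_mono l2sq_ge_sum a \<alpha> F) (simp_all add: sum_nonneg)
      finally show "cmod (iprod lebesgue (\<lambda>t. \<Sum>n\<in>F. a n * samp_fun n t) h) \<le> sqrt (l2sq a) * sqrt (l2sq \<alpha>)" .
    qed
    moreover have "cmod (iprod lebesgue h h) = ?N" unfolding iprod_self[OF h] norm_of_real by simp
    ultimately have "?N\<^sup>2 \<le> (sqrt (l2sq a) * sqrt (l2sq \<alpha>))\<^sup>2" by (intro power_mono) auto
    also have "\<dots> = l2sq a * l2sq \<alpha>" by (simp add: power_mult_distrib)
    also have "\<dots> \<le> ?N / lower_const * l2sq \<alpha>" using N lower_const_pos by (intro mult_right_mono) (auto simp: field_simps)
    finally have "?N * ?N \<le> (l2sq \<alpha> / lower_const) * ?N" by (simp add: power2_eq_square mult_ac)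
    moreover have "0 \<le> l2sq \<alpha> / lower_const" using lower_const_pos by simp
    ultimately have "?N \<le> l2sq \<alpha> / lower_const" by (rule cancel_self_mult_le) simp
    then have "lower_const * ?N \<le> l2sq \<alpha>" using lower_const_pos by (simp add: field_simps)
    then have "ennreal (lower_const * ?N) \<le> ennreal (l2sq \<alpha>)" by (rule ennreal_leI)
    then show "ennreal lower_const * L2_norm_sq h \<le> (\<Sum>\<^sub>\<infinity>n. ennreal ((cmod (L2_inner h (samp_fun n)))\<^sup>2))"
      using lower_const_pos by (simp add: L2_norm_sq_sq_norm sq_norm_L2norm[OF h] ennreal_mult' L2i l2_norm_sq_l2sq[OF \<alpha>, unfolded l2_norm_sq_def])
  qed (use lower_const_pos in auto)
qed

end

end

text \<open>
The frame enters the first step only through its upper bound and the second only through its lower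
bound.
\<close>
lemma frame_symbol_bounds:
  assumes S: "L2_frame (chirp_SIS_pt \<theta> \<phi>) S" and samp: "sampling_expansion \<theta> \<phi> \<sigma> S"
  shows "\<exists>\<delta> M. 0 < \<delta> \<and> 0 < M \<and> (AE \<xi> in torus w. \<delta> \<le> cmod (symbol \<xi>)) \<and> (AE \<xi> in torus w. cmod (symbol \<xi>) \<le> M)"
proof -
  from S obtain A' B' where SV: "\<And>n. S n \<in> chirp_SIS_pt \<theta> \<phi>" and A': "0 < A'" "A' \<le> B'"
    and lo: "\<And>h. h \<in> chirp_SIS_pt \<theta> \<phi> \<Longrightarrow> ennreal A' * L2_norm_sq h \<le> (\<Sum>\<^sub>\<infinity>n. ennreal ((cmod (L2_inner h (S n)))\<^sup>2))"
    and hi: "\<And>h. h \<in> chirp_SIS_pt \<theta> \<phi> \<Longrightarrow> (\<Sum>\<^sub>\<infinity>n. ennreal ((cmod (L2_inner h (S n)))\<^sup>2)) \<le> ennreal B' * L2_norm_sq h"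
    unfolding L2_frame_def by blast
  have Si: "sq_int lebesgue (S n)" for n by (rule pt_sq_int[OF SV])
  have inn: "L2_inner h g = iprod lebesgue h g" for h g by (simp add: L2_inner_def iprod_def)
  have B'0: "0 \<le> B'" using A' by simp
  have "\<exists>\<delta>>0. AE \<xi> in torus w. \<delta> \<le> cmod (symbol \<xi>)"
  proof (rule symbol_lower_bound[OF samp Si B'0])
    fix F :: "int set" and a :: "int \<Rightarrow> complex" assume F: "finite F"
    let ?g = "\<lambda>t. \<Sum>n\<in>F. a n * S n t"
    have gV: "?g \<in> chirp_SIS_pt \<theta> \<phi>" by (rule pt_sum[OF SV])
    have "ennreal (\<Sum>n\<in>F. (cmod (iprod lebesgue ?g (S n)))\<^sup>2) \<le> (\<Sum>\<^sub>\<infinity>n. ennreal ((cmod (iprod lebesgue ?g (S n)))\<^sup>2))"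
      by (rule infsum_ennreal_ge[OF F]) simp
    also have "\<dots> \<le> ennreal B' * sq_norm lebesgue ?g" using hi[OF gV] by (simp only: inn L2_norm_sq_sq_norm)
    also have "\<dots> = ennreal (B' * (L2norm lebesgue ?g)\<^sup>2)" by (simp only: sq_norm_L2norm[OF pt_sq_int[OF gV]] ennreal_mult'[OF B'0])
    finally have "(\<Sum>n\<in>F. (cmod (iprod lebesgue ?g (S n)))\<^sup>2) \<le> B' * (L2norm lebesgue ?g)\<^sup>2"
      by (subst (asm) ennreal_le_iff) (use B'0 in auto)
    then show "(L2norm lebesgue ?g)\<^sup>2 \<le> B' * (\<Sum>n\<in>F. (cmod (a n))\<^sup>2)"
      by (rule synthesis_from_Bessel[OF Si B'0])
  qed
  then obtain \<delta> where \<delta>: "\<delta> > 0" "AE \<xi> in torus w. \<delta> \<le> cmod (symbol \<xi>)" by blast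
  have "S = samp_fun" by (rule sampling_unique[OF \<delta> samp])
  then have "\<exists>M>0. AE \<xi> in torus w. cmod (symbol \<xi>) \<le> M"
    using lo by (intro symbol_upper_bound_frame[OF \<delta> A'(1)]) (simp only: inn L2_norm_sq_sq_norm)
  with \<delta> show ?thesis by blast
qed

text \<open>
For finitely supported coefficients the limit in the definition of a Riesz basis is, up to a null
set, the finite sum itself; finite sums are all that the two steps require.
\<close>
lemma riesz_symbol_bounds:
  assumes S: "L2_riesz_basis (chirp_SIS_pt \<theta> \<phi>) S" and samp: "sampling_expansion \<theta> \<phi> \<sigma> S"
  shows "\<exists>\<delta> M. 0 < \<delta> \<and> 0 < M \<and> (AE \<xi> in torus w. \<delta> \<le> cmod (symbol \<xi>)) \<and> (AE \<xi> in torus w. cmod (symbol \<xi>) \<le> M)"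
proof -
  from S obtain A' B' where SV: "\<And>n. S n \<in> chirp_SIS_pt \<theta> \<phi>" and A': "0 < A'" "A' \<le> B'"
    and bd: "\<And>c. l2_seq c \<Longrightarrow> \<exists>g. L2_fun g \<and> L2_has_sum (\<lambda>n t. c n * S n t) g \<and>
              ennreal A' * l2_norm_sq c \<le> L2_norm_sq g \<and> L2_norm_sq g \<le> ennreal B' * l2_norm_sq c"
    unfolding L2_riesz_basis_def by blast
  have Si: "sq_int lebesgue (S n)" for n by (rule pt_sq_int[OF SV])
  have B'0: "0 \<le> B'" using A' by simp
  have fin: "A' * (\<Sum>n\<in>F. (cmod (a n))\<^sup>2) \<le> (L2norm lebesgue (\<lambda>t. \<Sum>n\<in>F. a n * S n t))\<^sup>2 \<and>
      (L2norm lebesgue (\<lambda>t. \<Sum>n\<in>F. a n * S n t))\<^sup>2 \<le> B' * (\<Sum>n\<in>F. (cmod (a n))\<^sup>2)" if F: "finite F" for F a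
  proof -
    define c where "c n = (if n \<in> F then a n else 0)" for n
    let ?s = "\<Sum>n\<in>F. (cmod (a n))\<^sup>2" and ?g = "\<lambda>t. \<Sum>n\<in>F. a n * S n t"
    have g: "sq_int lebesgue ?g" by (intro sq_int_sum sq_int_cmult Si)
    have "((\<lambda>n. (cmod (c n))\<^sup>2) has_sum ?s) UNIV"
      using F by (intro has_sum_finite_neutralI[of F]) (auto simp: c_def)
    then have c: "l2_seq c" "l2sq c = ?s" by (auto simp: l2_seq_summable l2sq_def summable_on_def infsumI)
    obtain g' where g': "L2_fun g'" "L2_has_sum (\<lambda>n t. c n * S n t) g'"
       "ennreal A' * l2_norm_sq c \<le> L2_norm_sq g'" "L2_norm_sq g' \<le> ennreal B' * l2_norm_sq c" using bd[OF c(1)] by blast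
    have ev: "\<forall>\<^sub>F F' in fsets. (\<lambda>t. \<Sum>n\<in>F'. c n * S n t) = ?g"
      unfolding eventually_finite_subsets_at_top
    proof (intro exI[of _ F] conjI allI impI F ext)
      fix F' t assume F': "finite F' \<and> F \<subseteq> F' \<and> F' \<subseteq> UNIV"
      show "(\<Sum>n\<in>F'. c n * S n t) = ?g t"
        using F' by (intro sum.mono_neutral_cong_right) (auto simp: c_def)
    qed auto
    have "\<forall>\<^sub>F F' in fsets. L2_norm_sq (\<lambda>t. g' t - (\<Sum>n\<in>F'. c n * S n t)) = sq_norm lebesgue (\<lambda>t. g' t - ?g t)"
      using ev
    proof eventually_elim
      case (elim F')
      then have "(\<Sum>n\<in>F'. c n * S n t) = ?g t" for t by (rule fun_cong)
      then show ?case by (simp only: L2_norm_sq_sq_norm)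
    qed
    then have "((\<lambda>F'::int set. sq_norm lebesgue (\<lambda>t. g' t - ?g t)) \<longlongrightarrow> 0) fsets"
      using g'(2) unfolding L2_has_sum_def by (rule Lim_transform_eventually[rotated])
    then have "sq_norm lebesgue (\<lambda>t. g' t - ?g t) = 0"
      by (rule tendsto_unique[OF finite_subsets_at_top_neq_bot tendsto_const])
    then have "AE t in lebesgue. g' t - ?g t = 0"
      using g'(1) g by (subst sq_norm_eq_0[symmetric]) (auto simp: L2_fun_sq_int intro!: sq_intD sq_int_diff)
    then have "AE t in lebesgue. g' t = ?g t" by eventually_elim simp
    then have "L2_norm_sq g' = sq_norm lebesgue ?g" unfolding L2_norm_sq_sq_norm by (rule sq_norm_cong_AE)
    then have e: "L2_norm_sq g' = ennreal ((L2norm lebesgue ?g)\<^sup>2)" by (simp only: sq_norm_L2norm[OF g])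
    have s0: "0 \<le> ?s" by (simp add: sum_nonneg)
    have "ennreal (A' * ?s) \<le> ennreal ((L2norm lebesgue ?g)\<^sup>2)" "ennreal ((L2norm lebesgue ?g)\<^sup>2) \<le> ennreal (B' * ?s)"
      using g'(3,4) unfolding e l2_norm_sq_l2sq[OF c(1)] c(2) using A' B'0 by (simp_all only: ennreal_mult' less_imp_le)
    then show ?thesis using B'0 s0 by (simp add: ennreal_le_iff)
  qed
  have "\<exists>\<delta>>0. AE \<xi> in torus w. \<delta> \<le> cmod (symbol \<xi>)"
    by (rule symbol_lower_bound[OF samp Si B'0]) (use fin in blast)
  then obtain \<delta> where \<delta>: "\<delta> > 0" "AE \<xi> in torus w. \<delta> \<le> cmod (symbol \<xi>)" by blast
  have "S = samp_fun" by (rule sampling_unique[OF \<delta> samp])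
  then have "\<exists>M>0. AE \<xi> in torus w. cmod (symbol \<xi>) \<le> M"
    using fin by (intro symbol_upper_bound_Riesz[OF \<delta> A'(1)]) blast
  with \<delta> show ?thesis by blast
qed

text \<open>
Only the constant $|\kappa|$ separates the two sides. The two bounds on the symbol are stated
independently, whereas those on the Zak transform have to be ordered.
\<close>
lemma zak_bounds_iff:
  "(\<exists>\<alpha> \<beta>::real. 0 < \<alpha> \<and> \<alpha> \<le> \<beta> \<and>
      (AE \<xi> in lebesgue. \<xi> \<in> {0..frft_Delta \<theta>} \<longrightarrow>
         \<alpha> \<le> cmod (zak \<theta> \<phi> \<sigma> \<xi>) \<and> cmod (zak \<theta> \<phi> \<sigma> \<xi>) \<le> \<beta>))
   \<longleftrightarrow> (\<exists>\<delta> M. 0 < \<delta> \<and> 0 < M \<and> (AE \<xi> in torus w. \<delta> \<le> cmod (symbol \<xi>)) \<and> (AE \<xi> in torus w. cmod (symbol \<xi>) \<le> M))"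
  (is "?L \<longleftrightarrow> ?R")
proof -
  have zn: "AE \<xi> in torus w. cmod (zak \<theta> \<phi> \<sigma> \<xi>) = cmod \<kappa> * cmod (symbol \<xi>)"
  proof -
    have "AE \<xi> in lebesgue. cmod (zak \<theta> \<phi> \<sigma> \<xi>) = cmod \<kappa> * cmod (symbol \<xi>)"
      using zak_eq by eventually_elim (simp add: norm_mult)
    then show ?thesis unfolding AE_torus_iff by eventually_elim simp
  qed
  show ?thesis
  proof
    assume ?L
    then obtain \<alpha> \<beta> where ab: "0 < \<alpha>" "\<alpha> \<le> \<beta>" and "AE \<xi> in torus w. \<alpha> \<le> cmod (zak \<theta> \<phi> \<sigma> \<xi>) \<and> cmod (zak \<theta> \<phi> \<sigma> \<xi>) \<le> \<beta>"
      unfolding AE_torus_iff Delta by blast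
    from this(3) zn have b: "AE \<xi> in torus w. \<alpha> / cmod \<kappa> \<le> cmod (symbol \<xi>) \<and> cmod (symbol \<xi>) \<le> \<beta> / cmod \<kappa>"
    proof eventually_elim
      case (elim \<xi>)
      then show ?case using kappa_pos by (simp add: pos_divide_le_eq pos_le_divide_eq mult.commute)
    qed
    have "AE \<xi> in torus w. \<alpha> / cmod \<kappa> \<le> cmod (symbol \<xi>)" "AE \<xi> in torus w. cmod (symbol \<xi>) \<le> \<beta> / cmod \<kappa>"
      using b by (eventually_elim, simp)+
    moreover have "0 < \<alpha> / cmod \<kappa>" "0 < \<beta> / cmod \<kappa>" using ab kappa_pos by auto
    ultimately show ?R by blast
  next
    assume ?R
    then obtain \<delta> M where dM: "0 < \<delta>" "0 < M" "AE \<xi> in torus w. \<delta> \<le> cmod (symbol \<xi>)" "AE \<xi> in torus w. cmod (symbol \<xi>) \<le> M" by blast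
    have "AE \<xi> in torus w. cmod \<kappa> * \<delta> \<le> cmod (zak \<theta> \<phi> \<sigma> \<xi>) \<and> cmod (zak \<theta> \<phi> \<sigma> \<xi>) \<le> cmod \<kappa> * max \<delta> M"
      using dM(3,4) zn
    proof eventually_elim
      case (elim \<xi>)
      then show ?case using kappa_pos by (auto intro!: mult_left_mono)
    qed
    moreover have "0 < cmod \<kappa> * \<delta>" "cmod \<kappa> * \<delta> \<le> cmod \<kappa> * max \<delta> M"
      using kappa_pos dM by (auto intro!: mult_left_mono)
    ultimately show ?L unfolding AE_torus_iff Delta by blast
  qed
qed

end

section \<open>The sampling theorem\<close>

theorem theorem4p4:
  fixes \<theta> \<sigma> :: real and \<phi> :: "real \<Rightarrow> complex"
  assumes theta: "\<And>k::int. \<theta> \<noteq> of_int k * pi"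
    and phi: "L2_fun \<phi>"
    and G_bounds: "\<exists>A B::real. 0 < A \<and> A \<le> B \<and>
      (AE \<xi> in lebesgue. \<xi> \<in> {0..frft_Delta \<theta>} \<longrightarrow>
         ennreal A \<le> G_fun \<theta> \<phi> \<xi> \<and> G_fun \<theta> \<phi> \<xi> \<le> ennreal B)"
    and C_finite: "\<And>t. C_fun \<theta> \<phi> t < \<infinity>"
    and sigma: "0 \<le> \<sigma>" "\<sigma> < 1"
  defines "a_holds \<equiv> (\<lambda>S. L2_frame (chirp_SIS_pt \<theta> \<phi>) S \<and> sampling_expansion \<theta> \<phi> \<sigma> S)"
    and "b_holds \<equiv> (\<lambda>S. L2_riesz_basis (chirp_SIS_pt \<theta> \<phi>) S \<and> sampling_expansion \<theta> \<phi> \<sigma> S)"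
    and "c_holds \<equiv> (\<exists>\<alpha> \<beta>::real. 0 < \<alpha> \<and> \<alpha> \<le> \<beta> \<and>
      (AE \<xi> in lebesgue. \<xi> \<in> {0..frft_Delta \<theta>} \<longrightarrow>
         \<alpha> \<le> cmod (zak \<theta> \<phi> \<sigma> \<xi>) \<and> cmod (zak \<theta> \<phi> \<sigma> \<xi>) \<le> \<beta>))"
  shows "((\<exists>S. a_holds S) \<longleftrightarrow> (\<exists>S. b_holds S)) \<and>
         ((\<exists>S. b_holds S) \<longleftrightarrow> c_holds) \<and>
         (\<forall>S. a_holds S \<or> b_holds S \<longrightarrow>
            (\<forall>f \<in> chirp_SIS_pt \<theta> \<phi>.
               L2_has_sum (\<lambda>n t. f (\<sigma> + of_int n) * S n t) f \<and>
               (\<forall>X. (\<exists>M::real. \<forall>t\<in>X. C_fun \<theta> \<phi> t \<le> ennreal M) \<longrightarrow>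
                  uniform_limit X (\<lambda>F t. \<Sum>n\<in>F. f (\<sigma> + of_int n) * S n t) f
                    (finite_subsets_at_top UNIV))) \<and>
            (\<exists>S0 \<in> chirp_SIS_pt \<theta> \<phi>.
               (AE \<xi> in lebesgue. frft \<theta> S0 \<xi> =
                  cnj (frft_c \<theta>) * frft \<theta> \<phi> \<xi> / (chirp \<theta> \<xi> * zak \<theta> \<phi> \<sigma> \<xi>)) \<and>
               (\<forall>n t. S n t = cnj (chirp \<theta> t) * chirp \<theta> (\<sigma> + of_int n)
                                * chirp \<theta> (t - of_int n) * S0 (t - of_int n))) \<and>
            (\<forall>n k. S n (\<sigma> + of_int k) = (if n = k then 1 else 0)))"
proof -
  have sin: "sin \<theta> \<noteq> 0"
    using theta sin_zero_iff_int2[of \<theta>] by blast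
  obtain A B where AB: "0 < A" "A \<le> B" and G: "AE \<xi> in lebesgue. \<xi> \<in> {0..frft_Delta \<theta>} \<longrightarrow>
         ennreal A \<le> G_fun \<theta> \<phi> \<xi> \<and> G_fun \<theta> \<phi> \<xi> \<le> ennreal B"
    using G_bounds by blast
  interpret chirp_sampling \<theta> \<phi> A B \<sigma>
    by unfold_locales (rule sin phi[unfolded L2_fun_sq_int] AB G C_finite)+
  define bounds where "bounds \<delta> M \<longleftrightarrow> 0 < \<delta> \<and> 0 < M \<and> (AE \<xi> in torus w. \<delta> \<le> cmod (symbol \<xi>)) \<and> (AE \<xi> in torus w. cmod (symbol \<xi>) \<le> M)" for \<delta> M
  have c: "c_holds \<longleftrightarrow> (\<exists>\<delta> M. bounds \<delta> M)"
    unfolding c_holds_def bounds_def by (rule zak_bounds_iff)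
  have nec: "\<exists>\<delta> M. bounds \<delta> M" if "a_holds S \<or> b_holds S" for S
    using that frame_symbol_bounds riesz_symbol_bounds unfolding a_holds_def b_holds_def bounds_def by blast
  have suf: "a_holds samp_fun \<and> b_holds samp_fun" if "bounds \<delta> M" for \<delta> M
    using that samp_fun_frame samp_fun_riesz samp_fun_sampling unfolding a_holds_def b_holds_def bounds_def by blast
  have equiv: "((\<exists>S. a_holds S) \<longleftrightarrow> (\<exists>S. b_holds S)) \<and> ((\<exists>S. b_holds S) \<longleftrightarrow> c_holds)"
    unfolding c using nec suf by blast
  have "(\<forall>f \<in> chirp_SIS_pt \<theta> \<phi>.
               L2_has_sum (\<lambda>n t. f (\<sigma> + of_int n) * S n t) f \<and>
               (\<forall>X. (\<exists>M::real. \<forall>t\<in>X. C_fun \<theta> \<phi> t \<le> ennreal M) \<longrightarrow>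
                  uniform_limit X (\<lambda>F t. \<Sum>n\<in>F. f (\<sigma> + of_int n) * S n t) f
                    (finite_subsets_at_top UNIV))) \<and>
            (\<exists>S0 \<in> chirp_SIS_pt \<theta> \<phi>.
               (AE \<xi> in lebesgue. frft \<theta> S0 \<xi> =
                  cnj (frft_c \<theta>) * frft \<theta> \<phi> \<xi> / (chirp \<theta> \<xi> * zak \<theta> \<phi> \<sigma> \<xi>)) \<and>
               (\<forall>n t. S n t = cnj (chirp \<theta> t) * chirp \<theta> (\<sigma> + of_int n)
                                * chirp \<theta> (t - of_int n) * S0 (t - of_int n))) \<and>
            (\<forall>n k. S n (\<sigma> + of_int k) = (if n = k then 1 else 0))"
    if S: "a_holds S \<or> b_holds S" for S
  proof -
    obtain \<delta> M where "bounds \<delta> M" using nec[OF S] by blast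
    then have d: "0 < \<delta>" "AE \<xi> in torus w. \<delta> \<le> cmod (symbol \<xi>)" and M: "0 < M" "AE \<xi> in torus w. cmod (symbol \<xi>) \<le> M"
      by (auto simp: bounds_def)
    have "S = samp_fun" using S sampling_unique[OF d] unfolding a_holds_def b_holds_def by blast
    then show ?thesis
      using sampling_L2[OF d M] sampling_uniform[OF d M] samp_gen_pt[OF d] frft_samp_gen[OF d] samp_fun_translate[OF d] samp_fun_sample[OF d]
      by blast
  qed
  with equiv show ?thesis by blast
qed

end
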